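(* Fix $\lambda>0$ and $z>0$, and let $T$ be a stopping time with respect to $\mathbb{F}^{\xi^{\lambda,z},c}$. Then $$T=T_{\{T=\sigma_z^\lambda\}}\wedge T_{\{T\neq\sigma_z^\lambda\}},$$ where $T_{\{T=\sigma_z^\lambda\}}$ is totally inaccessible and $T_{\{T\ne\sigma_z^\lambda\}}$ is predictable.
   Context: Let $B=(B_t)_{t\ge 0}$ be a standard Brownian motion started at $0$ on a complete probability space $(\Omega,\mathcal{F},\mathbb{P})$, with $\mathcal{N}_{\mathbb{P}}$ the collection of $\mathbb{P}$-null sets. For $\lambda>0$, $z>0$, put $B^\lambda_t=B_t+\lambda t$, $\sigma_z^\lambda=\sup\{t>0: B^\lambda_t=z\}$ (almost surely finite), and $\xi^{\lambda,z}_t=B^\lambda_{t\wedge\sigma_z^\lambda}$, $t\ge 0$. The completed natural filtration is $\mathbb{F}^{\xi^{\lambda,z},c}$ with $\mathcal{F}^{\xi^{\lambda,z},c}_t=\sigma(\xi^{\lambda,z}_s,\,s\le t)\vee\mathcal{N}_{\mathbb{P}}$; $\sigma_z^\lambda$ is a stopping time of this filtration. For an event $C$, the restriction $T_C$ of $T$ to $C$ equals $T$ on $C$ and $+\infty$ off $C$. A stopping time $T$ is totally inaccessible if $\mathbb{P}(T=S<\infty)=0$ for every predictable stopping time $S$. *)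

theory Defs
  imports "HOL-Probability.Probability"
begin

text \<open>
  Processes are indexed by real numbers, of which only the nonnegative ones matter.
  Random times take values in \<open>[0, \<infinity>]\<close>, i.e. in the type \<^typ>\<open>ennreal\<close>; filtrations are
  indexed by \<^typ>\<open>ennreal\<close> as well, so that the constant \<^const>\<open>stopping_time\<close> of the library
  applies to times that may be infinite (its condition at the index \<open>\<infinity>\<close> is void).
\<close>

definition brownian_motion :: "'a measure \<Rightarrow> (real \<Rightarrow> 'a \<Rightarrow> real) \<Rightarrow> bool" where
  "brownian_motion M B \<longleftrightarrow>
     (\<forall>t\<ge>0. B t \<in> borel_measurable M) \<and>
     (AE \<omega> in M. B 0 \<omega> = 0) \<and>
     (AE \<omega> in M. continuous_on {0..} (\<lambda>t. B t \<omega>)) \<and>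
     (\<forall>s t. 0 \<le> s \<and> s < t \<longrightarrow>
        distributed M lborel (\<lambda>\<omega>. B t \<omega> - B s \<omega>)
          (\<lambda>x. ennreal (normal_density 0 (sqrt (t - s)) x))) \<and>
     (\<forall>(n::nat) u. 0 \<le> u 0 \<and> (\<forall>i<n. u i < u (Suc i)) \<longrightarrow>
        prob_space.indep_vars M (\<lambda>_. borel) (\<lambda>i \<omega>. B (u (Suc i)) \<omega> - B (u i) \<omega>) {..<n})"

definition drifted :: "(real \<Rightarrow> 'a \<Rightarrow> real) \<Rightarrow> real \<Rightarrow> real \<Rightarrow> 'a \<Rightarrow> real" where
  "drifted B \<mu> t \<omega> = B t \<omega> + \<mu> * t"

text \<open>The supremum is taken in \<open>[0, \<infinity>]\<close>: it is \<open>0\<close> if the level is never reached at a positive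
  time and \<open>\<infinity>\<close> if the visits are unbounded.\<close>

definition last_passage :: "(real \<Rightarrow> 'a \<Rightarrow> real) \<Rightarrow> real \<Rightarrow> real \<Rightarrow> 'a \<Rightarrow> ennreal" where
  "last_passage B \<mu> z \<omega> = Sup {ennreal t | t. 0 < t \<and> drifted B \<mu> t \<omega> = z}"

definition stopped_drifted :: "(real \<Rightarrow> 'a \<Rightarrow> real) \<Rightarrow> real \<Rightarrow> real \<Rightarrow> real \<Rightarrow> 'a \<Rightarrow> real" where
  "stopped_drifted B \<mu> z t \<omega> =
     drifted B \<mu> (enn2real (min (ennreal t) (last_passage B \<mu> z \<omega>))) \<omega>"

definition completed_natural_filtration ::
    "'a measure \<Rightarrow> (real \<Rightarrow> 'a \<Rightarrow> real) \<Rightarrow> ennreal \<Rightarrow> 'a measure" where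
  "completed_natural_filtration M X t =
     sigma (space M)
       ({X s -` A \<inter> space M | s A. 0 \<le> s \<and> ennreal s \<le> t \<and> A \<in> sets borel} \<union> null_sets M)"

lemma filtration_completed_natural_filtration:
  "filtration (space M) (completed_natural_filtration M X)"
proof
  have closed: "{X s -` A \<inter> space M | s A. 0 \<le> s \<and> ennreal s \<le> t \<and> A \<in> sets borel} \<union> null_sets M
      \<subseteq> Pow (space M)" for t
    using sets.sets_into_space by (force simp: null_sets_def)
  show "space (completed_natural_filtration M X i) = space M" for i
    unfolding completed_natural_filtration_def by (rule space_measure_of[OF closed])
  show "sets (completed_natural_filtration M X i) \<le> sets (completed_natural_filtration M X j)"
    if "i \<le> j" for i j
    unfolding completed_natural_filtration_def sets_measure_of[OF closed]
    by (rule sigma_sets_mono') (use that order_trans in blast)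
qed

definition restrict_time :: "('a \<Rightarrow> ennreal) \<Rightarrow> 'a set \<Rightarrow> 'a \<Rightarrow> ennreal" where
  "restrict_time T C \<omega> = (if \<omega> \<in> C then T \<omega> else \<infinity>)"

text \<open>Predictability is the existence of an announcing sequence, required almost surely. For
  filtrations whose members contain all null sets, as above, a sequence announcing almost surely
  can be modified on a null set so that it announces everywhere.\<close>

definition predictable_time ::
    "'a measure \<Rightarrow> (ennreal \<Rightarrow> 'a measure) \<Rightarrow> ('a \<Rightarrow> ennreal) \<Rightarrow> bool" where
  "predictable_time M F T \<longleftrightarrow>
     stopping_time F T \<and>
     (\<exists>S :: nat \<Rightarrow> 'a \<Rightarrow> ennreal.
        (\<forall>n. stopping_time F (S n)) \<and>
        (AE \<omega> in M. incseq (\<lambda>n. S n \<omega>) \<and>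
                    (0 < T \<omega> \<longrightarrow> (\<forall>n. S n \<omega> < T \<omega>)) \<and>
                    (\<lambda>n. S n \<omega>) \<longlonglongrightarrow> T \<omega>))"

definition totally_inaccessible_time ::
    "'a measure \<Rightarrow> (ennreal \<Rightarrow> 'a measure) \<Rightarrow> ('a \<Rightarrow> ennreal) \<Rightarrow> bool" where
  "totally_inaccessible_time M F T \<longleftrightarrow>
     stopping_time F T \<and>
     (\<forall>S. predictable_time M F S \<longrightarrow> {\<omega> \<in> space M. T \<omega> = S \<omega> \<and> S \<omega> < \<infinity>} \<in> null_sets M)"

end

theory Submission
  imports Defs
begin

text \<open>
  Let \<open>G\<close> be the completed filtration of \<open>B\<close>. On \<open>{t < \<sigma>}\<close> the filtrations of \<open>\<xi>\<close> and of \<open>B\<close> have the same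
  trace, so every \<open>\<xi>\<close>-stopping time agrees with a \<open>G\<close>-stopping time strictly before \<open>\<sigma>\<close>. Two facts about \<open>G\<close>
  then suffice. First, a \<open>G\<close>-stopping time almost surely never equals \<open>\<sigma> < \<infinity>\<close>: by the strong Markov property
  and Blumenthal's zero-one law the path takes values on both sides immediately after it, whereas after \<open>\<sigma>\<close>
  it stays on one side of the level. Applied to the supremum of an announcing sequence this makes \<open>\<sigma>\<close> totally
  inaccessible. Second, \<open>G\<close>-stopping times are predictable. Events of \<open>G\<close> are approximated in \<open>L\<^sup>1\<close> by Lipschitz
  functionals of finitely many path values, whose conditional expectations are explicit and continuous in time;
  hence, along a fine mesh, the conditional probability that \<open>\<tau>\<close> falls into a given short interval is close to 1
  at the last mesh point before \<open>\<tau>\<close>, and stopping there announces \<open>\<tau>\<close> up to a small error. After \<open>\<sigma>\<close>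
  everything is known and a time can be approached directly.
\<close>

section \<open>Completed natural filtrations\<close>

text \<open>\<open>\<sigma>\<close> looks into the future of \<open>B\<close>, so conditional laws
  given \<open>F\<close> have no simple form. Every computation is therefore made in
  \<open>G\<close>, where the increments after a fixed time are independent of the past, and is
  carried to \<open>F\<close> separately on the two sides of \<open>\<sigma>\<close>. The Lipschitz
  functionals stand in for the continuity of Brownian martingales: conditional expectations of a
  dense family get an explicit modulus of continuity in time. The L1 error of the approximation is
  summed over disjoint events, one for each mesh point, as in the proof of a maximal inequality; its
  size therefore does not grow with the fineness of the mesh. The same approximation makes
  \<open>G\<close> right-continuous, on which both the zero-one law and the construction of
  \<open>G\<close>-versions of \<open>F\<close>-times rest. The two facts about \<open>G\<close>
  meet at the end: an announcing sequence of a \<open>G\<close>-time that is at least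
  \<open>\<sigma>\<close> must eventually pass \<open>\<sigma>\<close> strictly when
  \<open>\<sigma>\<close> is finite, and it does so because the \<open>G\<close>-time almost surely
  differs from \<open>\<sigma>\<close>.\<close>

lemma generators_subset_Pow:
  "{X s -` A \<inter> space M | s A. 0 \<le> s \<and> ennreal s \<le> t \<and> A \<in> sets borel} \<union> null_sets M \<subseteq> Pow (space M)"
  using sets.sets_into_space by (force simp: null_sets_def)

lemma sets_natural_filtration:
  "sets (completed_natural_filtration M X t) =
     sigma_sets (space M)
       ({X s -` A \<inter> space M | s A. 0 \<le> s \<and> ennreal s \<le> t \<and> A \<in> sets borel} \<union> null_sets M)"
  unfolding completed_natural_filtration_def by (rule sets_measure_of[OF generators_subset_Pow])

lemma space_natural_filtration [simp]:
  "space (completed_natural_filtration M X t) = space M"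
  unfolding completed_natural_filtration_def by (rule space_measure_of[OF generators_subset_Pow])

lemma natural_filtration_mono:
  "s \<le> t \<Longrightarrow> sets (completed_natural_filtration M X s) \<subseteq> sets (completed_natural_filtration M X t)"
  using filtration.sets_F_mono[OF filtration_completed_natural_filtration] .

lemma null_sets_in_natural_filtration:
  "N \<in> null_sets M \<Longrightarrow> N \<in> sets (completed_natural_filtration M X t)"
  unfolding sets_natural_filtration by (rule sigma_sets.Basic) simp

lemma measurable_natural_filtration:
  assumes "0 \<le> s" "ennreal s \<le> t"
  shows "X s \<in> borel_measurable (completed_natural_filtration M X t)"
  by (rule measurableI)
    (use assms in \<open>auto simp: sets_natural_filtration intro!: sigma_sets.Basic\<close>)

lemma sets_natural_filtration_subset:
  assumes "\<And>s. 0 \<le> s \<Longrightarrow> X s \<in> borel_measurable M"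
  shows "sets (completed_natural_filtration M X t) \<subseteq> sets M"
  unfolding sets_natural_filtration
  by (rule sets.sigma_sets_subset) (use assms in \<open>auto intro: measurable_sets\<close>)

text \<open>Completeness turns both differences into null sets, and these are generators of every
  member of the filtration. Facts known only almost surely, such as \<open>B 0 = 0\<close> or
  continuity of the paths, enter measurability proofs through this lemma.\<close>

lemma AE_eq_in_natural_filtration:
  assumes "complete_measure M" "A \<in> sets (completed_natural_filtration M X t)"
    and "A' \<subseteq> space M" "AE w in M. w \<in> A \<longleftrightarrow> w \<in> A'"
  shows "A' \<in> sets (completed_natural_filtration M X t)"
proof -
  let ?F = "completed_natural_filtration M X t"
  have A: "A \<subseteq> space M" using sets.sets_into_space[OF assms(2)] by simp
  have n: "{w \<in> space M. \<not> (w \<in> A \<longleftrightarrow> w \<in> A')} \<in> null_sets M"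
    using assms(4) unfolding complete_measure.AE_iff_null_sets[OF assms(1)] .
  have "A' - A \<in> null_sets M" "A - A' \<in> null_sets M"
    by (rule complete_measure.complete2[OF assms(1) _ n]; use A assms(3) in blast)+
  then have "(A - (A - A')) \<union> (A' - A) \<in> sets ?F"
    using assms(2) null_sets_in_natural_filtration by blast
  also have "(A - (A - A')) \<union> (A' - A) = A'" by blast
  finally show ?thesis .
qed

text \<open>At the index \<open>\<infinity>\<close> the event is the whole space, so the finite
  indices carry the entire condition.\<close>

lemma stopping_time_iff:
  fixes T :: "'a \<Rightarrow> ennreal"
  shows "stopping_time (completed_natural_filtration M X) T \<longleftrightarrow>
    (\<forall>t\<ge>0. {w \<in> space M. T w \<le> ennreal t} \<in> sets (completed_natural_filtration M X (ennreal t)))"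
proof
  assume "stopping_time (completed_natural_filtration M X) T"
  then show "\<forall>t\<ge>0. {w \<in> space M. T w \<le> ennreal t} \<in> sets (completed_natural_filtration M X (ennreal t))"
    by (auto simp: stopping_time_def pred_def)
next
  assume *: "\<forall>t\<ge>0. {w \<in> space M. T w \<le> ennreal t} \<in> sets (completed_natural_filtration M X (ennreal t))"
  show "stopping_time (completed_natural_filtration M X) T"
    unfolding stopping_time_def pred_def
  proof
    fix t :: ennreal
    show "{w \<in> space (completed_natural_filtration M X t). T w \<le> t} \<in> sets (completed_natural_filtration M X t)"
    proof (cases t)
      case (real r)
      then show ?thesis using * by simp
    next
      case top
      have "space (completed_natural_filtration M X t) \<in> sets (completed_natural_filtration M X t)"
        by (rule sets.top)
      then show ?thesis using top by simp
    qed
  qed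
qed

lemma Int_stable_vimage: "Int_stable {f -` A \<inter> space M |A. A \<in> sets K}"
proof (rule Int_stableI, clarsimp)
  fix a b assume "a \<in> sets K" "b \<in> sets K"
  then show "\<exists>A. f -` a \<inter> space M \<inter> (f -` b \<inter> space M) = f -` A \<inter> space M \<and> A \<in> sets K"
    by (intro exI[of _ "a \<inter> b"]) auto
qed

text \<open>Sets with an almost sure version in a given sigma-algebra form a sigma-algebra
  themselves, so a comparison of generators is enough.\<close>

lemma sigma_sets_AE_transfer:
  assumes "\<And>A. A \<in> \<G> \<Longrightarrow> \<exists>A'\<in>sigma_sets (space M) \<H>. AE w in M. w \<in> A \<longleftrightarrow> w \<in> A'"
    and "A \<in> sigma_sets (space M) \<G>"
  shows "\<exists>A'\<in>sigma_sets (space M) \<H>. AE w in M. w \<in> A \<longleftrightarrow> w \<in> A'"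
  using assms(2)
proof induction
  case (Basic a)
  then show ?case by (rule assms(1))
next
  case Empty
  then show ?case by (intro bexI[of _ "{}"] sigma_sets.Empty) auto
next
  case (Compl a)
  then obtain a' where a': "a' \<in> sigma_sets (space M) \<H>" "AE w in M. w \<in> a \<longleftrightarrow> w \<in> a'" by blast
  show ?case
    by (rule bexI[of _ "space M - a'"]) (use a' in \<open>auto intro: sigma_sets.Compl\<close>)
next
  case (Union a)
  then obtain a' where a': "\<And>i. a' i \<in> sigma_sets (space M) \<H>" "\<And>i. AE w in M. w \<in> a i \<longleftrightarrow> w \<in> a' i"
    by metis
  show ?case
  proof (rule bexI[of _ "\<Union>i. a' i"])
    have "AE w in M. \<forall>i. w \<in> a i \<longleftrightarrow> w \<in> a' i" using a'(2) by (simp add: AE_all_countable)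
    then show "AE w in M. w \<in> (\<Union>i. a i) \<longleftrightarrow> w \<in> (\<Union>i. a' i)" by eventually_elim auto
  qed (use a' in \<open>auto intro: sigma_sets.Union\<close>)
qed

section \<open>Independence of past and future\<close>

locale brownian_setting = prob_space M + complete_measure M for M :: "'a measure" +
  fixes B :: "real \<Rightarrow> 'a \<Rightarrow> real"
  assumes brownian: "brownian_motion M B"
begin

abbreviation G :: "ennreal \<Rightarrow> 'a measure" where
  "G \<equiv> completed_natural_filtration M B"

lemma complete_measure_M: "complete_measure M" ..

lemma measurable_B [measurable]: "0 \<le> t \<Longrightarrow> B t \<in> borel_measurable M"
  using brownian by (simp add: brownian_motion_def)

lemma B_zero: "AE w in M. B 0 w = 0"
  using brownian by (simp add: brownian_motion_def)

lemma B_continuous: "AE w in M. continuous_on {0..} (\<lambda>t. B t w)"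
  using brownian by (simp add: brownian_motion_def)

lemma B_increment:
  "0 \<le> s \<Longrightarrow> s < t \<Longrightarrow>
    distributed M lborel (\<lambda>w. B t w - B s w) (\<lambda>x. ennreal (normal_density 0 (sqrt (t - s)) x))"
  using brownian by (simp add: brownian_motion_def)

lemma B_indep_increments:
  "0 \<le> u 0 \<Longrightarrow> (\<And>i. i < n \<Longrightarrow> u i < u (Suc i)) \<Longrightarrow>
    indep_vars (\<lambda>_. borel) (\<lambda>i w. B (u (Suc i)) w - B (u i) w) {..<n::nat}"
  using brownian by (simp add: brownian_motion_def)

lemma G_subset: "sets (G t) \<subseteq> sets M"
  by (rule sets_natural_filtration_subset) simp

lemma G_sets_M: "A \<in> sets (G t) \<Longrightarrow> A \<in> sets M"
  using G_subset by blast

text \<open>Brownian independence is given along one increasing grid at a time. Past and future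
  times are merged into such a grid, and the increments before and after \<open>t\<close> form
  disjoint blocks of it; telescoping sums recover both vectors from their blocks. Increments see the
  past only relative to \<open>B 0\<close>. With \<open>max u t\<close> the future vector is 0 at
  every index \<open>u\<close> before \<open>t\<close>, so \<open>U\<close> can be any finite
  set.\<close>

lemma indep_cylinders:
  assumes t: "0 \<le> t" and S: "finite S" "S \<subseteq> {0..t}" and U: "finite U"
  shows "indep_var (PiM S (\<lambda>_. borel)) (\<lambda>w. \<lambda>s\<in>S. B s w - B 0 w)
           (PiM U (\<lambda>_. borel)) (\<lambda>w. \<lambda>u\<in>U. B (max u t) w - B t w)"
proof -
  \<comment> \<open>\<open>0\<close> and \<open>t\<close> are added because they are the base points
    of the two vectors; \<open>idx\<close> then finds the position of each time in the sorted grid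
    \<open>u\<close>.\<close>
  define W where "W = {0, t} \<union> S \<union> (\<lambda>u. max u t) ` U"
  define u where "u = (!) (sorted_list_of_set W)"
  define n where "n = card W - 1"
  have fW: "finite W" using S U by (simp add: W_def)
  have len: "length (sorted_list_of_set W) = card W" by simp
  have cW: "card W > 0" using fW by (auto simp: W_def card_gt_0_iff)
  have strict: "u i < u j" if "i < j" "j \<le> n" for i j
    using sorted_wrt_nth_less[OF strict_sorted_list_of_set[of W] that(1)] that(2) cW
    by (simp add: u_def n_def)
  have uW: "u i \<in> W" if "i \<le> n" for i
    using that nth_mem[of i "sorted_list_of_set W"] fW cW by (simp add: u_def n_def)
  have Wpos: "r \<ge> 0" if "r \<in> W" for r using that t S by (auto simp: W_def)
  have "\<exists>i\<le>n. u i = r" if "r \<in> W" for r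
  proof -
    have "r \<in> set (sorted_list_of_set W)" using that fW by simp
    then obtain i where "i < length (sorted_list_of_set W)" "sorted_list_of_set W ! i = r"
      by (auto simp: in_set_conv_nth)
    then show ?thesis unfolding u_def n_def by (intro exI[of _ i]) auto
  qed
  then obtain idx where idx: "\<And>r. r \<in> W \<Longrightarrow> idx r \<le> n" "\<And>r. r \<in> W \<Longrightarrow> u (idx r) = r"
    by metis
  have idx_mono: "idx v \<le> idx r" if "v \<in> W" "r \<in> W" "v \<le> r" for v r
    using strict[of "idx r" "idx v"] idx that by (metis leI not_le)
  have tele: "B r w - B v w = (\<Sum>l\<in>{idx v..<idx r}. B (u (Suc l)) w - B (u l) w)"
    if "v \<in> W" "r \<in> W" "v \<le> r" for v r w
    using sum_Suc_diff'[OF idx_mono[OF that], of "\<lambda>l. B (u l) w"] idx that by simp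
  have ind: "indep_vars (\<lambda>_. borel) (\<lambda>i w. B (u (Suc i)) w - B (u i) w) {..<n}"
    by (rule B_indep_increments) (use uW[of 0] Wpos strict in auto)
  have *: "indep_var (PiM {..<idx t} (\<lambda>_. borel)) (\<lambda>w. restrict (\<lambda>i. B (u (Suc i)) w - B (u i) w) {..<idx t})
      (PiM {idx t..<n} (\<lambda>_. borel)) (\<lambda>w. restrict (\<lambda>i. B (u (Suc i)) w - B (u i) w) {idx t..<n})"
    by (rule indep_var_restrict[OF ind]) (use idx(1)[of t] in \<open>auto simp: W_def\<close>)
  define f1 where "f1 = (\<lambda>x. \<lambda>s\<in>S. \<Sum>l\<in>{idx 0..<idx s}. x l :: real)"
  define f2 where "f2 = (\<lambda>x. \<lambda>v\<in>U. \<Sum>l\<in>{idx t..<idx (max v t)}. x l :: real)"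
  have W: "0 \<in> W" "t \<in> W" "\<And>s. s \<in> S \<Longrightarrow> s \<in> W" "\<And>v. v \<in> U \<Longrightarrow> max v t \<in> W" by (auto simp: W_def)
  have f1: "f1 \<in> measurable (PiM {..<idx t} (\<lambda>_. borel)) (PiM S (\<lambda>_. borel))"
    unfolding f1_def
  proof (rule measurable_restrict, rule borel_measurable_sum)
    fix s l assume "s \<in> S" "l \<in> {idx 0..<idx s}"
    then have "l \<in> {..<idx t}" using idx_mono[of s t] W S by fastforce
    then show "(\<lambda>x. x l) \<in> borel_measurable (PiM {..<idx t} (\<lambda>_. borel))"
      by (rule measurable_component_singleton)
  qed
  have f2: "f2 \<in> measurable (PiM {idx t..<n} (\<lambda>_. borel)) (PiM U (\<lambda>_. borel))"
    unfolding f2_def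
  proof (rule measurable_restrict, rule borel_measurable_sum)
    fix s l assume "s \<in> U" "l \<in> {idx t..<idx (max s t)}"
    then have "l \<in> {idx t..<n}" using idx(1)[OF W(4)] by fastforce
    then show "(\<lambda>x. x l) \<in> borel_measurable (PiM {idx t..<n} (\<lambda>_. borel))"
      by (rule measurable_component_singleton)
  qed
  have "(\<lambda>w. \<lambda>s\<in>S. B s w - B 0 w) = f1 \<circ> (\<lambda>w. restrict (\<lambda>i. B (u (Suc i)) w - B (u i) w) {..<idx t})"
  proof (intro ext)
    fix w s
    show "(\<lambda>s\<in>S. B s w - B 0 w) s = (f1 \<circ> (\<lambda>w. restrict (\<lambda>i. B (u (Suc i)) w - B (u i) w) {..<idx t})) w s"
    proof (cases "s \<in> S")
      case True
      then have "idx s \<le> idx t" using idx_mono[of s t] W S by auto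
      then show ?thesis using True tele[OF W(1) W(3)[OF True]] S(2)
        by (auto simp: f1_def intro!: sum.cong)
    qed (simp add: f1_def)
  qed
  moreover have "(\<lambda>w. \<lambda>u\<in>U. B (max u t) w - B t w) = f2 \<circ> (\<lambda>w. restrict (\<lambda>i. B (u (Suc i)) w - B (u i) w) {idx t..<n})"
  proof (intro ext)
    fix w s
    show "(\<lambda>u\<in>U. B (max u t) w - B t w) s = (f2 \<circ> (\<lambda>w. restrict (\<lambda>i. B (u (Suc i)) w - B (u i) w) {idx t..<n})) w s"
    proof (cases "s \<in> U")
      case True
      then have "idx (max s t) \<le> n" using idx(1) W by auto
      then show ?thesis using True tele[OF W(2) W(4)[OF True]]
        by (auto simp: f2_def intro!: sum.cong)
    qed (simp add: f2_def)
  qed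
  ultimately show ?thesis using indep_var_compose[OF * f1 f2] by simp
qed

text \<open>\<open>B s\<close> and \<open>B s - B 0\<close> agree almost surely, and a null set has
  the empty set as a version. This links the generators of \<open>G\<close> to what independence of
  increments can treat.\<close>

lemma past_AE_eq_cylinder:
  assumes "0 \<le> t" "D \<in> sets (G (ennreal t))"
  shows "\<exists>D'\<in>sigma_sets (space M)
      {(\<lambda>w. \<lambda>s\<in>S. B s w - B 0 w) -` E \<inter> space M | S E.
         finite S \<and> S \<subseteq> {0..t} \<and> E \<in> sets (PiM S (\<lambda>_. borel))}. AE w in M. w \<in> D \<longleftrightarrow> w \<in> D'"
  using assms(2) unfolding sets_natural_filtration
proof (rule sigma_sets_AE_transfer[rotated], goal_cases)
  case (1 A)
  then consider s E where "A = B s -` E \<inter> space M" "0 \<le> s" "ennreal s \<le> ennreal t" "E \<in> sets borel"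
    | "A \<in> null_sets M" by blast
  then show ?case
  proof cases
    case 1
    let ?E = "(\<lambda>x. x s) -` E \<inter> space (PiM {s} (\<lambda>_. borel)) :: (real \<Rightarrow> real) set"
    have "?E \<in> sets (PiM {s} (\<lambda>_. borel))"
      by (rule measurable_sets[OF _ 1(4)], rule measurable_component_singleton) simp
    moreover have "s \<le> t" using 1 assms(1) by simp
    ultimately have "(\<lambda>w. \<lambda>s\<in>{s}. B s w - B 0 w) -` ?E \<inter> space M \<in> sigma_sets (space M)
      {(\<lambda>w. \<lambda>s\<in>S. B s w - B 0 w) -` E \<inter> space M | S E.
         finite S \<and> S \<subseteq> {0..t} \<and> E \<in> sets (PiM S (\<lambda>_. borel))}"
      using \<open>0 \<le> s\<close> by (intro sigma_sets.Basic CollectI exI[of _ "{s}"] exI[of _ ?E]) auto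
    moreover have "AE w in M. w \<in> A \<longleftrightarrow> w \<in> (\<lambda>w. \<lambda>s\<in>{s}. B s w - B 0 w) -` ?E \<inter> space M"
      using B_zero by eventually_elim (auto simp: 1 space_PiM)
    ultimately show ?thesis by blast
  next
    case 2
    then show ?thesis by (intro bexI[of _ "{}"] sigma_sets.Empty) (auto dest: AE_not_in)
  qed
qed

text \<open>Dynkin's argument over the past cylinders: two of them intersect in a cylinder over the
  union of their index sets, and the product formula survives complements and disjoint unions.
  \<open>D\<close> enters only through its almost sure version.\<close>

lemma prob_past_future:
  assumes t: "0 \<le> t" and D: "D \<in> sets (G (ennreal t))" and U: "finite U"
    and E: "E \<in> sets (PiM U (\<lambda>_. borel))"
  defines "Y \<equiv> (\<lambda>w. \<lambda>u\<in>U. B (max u t) w - B t w)"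
  shows "prob (D \<inter> (Y -` E \<inter> space M)) = prob D * prob (Y -` E \<inter> space M)"
proof -
  let ?P = "{(\<lambda>w. \<lambda>s\<in>S. B s w - B 0 w) -` E \<inter> space M | S E.
         finite S \<and> S \<subseteq> {0..t} \<and> E \<in> sets (PiM S (\<lambda>_. borel))}"
  let ?Y = "Y -` E \<inter> space M"
  have mX: "(\<lambda>w. \<lambda>s\<in>S. B s w - B 0 w) \<in> measurable M (PiM S (\<lambda>_. borel))" if "S \<subseteq> {0..t}" for S
    using that by (intro measurable_restrict) auto
  have mY: "Y \<in> measurable M (PiM U (\<lambda>_. borel))"
    unfolding Y_def using t by (intro measurable_restrict) auto
  have Ym: "?Y \<in> events" by (rule measurable_sets[OF mY E])
  have Pm: "?P \<subseteq> events" by (auto intro: measurable_sets[OF mX])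
  have sm: "sigma_sets (space M) ?P \<subseteq> events" by (rule sets.sigma_sets_subset[OF Pm])
  obtain D' where D': "D' \<in> sigma_sets (space M) ?P" "AE w in M. w \<in> D \<longleftrightarrow> w \<in> D'"
    using past_AE_eq_cylinder[OF t D] by blast
  have st: "Int_stable ?P"
  proof (rule Int_stableI)
    fix a b assume "a \<in> ?P" "b \<in> ?P"
    then obtain S E S' E' where 1: "a = (\<lambda>w. \<lambda>s\<in>S. B s w - B 0 w) -` E \<inter> space M"
      "finite S" "S \<subseteq> {0..t}" "E \<in> sets (PiM S (\<lambda>_. borel))"
      "b = (\<lambda>w. \<lambda>s\<in>S'. B s w - B 0 w) -` E' \<inter> space M"
      "finite S'" "S' \<subseteq> {0..t}" "E' \<in> sets (PiM S' (\<lambda>_. borel))" by blast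
    let ?R = "\<lambda>S x. restrict x S :: real \<Rightarrow> real"
    have "?R S \<in> measurable (PiM (S \<union> S') (\<lambda>_. borel)) (PiM S (\<lambda>_. borel))"
      "?R S' \<in> measurable (PiM (S \<union> S') (\<lambda>_. borel)) (PiM S' (\<lambda>_. borel))"
      by (rule measurable_restrict_subset; simp)+
    then have "?R S -` E \<inter> space (PiM (S \<union> S') (\<lambda>_. borel)) \<inter> (?R S' -` E' \<inter> space (PiM (S \<union> S') (\<lambda>_. borel)))
        \<in> sets (PiM (S \<union> S') (\<lambda>_. borel))" (is "?E \<in> _")
      using 1 by (intro sets.Int measurable_sets) auto
    moreover have "restrict (\<lambda>s. B s w - B 0 w) S = ?R S (restrict (\<lambda>s. B s w - B 0 w) (S \<union> S'))"
      "restrict (\<lambda>s. B s w - B 0 w) S' = ?R S' (restrict (\<lambda>s. B s w - B 0 w) (S \<union> S'))" for w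
      by (auto simp: restrict_def)
    ultimately show "a \<inter> b \<in> ?P"
      using 1 by (intro CollectI exI[of _ "S \<union> S'"] exI[of _ ?E]) (auto simp: space_PiM)
  qed
  have "?P \<subseteq> Pow (space M)" by auto
  from st this D'(1) have "prob (D' \<inter> ?Y) = prob D' * prob ?Y"
  proof (induction rule: sigma_sets_induct_disjoint)
    case (basic A)
    then obtain S E' where A: "A = (\<lambda>w. \<lambda>s\<in>S. B s w - B 0 w) -` E' \<inter> space M"
      "finite S" "S \<subseteq> {0..t}" "E' \<in> sets (PiM S (\<lambda>_. borel))" by blast
    have "A \<inter> ?Y = (\<lambda>w. ((\<lambda>s\<in>S. B s w - B 0 w), Y w)) -` (E' \<times> E) \<inter> space M" using A by auto
    then have "prob (A \<inter> ?Y) = prob ((\<lambda>w. ((\<lambda>s\<in>S. B s w - B 0 w), Y w)) -` (E' \<times> E) \<inter> space M)"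
      by (rule arg_cong)
    also have "\<dots> = prob ((\<lambda>w. \<lambda>s\<in>S. B s w - B 0 w) -` E' \<inter> space M) * prob ?Y"
      unfolding Y_def by (rule indep_varD[OF indep_cylinders[OF t A(2,3) U] A(4) E])
    finally show ?case unfolding A(1) .
  next
    case (compl A)
    then have A: "A \<in> events" using sm by blast
    have "(space M - A) \<inter> ?Y = ?Y - A" by auto
    then have "prob ((space M - A) \<inter> ?Y) = prob ?Y - prob (A \<inter> ?Y)"
      using finite_measure_Diff'[OF Ym A] by (simp only: Int_commute)
    also have "\<dots> = (1 - prob A) * prob ?Y" unfolding compl(2) by (simp add: left_diff_distrib)
    finally show ?case unfolding prob_compl[OF A] .
  next
    case (union A)
    have A: "range A \<subseteq> events" using union(2) sm by blast
    have "(\<lambda>i. prob (A i \<inter> ?Y)) sums prob (\<Union>i. A i \<inter> ?Y)"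
      using A Ym union(1) by (intro finite_measure_UNION) (auto simp: disjoint_family_on_def)
    moreover have "(\<lambda>i. prob (A i) * prob ?Y) sums (prob (\<Union>i. A i) * prob ?Y)"
      using A union(1) by (intro sums_mult2 finite_measure_UNION)
    ultimately show ?case using union(3) by (simp add: sums_unique2)
  qed simp
  moreover have "prob D = prob D'"
    using D' D sm by (intro measure_eq_AE) (auto dest: G_sets_M)
  moreover have "prob (D \<inter> ?Y) = prob (D' \<inter> ?Y)"
    by (rule measure_eq_AE) (use D' D sm Ym in \<open>auto dest: G_sets_M\<close>)
  ultimately show ?thesis by simp
qed

lemma indep_past_future:
  assumes t: "0 \<le> t" and X: "X \<in> measurable (G (ennreal t)) N" and U: "finite U"
  shows "indep_var N X (PiM U (\<lambda>_. borel)) (\<lambda>w. \<lambda>u\<in>U. B (max u t) w - B t w)"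
    (is "indep_var N X ?P ?Y")
  unfolding indep_var_eq
proof (intro conjI indep_set_sigma_sets)
  show XM: "random_variable N X"
    using X G_subset by (auto simp: measurable_def)
  show Y: "random_variable ?P ?Y"
    using t by (intro measurable_restrict) auto
  show "Int_stable {X -` A \<inter> space M |A. A \<in> sets N}"
    "Int_stable {?Y -` A \<inter> space M |A. A \<in> sets ?P}"
    by (rule Int_stable_vimage)+
  show "indep_set {X -` A \<inter> space M |A. A \<in> sets N} {?Y -` A \<inter> space M |A. A \<in> sets ?P}"
  proof (safe intro!: indep_setI)
    fix A E assume A: "A \<in> sets N" and E: "E \<in> sets ?P"
    have "X -` A \<inter> space M \<in> sets (G (ennreal t))" using measurable_sets[OF X A] by simp
    from prob_past_future[OF t this U E]
    show "prob (X -` A \<inter> space M \<inter> (?Y -` E \<inter> space M)) = prob (X -` A \<inter> space M) * prob (?Y -` E \<inter> space M)" .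
  qed (use XM Y in \<open>auto intro: measurable_sets\<close>)
qed

end

section \<open>Lipschitz functionals of the path\<close>

text \<open>The argument is a whole path, but the Lipschitz bound already forces
  \<open>\<Phi>\<close> to depend on the coordinates in \<open>U\<close> alone, so paths can be
  inserted without restricting them to \<open>U\<close>. The range \<open>[0, 1]\<close> is that of
  the indicators to be approximated.\<close>

definition lipschitz_functional :: "real set \<Rightarrow> real \<Rightarrow> ((real \<Rightarrow> real) \<Rightarrow> real) \<Rightarrow> bool" where
  "lipschitz_functional U L \<Phi> \<longleftrightarrow>
     finite U \<and> U \<subseteq> {0..} \<and> 0 \<le> L \<and> \<Phi> \<in> borel_measurable (PiM U (\<lambda>_. borel)) \<and>
     (\<forall>b. 0 \<le> \<Phi> b \<and> \<Phi> b \<le> 1) \<and>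
     (\<forall>b b'. \<bar>\<Phi> b - \<Phi> b'\<bar> \<le> L * (\<Sum>u\<in>U. \<bar>b u - b' u\<bar>))"

lemma lipschitz_functionalD:
  assumes "lipschitz_functional U L \<Phi>"
  shows "finite U" "U \<subseteq> {0..}" "0 \<le> L" "\<Phi> \<in> borel_measurable (PiM U (\<lambda>_. borel))"
    "0 \<le> \<Phi> b" "\<Phi> b \<le> 1" "\<bar>\<Phi> b - \<Phi> b'\<bar> \<le> L * (\<Sum>u\<in>U. \<bar>b u - b' u\<bar>)"
  using assms unfolding lipschitz_functional_def by blast+

lemma lipschitz_functional_cong:
  assumes "lipschitz_functional U L \<Phi>" "\<And>u. u \<in> U \<Longrightarrow> b u = b' u"
  shows "\<Phi> b = \<Phi> b'"
proof -
  have "(\<Sum>u\<in>U. \<bar>b u - b' u\<bar>) = 0" using assms(2) by simp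
  then show ?thesis using lipschitz_functionalD(7)[OF assms(1), of b b'] by simp
qed

lemma lipschitz_functional_superset:
  assumes \<Phi>: "lipschitz_functional U L \<Phi>" and V: "U \<subseteq> V" "finite V" "V \<subseteq> {0..}"
  shows "lipschitz_functional V L \<Phi>"
  unfolding lipschitz_functional_def
proof (intro conjI allI)
  have "(\<lambda>b. \<Phi> (restrict b U)) \<in> borel_measurable (PiM V (\<lambda>_. borel))"
    by (rule measurable_compose[OF measurable_restrict_subset[OF V(1)] lipschitz_functionalD(4)[OF \<Phi>]])
  moreover have "(\<lambda>b. \<Phi> (restrict b U)) = \<Phi>"
    by (intro ext lipschitz_functional_cong[OF \<Phi>]) auto
  ultimately show "\<Phi> \<in> borel_measurable (PiM V (\<lambda>_. borel))" by simp
  fix b b'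
  have "L * (\<Sum>u\<in>U. \<bar>b u - b' u\<bar>) \<le> L * (\<Sum>u\<in>V. \<bar>b u - b' u\<bar>)"
    by (intro mult_left_mono sum_mono2 V lipschitz_functionalD(3)[OF \<Phi>]) auto
  then show "\<bar>\<Phi> b - \<Phi> b'\<bar> \<le> L * (\<Sum>u\<in>V. \<bar>b u - b' u\<bar>)"
    using lipschitz_functionalD(7)[OF \<Phi>, of b b'] by linarith
qed (use V lipschitz_functionalD[OF \<Phi>] in auto)

lemma lipschitz_functional_compl:
  "lipschitz_functional U L \<Phi> \<Longrightarrow> lipschitz_functional U L (\<lambda>b. 1 - \<Phi> b)"
  unfolding lipschitz_functional_def by (auto simp: abs_minus_commute)

text \<open>The indicator of a union is the maximum of the indicators; this is the functional
  counterpart. The constants add because a maximum moves by at most the sum of the moves of its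
  arguments.\<close>

lemma lipschitz_functional_max:
  assumes \<Phi>: "lipschitz_functional U L \<Phi>" and \<Psi>: "lipschitz_functional V K \<Psi>"
  shows "lipschitz_functional (U \<union> V) (L + K) (\<lambda>b. max (\<Phi> b) (\<Psi> b))"
  unfolding lipschitz_functional_def
proof (intro conjI allI)
  have 1: "lipschitz_functional (U \<union> V) L \<Phi>" "lipschitz_functional (U \<union> V) K \<Psi>"
    using lipschitz_functionalD(1,2)[OF \<Phi>] lipschitz_functionalD(1,2)[OF \<Psi>]
    by (auto intro!: lipschitz_functional_superset[OF \<Phi>] lipschitz_functional_superset[OF \<Psi>])
  show "(\<lambda>b. max (\<Phi> b) (\<Psi> b)) \<in> borel_measurable (PiM (U \<union> V) (\<lambda>_. borel))"
    by (intro borel_measurable_max 1[THEN lipschitz_functionalD(4)])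
  fix b b'
  show "0 \<le> max (\<Phi> b) (\<Psi> b)" "max (\<Phi> b) (\<Psi> b) \<le> 1"
    using lipschitz_functionalD(5,6)[OF \<Phi>, of b] lipschitz_functionalD(5,6)[OF \<Psi>, of b] by auto
  have "\<bar>max (\<Phi> b) (\<Psi> b) - max (\<Phi> b') (\<Psi> b')\<bar> \<le> \<bar>\<Phi> b - \<Phi> b'\<bar> + \<bar>\<Psi> b - \<Psi> b'\<bar>" by linarith
  also have "\<dots> \<le> L * (\<Sum>u\<in>U \<union> V. \<bar>b u - b' u\<bar>) + K * (\<Sum>u\<in>U \<union> V. \<bar>b u - b' u\<bar>)"
    by (intro add_mono lipschitz_functionalD(7) 1)
  finally show "\<bar>max (\<Phi> b) (\<Psi> b) - max (\<Phi> b') (\<Psi> b')\<bar> \<le> (L + K) * (\<Sum>u\<in>U \<union> V. \<bar>b u - b' u\<bar>)"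
    by (simp add: algebra_simps)
qed (use lipschitz_functionalD(1-3)[OF \<Phi>] lipschitz_functionalD(1-3)[OF \<Psi>] in auto)

text \<open>As \<open>k\<close> grows, the ramp increases to the indicator of
  \<open>b u < a\<close>; half lines generate the Borel sets.\<close>

lemma lipschitz_functional_ramp:
  assumes "0 \<le> u" "0 \<le> k"
  shows "lipschitz_functional {u} k (\<lambda>b. max 0 (min 1 (k * (a - b u))))"
  unfolding lipschitz_functional_def
proof (intro conjI allI)
  show "(\<lambda>b. max 0 (min 1 (k * (a - b u)))) \<in> borel_measurable (PiM {u} (\<lambda>_. borel))"
    by (intro borel_measurable_max borel_measurable_min borel_measurable_times borel_measurable_diff
        borel_measurable_const measurable_component_singleton) simp
  fix b b' :: "real \<Rightarrow> real"
  have "\<bar>max 0 (min 1 (k * (a - b u))) - max 0 (min 1 (k * (a - b' u)))\<bar> \<le> \<bar>k * (a - b u) - k * (a - b' u)\<bar>"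
    by linarith
  also have "\<dots> = \<bar>k * (b' u - b u)\<bar>" by (simp add: algebra_simps)
  also have "\<dots> = k * \<bar>b u - b' u\<bar>" using assms by (simp add: abs_mult abs_minus_commute)
  finally show "\<bar>max 0 (min 1 (k * (a - b u))) - max 0 (min 1 (k * (a - b' u)))\<bar> \<le> k * (\<Sum>u\<in>{u}. \<bar>b u - b' u\<bar>)"
    by simp
qed (use assms in auto)

section \<open>Conditional expectations of Lipschitz functionals\<close>

context brownian_setting
begin

text \<open>A version of \<open>E[\<Phi>(B) | G t]\<close>: the increments after \<open>t\<close> are independent of \<open>G t\<close> and are integrated out.\<close>

definition conditional :: "((real \<Rightarrow> real) \<Rightarrow> real) \<Rightarrow> real \<Rightarrow> 'a \<Rightarrow> real" where
  "conditional \<Phi> t w = (\<integral>w'. \<Phi> (\<lambda>u. B (min u t) w + (B (max u t) w' - B t w')) \<partial>M)"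

lemma integrable_bounded:
  fixes f :: "'a \<Rightarrow> real"
  assumes "f \<in> borel_measurable M" "\<And>w. w \<in> space M \<Longrightarrow> \<bar>f w\<bar> \<le> c"
  shows "integrable M f"
  by (rule integrable_const_bound[where B = c]) (use assms in auto)

lemma lipschitz_functional_measurable:
  assumes \<Phi>: "lipschitz_functional U L \<Phi>" and X: "\<And>u. u \<in> U \<Longrightarrow> X u \<in> borel_measurable N"
  shows "(\<lambda>w. \<Phi> (\<lambda>u. X u w)) \<in> borel_measurable N"
proof -
  have "(\<lambda>w. \<Phi> (\<lambda>u\<in>U. X u w)) \<in> borel_measurable N"
    by (rule measurable_compose[OF measurable_restrict[OF X] lipschitz_functionalD(4)[OF \<Phi>]])
  moreover have "\<Phi> (\<lambda>u\<in>U. X u w) = \<Phi> (\<lambda>u. X u w)" for w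
    by (rule lipschitz_functional_cong[OF \<Phi>]) simp
  ultimately show ?thesis by simp
qed

lemma functional_integrable:
  assumes \<Phi>: "lipschitz_functional U L \<Phi>" and "\<And>u. u \<in> U \<Longrightarrow> X u \<in> borel_measurable M"
  shows "integrable M (\<lambda>w. \<Phi> (\<lambda>u. X u w))"
  by (rule integrable_bounded[OF lipschitz_functional_measurable[OF assms], where c = 1])
    (use lipschitz_functionalD(5,6)[OF \<Phi>] in auto)

lemma conditional_bounds:
  assumes \<Phi>: "lipschitz_functional U L \<Phi>" and t: "0 \<le> t"
  shows "0 \<le> conditional \<Phi> t w" "conditional \<Phi> t w \<le> 1"
proof -
  show "0 \<le> conditional \<Phi> t w"
    unfolding conditional_def by (rule Bochner_Integration.integral_nonneg) (rule lipschitz_functionalD(5)[OF \<Phi>])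
  have "conditional \<Phi> t w \<le> (\<integral>w'. 1 \<partial>M)"
    unfolding conditional_def
    by (rule integral_mono[OF functional_integrable[OF \<Phi>]])
      (use t lipschitz_functionalD(2,6)[OF \<Phi>] in auto)
  then show "conditional \<Phi> t w \<le> 1" by (simp add: prob_space)
qed

text \<open>After integration over \<open>w'\<close> only the finitely many values
  \<open>B (min u t) w\<close> remain, all observed by time \<open>t\<close>.\<close>

lemma conditional_measurable:
  assumes \<Phi>: "lipschitz_functional U L \<Phi>" and t: "0 \<le> t"
  shows "conditional \<Phi> t \<in> borel_measurable (G (ennreal t))"
proof -
  have m: "(\<lambda>p. \<Phi> (\<lambda>u. fst p u + (B (max u t) (snd p) - B t (snd p)))) \<in> borel_measurable (PiM U (\<lambda>_. borel) \<Otimes>\<^sub>M M)"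
  proof (rule lipschitz_functional_measurable[OF \<Phi>, of "\<lambda>u p. fst p u + (B (max u t) (snd p) - B t (snd p))"])
    fix u assume "u \<in> U"
    then have [measurable]: "(\<lambda>p. fst p u) \<in> borel_measurable (PiM U (\<lambda>_. borel :: real measure) \<Otimes>\<^sub>M M)"
      by (intro measurable_compose[OF measurable_fst] measurable_component_singleton)
    have [measurable]: "B (max u t) \<in> borel_measurable M" "B t \<in> borel_measurable M"
      using t by auto
    show "(\<lambda>p. fst p u + (B (max u t) (snd p) - B t (snd p))) \<in> borel_measurable (PiM U (\<lambda>_. borel) \<Otimes>\<^sub>M M)"
      using t by measurable
  qed
  have "(\<lambda>x. \<integral>w'. \<Phi> (\<lambda>u. x u + (B (max u t) w' - B t w')) \<partial>M) \<in> borel_measurable (PiM U (\<lambda>_. borel))"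
    by (rule borel_measurable_lebesgue_integral) (use m in \<open>simp add: case_prod_beta'\<close>)
  moreover have "(\<lambda>w. \<lambda>u\<in>U. B (min u t) w) \<in> measurable (G (ennreal t)) (PiM U (\<lambda>_. borel))"
    by (intro measurable_restrict measurable_natural_filtration)
      (use t lipschitz_functionalD(2)[OF \<Phi>] in \<open>auto simp: ennreal_leI\<close>)
  ultimately have "(\<lambda>w. \<integral>w'. \<Phi> (\<lambda>u. (\<lambda>u\<in>U. B (min u t) w) u + (B (max u t) w' - B t w')) \<partial>M)
      \<in> borel_measurable (G (ennreal t))"
    by (rule measurable_compose[rotated])
  moreover have "\<Phi> (\<lambda>u. (\<lambda>u\<in>U. B (min u t) w) u + (B (max u t) w' - B t w')) =
      \<Phi> (\<lambda>u. B (min u t) w + (B (max u t) w' - B t w'))" for w w'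
    by (rule lipschitz_functional_cong[OF \<Phi>]) simp
  ultimately show ?thesis by (simp add: conditional_def[abs_def])
qed

lemma conditional_measurable_M [measurable]:
  assumes "lipschitz_functional U L \<Phi>" "0 \<le> t"
  shows "conditional \<Phi> t \<in> borel_measurable M"
  using conditional_measurable[OF assms] G_subset by (auto simp: measurable_def)

text \<open>For each \<open>u\<close> the value \<open>B u\<close> is the sum of
  \<open>B (min u t)\<close>, observed at \<open>t\<close>, and \<open>B (max u t) - B t\<close>,
  independent of \<open>G t\<close>. Their joint law is a product, and Fubini's theorem integrates
  the second part against its own law, which is exactly \<open>conditional\<close>.\<close>

lemma integral_conditional:
  assumes \<Phi>: "lipschitz_functional U L \<Phi>" and t: "0 \<le> t" and D: "D \<in> sets (G (ennreal t))"
  shows "(\<integral>w. indicator D w * \<Phi> (\<lambda>u. B u w) \<partial>M) = (\<integral>w. indicator D w * conditional \<Phi> t w \<partial>M)"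
proof -
  \<comment> \<open>\<open>indep_var\<close> needs both variables to have the same type, so the indicator of \<open>D\<close> is stored at the spare index \<open>-1\<close>.\<close>
  let ?V = "insert (- 1) U"
  let ?P = "PiM U (\<lambda>_. borel :: real measure)"
  let ?N = "PiM ?V (\<lambda>_. borel :: real measure)"
  let ?X = "\<lambda>w. \<lambda>i\<in>?V. if i = - 1 then indicator D w else B (min i t) w"
  let ?Y = "\<lambda>w. \<lambda>u\<in>U. B (max u t) w - B t w"
  let ?f = "\<lambda>p. indicator {1::real} (fst p (- 1)) * \<Phi> (\<lambda>u. fst p u + snd p u)"
  have U: "finite U" "U \<subseteq> {0..}" using lipschitz_functionalD[OF \<Phi>] by auto
  have X: "?X \<in> measurable (G (ennreal t)) ?N"
  proof (rule measurable_restrict)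
    fix i assume i: "i \<in> ?V"
    show "(\<lambda>w. if i = - 1 then indicator D w else B (min i t) w) \<in> borel_measurable (G (ennreal t))"
    proof (cases "i = - 1")
      case True
      then show ?thesis using D by simp
    next
      case False
      then have "0 \<le> min i t" "ennreal (min i t) \<le> ennreal t" using i U t by (auto simp: ennreal_leI)
      from measurable_natural_filtration[OF this] show ?thesis using False by simp
    qed
  qed
  note ind = indep_past_future[OF t X U(1)]
  have XM: "?X \<in> measurable M ?N" and YM: "?Y \<in> measurable M ?P"
    using ind unfolding indep_var_eq by auto
  interpret dX: prob_space "distr M ?N ?X" by (rule prob_space_distr[OF XM])
  interpret dY: prob_space "distr M ?P ?Y" by (rule prob_space_distr[OF YM])
  interpret p: pair_prob_space "distr M ?N ?X" "distr M ?P ?Y" ..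
  have fm: "?f \<in> borel_measurable (?N \<Otimes>\<^sub>M ?P)"
  proof (rule borel_measurable_times)
    have "(\<lambda>p. fst p (- 1)) \<in> borel_measurable (?N \<Otimes>\<^sub>M ?P)"
      by (rule measurable_compose[OF measurable_fst]) (rule measurable_component_singleton, simp)
    then show "(\<lambda>p. indicator {1::real} (fst p (- 1)) :: real) \<in> borel_measurable (?N \<Otimes>\<^sub>M ?P)"
      by (rule measurable_compose) simp
    show "(\<lambda>p. \<Phi> (\<lambda>u. fst p u + snd p u)) \<in> borel_measurable (?N \<Otimes>\<^sub>M ?P)"
    proof (rule lipschitz_functional_measurable[OF \<Phi>, of "\<lambda>u p. fst p u + snd p u"])
      fix u assume "u \<in> U"
      then show "(\<lambda>p. fst p u + snd p u) \<in> borel_measurable (?N \<Otimes>\<^sub>M ?P)"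
        by (intro borel_measurable_add measurable_compose[OF measurable_fst]
            measurable_compose[OF measurable_snd] measurable_component_singleton) auto
    qed
  qed
  have mono: "norm (?f p) \<le> 1" for p
    using lipschitz_functionalD(5,6)[OF \<Phi>] by (auto simp: indicator_def)
  have fi: "integrable (distr M ?N ?X \<Otimes>\<^sub>M distr M ?P ?Y) ?f"
    by (rule p.P.integrable_const_bound[where B = 1]) (use fm mono in \<open>auto intro!: AE_I2\<close>)
  have eq: "distr M ?N ?X \<Otimes>\<^sub>M distr M ?P ?Y = distr M (?N \<Otimes>\<^sub>M ?P) (\<lambda>w. (?X w, ?Y w))"
    using ind unfolding indep_var_distribution_eq by simp
  have "(\<integral>w. indicator D w * \<Phi> (\<lambda>u. B u w) \<partial>M) = (\<integral>w. ?f (?X w, ?Y w) \<partial>M)"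
  proof (rule Bochner_Integration.integral_cong[OF refl])
    fix w
    have "\<Phi> (\<lambda>u. B u w) = \<Phi> (\<lambda>u. ?X w u + ?Y w u)"
      by (rule lipschitz_functional_cong[OF \<Phi>]) (use U in \<open>auto simp: min_def max_def\<close>)
    then show "indicator D w * \<Phi> (\<lambda>u. B u w) = ?f (?X w, ?Y w)" by (auto simp: indicator_def)
  qed
  also have "\<dots> = (\<integral>p. ?f p \<partial>(distr M ?N ?X \<Otimes>\<^sub>M distr M ?P ?Y))"
    unfolding eq by (rule integral_distr[symmetric]) (use XM YM fm in auto)
  also have "\<dots> = (\<integral>x. (\<integral>y. ?f (x, y) \<partial>distr M ?P ?Y) \<partial>distr M ?N ?X)"
    by (rule p.integral_fst'[symmetric, OF fi])
  also have "\<dots> = (\<integral>w. (\<integral>y. ?f (?X w, y) \<partial>distr M ?P ?Y) \<partial>M)"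
  proof (rule integral_distr[OF XM])
    have "?f \<in> borel_measurable (?N \<Otimes>\<^sub>M distr M ?P ?Y)" using fm by simp
    then have "(\<lambda>(x, y). ?f (x, y)) \<in> borel_measurable (?N \<Otimes>\<^sub>M distr M ?P ?Y)" by (simp add: case_prod_beta')
    from dY.borel_measurable_lebesgue_integral[OF this]
    show "(\<lambda>x. \<integral>y. ?f (x, y) \<partial>distr M ?P ?Y) \<in> borel_measurable ?N" by simp
  qed
  also have "\<dots> = (\<integral>w. indicator D w * conditional \<Phi> t w \<partial>M)"
  proof (rule Bochner_Integration.integral_cong[OF refl])
    fix w assume w: "w \<in> space M"
    have "?X w \<in> space ?N" using measurable_space[OF XM w] .
    then have "(\<lambda>y. ?f (?X w, y)) \<in> borel_measurable ?P"
      by (intro measurable_compose[OF _ fm] measurable_Pair measurable_const) auto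
    then have "(\<integral>y. ?f (?X w, y) \<partial>distr M ?P ?Y) = (\<integral>w'. ?f (?X w, ?Y w') \<partial>M)"
      by (rule integral_distr[OF YM])
    also have "\<dots> = (\<integral>w'. indicator D w * \<Phi> (\<lambda>u. B (min u t) w + (B (max u t) w' - B t w')) \<partial>M)"
    proof (rule Bochner_Integration.integral_cong[OF refl])
      fix w'
      have "\<Phi> (\<lambda>u. B (min u t) w + (B (max u t) w' - B t w')) = \<Phi> (\<lambda>u. ?X w u + ?Y w' u)"
        by (rule lipschitz_functional_cong[OF \<Phi>]) (use U in auto)
      then show "?f (?X w, ?Y w') = indicator D w * \<Phi> (\<lambda>u. B (min u t) w + (B (max u t) w' - B t w'))"
        by (auto simp: indicator_def)
    qed
    finally show "(\<integral>y. ?f (?X w, y) \<partial>distr M ?P ?Y) = indicator D w * conditional \<Phi> t w"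
      by (simp add: conditional_def)
  qed
  finally show ?thesis .
qed

lemma increment_abs_moment:
  assumes "0 \<le> s" "s \<le> t"
  shows "integrable M (\<lambda>w. \<bar>B t w - B s w\<bar>)"
    and "(\<integral>w. \<bar>B t w - B s w\<bar> \<partial>M) = sqrt (2 / pi) * sqrt (t - s)"
proof -
  have "integrable M (\<lambda>w. \<bar>B t w - B s w\<bar>) \<and> (\<integral>w. \<bar>B t w - B s w\<bar> \<partial>M) = sqrt (2 / pi) * sqrt (t - s)"
  proof (cases "s = t")
    case False
    then have st: "s < t" using assms by simp
    note d = B_increment[OF assms(1) st]
    have p: "0 < sqrt (t - s)" using st by simp
    have "integrable M (\<lambda>w. \<bar>B t w - B s w\<bar>)"
      using integrable_normal_moment_abs[OF p, of 0 1] distributed_integrable[OF d, of abs] by simp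
    moreover have "(\<integral>w. \<bar>B t w - B s w\<bar> \<partial>M) = sqrt (2 / pi) * sqrt (t - s)"
      using integral_normal_moment_abs_odd[OF p, of 0 0] distributed_integral[OF d, of abs] by (simp add: mult.commute)
    ultimately show ?thesis by simp
  qed simp
  then show "integrable M (\<lambda>w. \<bar>B t w - B s w\<bar>)"
    and "(\<integral>w. \<bar>B t w - B s w\<bar> \<partial>M) = sqrt (2 / pi) * sqrt (t - s)" by blast+
qed

text \<open>Between \<open>s\<close> and \<open>t\<close> each coordinate changes in its observed
  part, which is kept pathwise, and in its averaged part. The latter changes by the increment from
  \<open>s\<close> to \<open>min u t\<close> if \<open>u\<close> is at least \<open>s\<close>, and
  not at all otherwise; the Gaussian first absolute moment bounds its mean. The explicit bound
  serves both continuity at a point and uniformity along a mesh.\<close>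

lemma conditional_oscillation:
  assumes \<Phi>: "lipschitz_functional U L \<Phi>" and st: "0 \<le> s" "s \<le> t"
  shows "\<bar>conditional \<Phi> t w - conditional \<Phi> s w\<bar> \<le>
    L * (\<Sum>u\<in>U. \<bar>B (min u t) w - B (min u s) w\<bar> + sqrt (2 / pi) * sqrt (t - s))"
proof -
  let ?F = "\<lambda>t w' u. B (min u t) w + (B (max u t) w' - B t w')"
  let ?d = "\<lambda>w' u. \<bar>(B (max u t) w' - B t w') - (B (max u s) w' - B s w')\<bar>"
  have d: "integrable M (\<lambda>w'. ?d w' u) \<and> (\<integral>w'. ?d w' u \<partial>M) \<le> sqrt (2 / pi) * sqrt (t - s)"
    if "u \<in> U" for u
  proof -
    have "u \<ge> 0" using that lipschitz_functionalD(2)[OF \<Phi>] by auto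
    consider "u \<le> s" | "s \<le> u" "u \<le> t" | "t < u" by linarith
    then show ?thesis
    proof cases
      case 1
      then show ?thesis using st by simp
    next
      case 2
      then have "?d w' u = \<bar>B u w' - B s w'\<bar>" for w' by (simp add: max_def)
      moreover have "sqrt (u - s) \<le> sqrt (t - s)" using 2 by simp
      ultimately show ?thesis using increment_abs_moment[OF st(1) 2(1)] by (simp add: mult_left_mono)
    next
      case 3
      then have "?d w' u = \<bar>B t w' - B s w'\<bar>" for w' using st by (auto simp: max_def abs_minus_commute)
      then show ?thesis using increment_abs_moment[OF st] by simp
    qed
  qed
  have i: "integrable M (\<lambda>w'. \<Phi> (?F r w'))" if "0 \<le> r" for r
    by (rule functional_integrable[OF \<Phi>, of "\<lambda>u w'. ?F r w' u"])
      (use that in auto)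
  have L: "0 \<le> L" using lipschitz_functionalD(3)[OF \<Phi>] .
  have "\<bar>conditional \<Phi> t w - conditional \<Phi> s w\<bar> = \<bar>\<integral>w'. \<Phi> (?F t w') - \<Phi> (?F s w') \<partial>M\<bar>"
    unfolding conditional_def using i st by simp
  also have "\<dots> \<le> (\<integral>w'. \<bar>\<Phi> (?F t w') - \<Phi> (?F s w')\<bar> \<partial>M)" by (rule integral_abs_bound)
  also have "\<dots> \<le> (\<integral>w'. L * (\<Sum>u\<in>U. \<bar>B (min u t) w - B (min u s) w\<bar> + ?d w' u) \<partial>M)"
  proof (rule integral_mono)
    show "integrable M (\<lambda>w'. \<bar>\<Phi> (?F t w') - \<Phi> (?F s w')\<bar>)"
      using i st by simp
    show "integrable M (\<lambda>w'. L * (\<Sum>u\<in>U. \<bar>B (min u t) w - B (min u s) w\<bar> + ?d w' u))"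
      using d by (intro integrable_mult_right Bochner_Integration.integrable_sum Bochner_Integration.integrable_add) auto
    fix w'
    have "\<bar>\<Phi> (?F t w') - \<Phi> (?F s w')\<bar> \<le> L * (\<Sum>u\<in>U. \<bar>?F t w' u - ?F s w' u\<bar>)"
      by (rule lipschitz_functionalD(7)[OF \<Phi>])
    also have "\<dots> \<le> L * (\<Sum>u\<in>U. \<bar>B (min u t) w - B (min u s) w\<bar> + ?d w' u)"
      by (intro mult_left_mono sum_mono L) linarith
    finally show "\<bar>\<Phi> (?F t w') - \<Phi> (?F s w')\<bar> \<le> L * (\<Sum>u\<in>U. \<bar>B (min u t) w - B (min u s) w\<bar> + ?d w' u)" .
  qed
  also have "\<dots> = L * (\<Sum>u\<in>U. \<bar>B (min u t) w - B (min u s) w\<bar> + (\<integral>w'. ?d w' u \<partial>M))"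
    using d by (simp add: prob_space)
  also have "\<dots> \<le> L * (\<Sum>u\<in>U. \<bar>B (min u t) w - B (min u s) w\<bar> + sqrt (2 / pi) * sqrt (t - s))"
    using d by (intro mult_left_mono sum_mono L) auto
  finally show ?thesis .
qed

section \<open>Right-continuity of the Brownian filtration\<close>

text \<open>The functional may use times beyond those that determine the event; conditioning brings
  it back to the right time later, see \<open>conditional_approximation\<close>.\<close>

definition approximable :: "'a set \<Rightarrow> bool" where
  "approximable A \<longleftrightarrow> A \<in> events \<and>
     (\<forall>\<eta>>0. \<exists>U L \<Phi>. lipschitz_functional U L \<Phi> \<and> (\<integral>w. \<bar>indicator A w - \<Phi> (\<lambda>u. B u w)\<bar> \<partial>M) < \<eta>)"

lemma functional_measurable:
  assumes \<Phi>: "lipschitz_functional U L \<Phi>"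
  shows "(\<lambda>w. \<Phi> (\<lambda>u. B u w)) \<in> borel_measurable M"
  by (rule lipschitz_functional_measurable[OF \<Phi>]) (use lipschitz_functionalD(2)[OF \<Phi>] in auto)

lemma integrable_indicator_diff:
  assumes "A \<in> events" "f \<in> borel_measurable M" "\<And>w. 0 \<le> f w \<and> f w \<le> (1::real)"
  shows "integrable M (\<lambda>w. \<bar>indicator A w - f w\<bar>)"
proof (rule integrable_bounded[where c = 1])
  show "\<bar>\<bar>indicator A w - f w\<bar>\<bar> \<le> 1" for w
    using assms(3)[of w] by (auto simp: indicator_def)
qed (use assms in auto)

lemma approximable_empty: "approximable {}"
proof -
  have "lipschitz_functional {} 0 (\<lambda>_. 0)"
    by (auto simp: lipschitz_functional_def)
  then show ?thesis unfolding approximable_def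
    by (auto intro!: exI[of _ "{}"] exI[of _ "0::real"] exI[of _ "\<lambda>_. 0"])
qed

lemma approximable_compl:
  assumes "approximable A" shows "approximable (space M - A)"
  unfolding approximable_def
proof (intro conjI allI impI)
  show "space M - A \<in> events" using assms by (auto simp: approximable_def)
  fix \<eta> :: real assume "\<eta> > 0"
  then obtain U L \<Phi> where \<Phi>: "lipschitz_functional U L \<Phi>"
    "(\<integral>w. \<bar>indicator A w - \<Phi> (\<lambda>u. B u w)\<bar> \<partial>M) < \<eta>" using assms by (auto simp: approximable_def)
  have "(\<integral>w. \<bar>indicator (space M - A) w - (1 - \<Phi> (\<lambda>u. B u w))\<bar> \<partial>M) = (\<integral>w. \<bar>indicator A w - \<Phi> (\<lambda>u. B u w)\<bar> \<partial>M)"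
    by (rule Bochner_Integration.integral_cong) (auto simp: indicator_def)
  then show "\<exists>U L \<Phi>. lipschitz_functional U L \<Phi> \<and> (\<integral>w. \<bar>indicator (space M - A) w - \<Phi> (\<lambda>u. B u w)\<bar> \<partial>M) < \<eta>"
    using \<Phi>(2) lipschitz_functional_compl[OF \<Phi>(1)]
    by (intro exI[of _ U] exI[of _ L] exI[of _ "\<lambda>b. 1 - \<Phi> b"]) simp
qed

lemma approximable_Un:
  assumes A: "approximable A" and A': "approximable A'" shows "approximable (A \<union> A')"
  unfolding approximable_def
proof (intro conjI allI impI)
  have m: "A \<in> events" "A' \<in> events" using A A' by (auto simp: approximable_def)
  then show "A \<union> A' \<in> events" by auto
  fix \<eta> :: real assume "\<eta> > 0"
  then have "\<eta> / 2 > 0" by simp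
  then obtain U L \<Phi> where \<Phi>: "lipschitz_functional U L \<Phi>"
    "(\<integral>w. \<bar>indicator A w - \<Phi> (\<lambda>u. B u w)\<bar> \<partial>M) < \<eta> / 2" using A unfolding approximable_def by blast
  obtain V K \<Psi> where \<Psi>: "lipschitz_functional V K \<Psi>"
    "(\<integral>w. \<bar>indicator A' w - \<Psi> (\<lambda>u. B u w)\<bar> \<partial>M) < \<eta> / 2"
    using A' \<open>\<eta> / 2 > 0\<close> unfolding approximable_def by blast
  note max = lipschitz_functional_max[OF \<Phi>(1) \<Psi>(1)]
  have i: "integrable M (\<lambda>w. \<bar>indicator A w - \<Phi> (\<lambda>u. B u w)\<bar>)" "integrable M (\<lambda>w. \<bar>indicator A' w - \<Psi> (\<lambda>u. B u w)\<bar>)"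
    by (intro integrable_indicator_diff functional_measurable[OF \<Phi>(1)] functional_measurable[OF \<Psi>(1)] m conjI
        lipschitz_functionalD(5,6)[OF \<Phi>(1)] lipschitz_functionalD(5,6)[OF \<Psi>(1)])+
  have "(\<integral>w. \<bar>indicator (A \<union> A') w - max (\<Phi> (\<lambda>u. B u w)) (\<Psi> (\<lambda>u. B u w))\<bar> \<partial>M) \<le>
     (\<integral>w. \<bar>indicator A w - \<Phi> (\<lambda>u. B u w)\<bar> + \<bar>indicator A' w - \<Psi> (\<lambda>u. B u w)\<bar> \<partial>M)"
  proof (rule integral_mono)
    show "integrable M (\<lambda>w. \<bar>indicator (A \<union> A') w - max (\<Phi> (\<lambda>u. B u w)) (\<Psi> (\<lambda>u. B u w))\<bar>)"
      using m lipschitz_functionalD(5,6)[OF max] functional_measurable[OF max]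
      by (intro integrable_indicator_diff) auto
    fix w
    have "\<bar>indicator (A \<union> A') w - max (\<Phi> (\<lambda>u. B u w)) (\<Psi> (\<lambda>u. B u w))\<bar> =
      \<bar>max (indicator A w) (indicator A' w) - max (\<Phi> (\<lambda>u. B u w)) (\<Psi> (\<lambda>u. B u w))\<bar>"
      by (auto simp: indicator_def)
    then show "\<bar>indicator (A \<union> A') w - max (\<Phi> (\<lambda>u. B u w)) (\<Psi> (\<lambda>u. B u w))\<bar>
      \<le> \<bar>indicator A w - \<Phi> (\<lambda>u. B u w)\<bar> + \<bar>indicator A' w - \<Psi> (\<lambda>u. B u w)\<bar>" by linarith
  qed (use i in auto)
  also have "\<dots> < \<eta>" using i \<Phi> \<Psi> by simp
  finally show "\<exists>U L \<Phi>. lipschitz_functional U L \<Phi> \<and> (\<integral>w. \<bar>indicator (A \<union> A') w - \<Phi> (\<lambda>u. B u w)\<bar> \<partial>M) < \<eta>"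
    using max by blast
qed

text \<open>Dominated convergence and the triangle inequality. The statement is about functions
  \<open>f n\<close> and not about events because it serves two purposes: finite unions tending to a
  countable one, and ramps tending to a half line.\<close>

lemma approximable_limit:
  assumes A: "A \<in> events"
    and f: "\<And>n::nat. f n \<in> borel_measurable M" "\<And>n w. 0 \<le> f n w \<and> f n w \<le> (1::real)"
    and lim: "\<And>w. w \<in> space M \<Longrightarrow> (\<lambda>n. f n w) \<longlonglongrightarrow> indicator A w"
    and ap: "\<And>n \<eta>. \<eta> > 0 \<Longrightarrow>
      \<exists>U L \<Phi>. lipschitz_functional U L \<Phi> \<and> (\<integral>w. \<bar>f n w - \<Phi> (\<lambda>u. B u w)\<bar> \<partial>M) < \<eta>"
  shows "approximable A"
  unfolding approximable_def
proof (intro conjI allI impI A)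
  fix \<eta> :: real assume \<eta>: "\<eta> > 0"
  have "(\<lambda>n. \<integral>w. \<bar>indicator A w - f n w\<bar> \<partial>M) \<longlonglongrightarrow> (\<integral>w. 0 \<partial>M)"
  proof (rule integral_dominated_convergence[where w = "\<lambda>_. 1"])
    show "AE w in M. (\<lambda>n. \<bar>indicator A w - f n w\<bar>) \<longlonglongrightarrow> 0"
    proof (rule AE_I2)
      fix w assume "w \<in> space M"
      from tendsto_rabs[OF tendsto_diff[OF tendsto_const[of "indicator A w"] lim[OF this]]]
      show "(\<lambda>n. \<bar>indicator A w - f n w\<bar>) \<longlonglongrightarrow> 0" by simp
    qed
    show "AE w in M. norm \<bar>indicator A w - f n w\<bar> \<le> 1" for n
    proof (rule AE_I2)
      fix w show "norm \<bar>indicator A w - f n w\<bar> \<le> 1" using f(2)[of n w] by (auto simp: indicator_def)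
    qed
  qed (use A f in auto)
  then have "eventually (\<lambda>n. (\<integral>w. \<bar>indicator A w - f n w\<bar> \<partial>M) < \<eta> / 2) sequentially"
    using \<eta> by (intro order_tendstoD) auto
  then obtain n where n: "(\<integral>w. \<bar>indicator A w - f n w\<bar> \<partial>M) < \<eta> / 2"
    by (auto simp: eventually_sequentially)
  obtain U L \<Phi> where \<Phi>: "lipschitz_functional U L \<Phi>" "(\<integral>w. \<bar>f n w - \<Phi> (\<lambda>u. B u w)\<bar> \<partial>M) < \<eta> / 2"
    using ap[of "\<eta> / 2" n] \<eta> by auto
  note i = integrable_indicator_diff[OF A f, of n]
  have b: "0 \<le> \<Phi> b \<and> \<Phi> b \<le> 1" for b using lipschitz_functionalD(5,6)[OF \<Phi>(1)] by blast
  have j: "integrable M (\<lambda>w. \<bar>f n w - \<Phi> (\<lambda>u. B u w)\<bar>)"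
  proof (rule integrable_bounded[where c = 1])
    fix w show "\<bar>\<bar>f n w - \<Phi> (\<lambda>u. B u w)\<bar>\<bar> \<le> 1"
      using f(2)[of n w] b[of "\<lambda>u. B u w"] by linarith
  qed (use f functional_measurable[OF \<Phi>(1)] in auto)
  have "(\<integral>w. \<bar>indicator A w - \<Phi> (\<lambda>u. B u w)\<bar> \<partial>M) \<le>
      (\<integral>w. \<bar>indicator A w - f n w\<bar> + \<bar>f n w - \<Phi> (\<lambda>u. B u w)\<bar> \<partial>M)"
    by (rule integral_mono[OF integrable_indicator_diff[OF A functional_measurable[OF \<Phi>(1)] b]])
      (use i j in \<open>auto simp: abs_if\<close>)
  also have "\<dots> < \<eta>" using i j n \<Phi> by simp
  finally show "\<exists>U L \<Phi>. lipschitz_functional U L \<Phi> \<and> (\<integral>w. \<bar>indicator A w - \<Phi> (\<lambda>u. B u w)\<bar> \<partial>M) < \<eta>"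
    using \<Phi>(1) by blast
qed

lemma approximable_countable_Un:
  fixes A :: "nat \<Rightarrow> 'a set"
  assumes A: "\<And>i. approximable (A i)" shows "approximable (\<Union>i. A i)"
proof (rule approximable_limit[where f = "\<lambda>n. indicator (\<Union>i\<le>n. A i)"])
  have m: "A i \<in> events" for i using A by (auto simp: approximable_def)
  then show "(\<Union>i. A i) \<in> events" "\<And>n. (indicator (\<Union>i\<le>n. A i) :: _ \<Rightarrow> real) \<in> borel_measurable M" by auto
  have "approximable (\<Union>i\<le>n. A i)" for n
  proof (induction n)
    case (Suc n)
    then show ?case using approximable_Un[OF A[of "Suc n"] Suc] by (simp add: atMost_Suc)
  qed (use A in simp)
  then show "\<exists>U L \<Phi>. lipschitz_functional U L \<Phi> \<and> (\<integral>w. \<bar>indicator (\<Union>i\<le>n. A i) w - \<Phi> (\<lambda>u. B u w)\<bar> \<partial>M) < \<eta>"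
    if "\<eta> > 0" for n \<eta> using that unfolding approximable_def by blast
  show "(\<lambda>n. indicator (\<Union>i\<le>n. A i) w) \<longlonglongrightarrow> (indicator (\<Union>i. A i) w :: real)" for w
  proof (cases "w \<in> (\<Union>i. A i)")
    case True
    then obtain i where i: "w \<in> A i" by blast
    have "(indicator (\<Union>i\<le>n. A i) w :: real) = indicator (\<Union>i. A i) w" if "n \<ge> i" for n
      using i that by (auto simp: indicator_def)
    then show ?thesis by (intro tendsto_eventually) (auto simp: eventually_sequentially)
  qed (auto simp: indicator_def)
qed (auto simp: indicator_def)

lemma approximable_half_line:
  assumes s: "0 \<le> s" shows "approximable {w \<in> space M. B s w < a}"
proof (rule approximable_limit[where f = "\<lambda>n w. max 0 (min 1 (real n * (a - B s w)))"])
  have [measurable]: "B s \<in> borel_measurable M" using s by simp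
  show "{w \<in> space M. B s w < a} \<in> events"
    "\<And>n. (\<lambda>w. max 0 (min 1 (real n * (a - B s w)))) \<in> borel_measurable M" by measurable
  fix w assume w: "w \<in> space M"
  show "(\<lambda>n. max 0 (min 1 (real n * (a - B s w)))) \<longlonglongrightarrow> indicator {w \<in> space M. B s w < a} w"
  proof (cases "B s w < a")
    case True
    then obtain N :: nat where N: "1 / (a - B s w) < real N" using reals_Archimedean2 by blast
    have "max 0 (min 1 (real n * (a - B s w))) = 1" if "n \<ge> N" for n
    proof -
      have "1 / (a - B s w) \<le> real n" using N that by linarith
      then have "1 \<le> real n * (a - B s w)" using True by (simp add: field_simps)
      then show ?thesis by simp
    qed
    then show ?thesis using True w by (intro tendsto_eventually) (auto simp: eventually_sequentially)
  next
    case False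
    then have "real n * (a - B s w) \<le> 0" for n by (simp add: mult_nonneg_nonpos)
    then have "max 0 (min 1 (real n * (a - B s w))) = 0" for n by (meson max.absorb1 min.coboundedI2)
    then show ?thesis using False by simp
  qed
next
  fix n and \<eta> :: real assume "\<eta> > 0"
  then show "\<exists>U L \<Phi>. lipschitz_functional U L \<Phi> \<and>
      (\<integral>w. \<bar>max 0 (min 1 (real n * (a - B s w))) - \<Phi> (\<lambda>u. B u w)\<bar> \<partial>M) < \<eta>"
    using lipschitz_functional_ramp[OF s, of "real n" a]
    by (intro exI[of _ "{s}"] exI[of _ "real n"] exI[of _ "\<lambda>b. max 0 (min 1 (real n * (a - b s)))"]) simp
qed auto

lemma sigma_algebra_approximable: "sigma_algebra (space M) {A. approximable A}"
  unfolding sigma_algebra_iff2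
proof (intro conjI ballI allI impI)
  show "{A. approximable A} \<subseteq> Pow (space M)"
    using sets.sets_into_space by (auto simp: approximable_def)
  show "(\<Union>i. A i) \<in> {A. approximable A}" if "range A \<subseteq> {A. approximable A}" for A :: "nat \<Rightarrow> 'a set"
  proof -
    have "approximable (A i)" for i using that by blast
    from approximable_countable_Un[of A, OF this] show ?thesis by simp
  qed
qed (use approximable_empty approximable_compl in blast)+

lemma approximable_null:
  assumes "N \<in> null_sets M" shows "approximable N"
  unfolding approximable_def
proof (intro conjI allI impI)
  show "N \<in> events" using assms by auto
  fix \<eta> :: real assume "\<eta> > 0"
  have "(\<integral>w. \<bar>indicator N w - (0::real)\<bar> \<partial>M) = (\<integral>w. 0 \<partial>M)"
  proof (rule integral_cong_AE)
    show "AE w in M. \<bar>indicator N w - 0\<bar> = (0::real)" using AE_not_in[OF assms] by eventually_elim simp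
    have "N \<in> events" using assms by auto
    then show "(\<lambda>w. \<bar>indicator N w - (0::real)\<bar>) \<in> borel_measurable M" by measurable
  qed simp
  moreover have "lipschitz_functional {} 0 (\<lambda>_. 0)" by (auto simp: lipschitz_functional_def)
  ultimately show "\<exists>U L \<Phi>. lipschitz_functional U L \<Phi> \<and> (\<integral>w. \<bar>indicator N w - \<Phi> (\<lambda>u. B u w)\<bar> \<partial>M) < \<eta>"
    using \<open>\<eta> > 0\<close> by (intro exI[of _ "{}"] exI[of _ "0::real"] exI[of _ "\<lambda>_. 0"]) simp
qed

lemma approximable_G:
  assumes "A \<in> sets (G t)" shows "approximable A"
proof -
  interpret D: sigma_algebra "space M" "{A. approximable A}" by (rule sigma_algebra_approximable)
  let ?D = "sigma (space M) {A. approximable A}"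
  have sD: "sets ?D = {A. approximable A}" by (rule D.sets_measure_of_eq)
  have spD: "space ?D = space M" by (rule D.space_measure_of_eq)
  have "B s \<in> borel_measurable ?D" if "0 \<le> s" for s
    by (rule borel_measurableI_less) (use approximable_half_line[OF that] in \<open>simp add: sD spD\<close>)
  then have "B s -` E \<inter> space M \<in> {A. approximable A}" if "0 \<le> s" "E \<in> sets borel" for s E
    using measurable_sets[of "B s" ?D borel E] that by (simp only: sD spD)
  then have "sets (G t) \<subseteq> {A. approximable A}"
    unfolding sets_natural_filtration
    by (intro D.sigma_sets_subset) (auto intro: approximable_null)
  then show ?thesis using assms by blast
qed

text \<open>For \<open>h\<close> with values in \<open>[0, 1]\<close> the L1 distance to the
  indicator of \<open>A\<close> is affine in the integrals of \<open>h\<close> over \<open>A\<close>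
  and over its complement. Both events lie in \<open>G t\<close>, so conditioning leaves these
  integrals unchanged.\<close>

lemma conditional_approximation:
  assumes \<Phi>: "lipschitz_functional U L \<Phi>" and t: "0 \<le> t" and A: "A \<in> sets (G (ennreal t))"
  shows "(\<integral>w. \<bar>indicator A w - conditional \<Phi> t w\<bar> \<partial>M) \<le> (\<integral>w. \<bar>indicator A w - \<Phi> (\<lambda>u. B u w)\<bar> \<partial>M)"
proof -
  let ?A = "space M - A"
  have A': "?A \<in> sets (G (ennreal t))" using sets.compl_sets[OF A] by simp
  have m: "A \<in> events" using A by (rule G_sets_M)
  have split: "(\<integral>w. \<bar>indicator A w - h w\<bar> \<partial>M) = prob A - (\<integral>w. indicator A w * h w \<partial>M) + (\<integral>w. indicator ?A w * h w \<partial>M)"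
    if h: "h \<in> borel_measurable M" "\<And>w. 0 \<le> h w \<and> h w \<le> 1" for h :: "'a \<Rightarrow> real"
  proof -
    have i: "integrable M (\<lambda>w. indicator E w * h w)" if "E \<in> events" for E
      by (rule integrable_bounded[where c = 1]) (use that h in \<open>auto simp: indicator_def\<close>)
    have "(\<integral>w. \<bar>indicator A w - h w\<bar> \<partial>M) = (\<integral>w. indicator A w - indicator A w * h w + indicator ?A w * h w \<partial>M)"
      by (rule Bochner_Integration.integral_cong) (use h in \<open>auto simp: indicator_def\<close>)
    then show ?thesis using i[of A] i[of ?A] m by (simp add: emeasure_eq_measure)
  qed
  have "(\<integral>w. \<bar>indicator A w - conditional \<Phi> t w\<bar> \<partial>M) = (\<integral>w. \<bar>indicator A w - \<Phi> (\<lambda>u. B u w)\<bar> \<partial>M)"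
    using split[OF conditional_measurable_M[OF \<Phi> t]] split[OF functional_measurable[OF \<Phi>]]
      conditional_bounds[OF \<Phi> t] lipschitz_functionalD(5,6)[OF \<Phi>]
      integral_conditional[OF \<Phi> t A] integral_conditional[OF \<Phi> t A'] by simp
  then show ?thesis by simp
qed

text \<open>With errors \<open>(1/2)^n\<close>, Markov's inequality and the Borel-Cantelli lemma
  make \<open>A\<close> almost surely equal to the lower limit of the events
  \<open>g n > 1/2\<close>, and \<open>G t\<close> contains the null sets.\<close>

lemma in_G_of_approximation:
  assumes "A \<in> events" and ap: "\<And>\<eta>. \<eta> > 0 \<Longrightarrow>
    \<exists>g\<in>borel_measurable (G t). (\<forall>w. 0 \<le> g w \<and> g w \<le> 1) \<and> (\<integral>w. \<bar>indicator A w - g w\<bar> \<partial>M) \<le> (\<eta>::real)"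
  shows "A \<in> sets (G t)"
proof -
  have "\<exists>g\<in>borel_measurable (G t). (\<forall>w. 0 \<le> g w \<and> g w \<le> 1) \<and> (\<integral>w. \<bar>indicator A w - g w\<bar> \<partial>M) \<le> (1/2::real)^n" for n :: nat
    by (rule ap) simp
  then obtain g where g: "\<And>n::nat. g n \<in> borel_measurable (G t)" "\<And>n w. 0 \<le> g n w \<and> g n w \<le> 1"
    "\<And>n. (\<integral>w. \<bar>indicator A w - g n w\<bar> \<partial>M) \<le> (1/2::real)^n" by metis
  have gM: "g n \<in> borel_measurable M" for n using g(1)[of n] G_subset by (auto simp: measurable_def)
  define C where "C = (\<lambda>n. {w \<in> space M. g n w > 1/2})"
  define E where "E = (\<lambda>n. {w \<in> space M. 1/2 \<le> \<bar>indicator A w - g n w\<bar>})"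
  have C: "C n \<in> sets (G t)" for n
    using borel_measurable_less[OF borel_measurable_const g(1), of "1/2" n] unfolding C_def by simp
  have [measurable]: "E n \<in> events" for n unfolding E_def using assms(1) gM[of n] by measurable
  have pE: "prob (E n) \<le> 2 * (1/2)^n" for n
  proof -
    have "(1/2) * prob (E n) = (\<integral>w. (1/2) * indicator (E n) w \<partial>M)" by simp
    also have "\<dots> \<le> (\<integral>w. \<bar>indicator A w - g n w\<bar> \<partial>M)"
    proof (rule integral_mono[OF _ integrable_indicator_diff[OF assms(1) gM g(2)]])
      show "integrable M (\<lambda>w. (1/2) * indicator (E n) w :: real)" by (simp add: emeasure_eq_measure)
    qed (auto simp: E_def indicator_def)
    finally show ?thesis using g(3)[of n] by linarith
  qed
  have "AE w in M. eventually (\<lambda>n. w \<in> space M - E n) sequentially"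
  proof (rule borel_cantelli_AE1)
    show "summable (\<lambda>n. prob (E n))"
    proof (rule summable_comparison_test')
      show "summable (\<lambda>n. 2 * (1/2)^n :: real)" by (intro summable_mult summable_geometric) simp
      show "norm (prob (E n)) \<le> 2 * (1/2)^n" for n using pE[of n] by simp
    qed
  qed (auto simp: emeasure_eq_measure)
  then have "AE w in M. w \<in> (\<Union>N. \<Inter>n\<in>{N..}. C n) \<longleftrightarrow> w \<in> A"
  proof eventually_elim
    case (elim w)
    then obtain N where N: "\<And>n. n \<ge> N \<Longrightarrow> w \<in> space M - E n" by (auto simp: eventually_sequentially)
    then have eq: "w \<in> C n \<longleftrightarrow> w \<in> A" if "n \<ge> N" for n
    proof -
      have "w \<in> space M" "\<bar>indicator A w - g n w\<bar> < 1/2" using N[OF that] by (auto simp: E_def)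
      then show ?thesis using g(2)[of n w] by (cases "w \<in> A") (auto simp: C_def)
    qed
    show ?case
    proof
      assume "w \<in> (\<Union>N. \<Inter>n\<in>{N..}. C n)"
      then obtain N' where "\<And>n. n \<ge> N' \<Longrightarrow> w \<in> C n" by auto
      then show "w \<in> A" using eq[of "max N N'"] by simp
    qed (use eq in auto)
  qed
  moreover have "(\<Union>N. \<Inter>n\<in>{N..}. C n) \<in> sets (G t)"
    using C by (intro sets.countable_UN sets.countable_INT') auto
  ultimately show ?thesis
    using AE_eq_in_natural_filtration[OF complete_measure_M] sets.sets_into_space[OF assms(1)] by blast
qed

lemma conditional_continuous:
  assumes \<Phi>: "lipschitz_functional U L \<Phi>" and t: "0 \<le> t"
    and c: "continuous_on {0..} (\<lambda>t. B t w)"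
    and r: "\<And>n. t \<le> r n" "r \<longlonglongrightarrow> t"
  shows "(\<lambda>n. conditional \<Phi> (r n) w) \<longlonglongrightarrow> conditional \<Phi> t w"
proof -
  have U: "u \<ge> 0" if "u \<in> U" for u using that lipschitz_functionalD(2)[OF \<Phi>] by auto
  have "(\<lambda>n. B (min u (r n)) w - B (min u t) w) \<longlonglongrightarrow> B (min u t) w - B (min u t) w" if "u \<in> U" for u
  proof (intro tendsto_diff tendsto_const)
    show "(\<lambda>n. B (min u (r n)) w) \<longlonglongrightarrow> B (min u t) w"
      by (rule continuous_on_tendsto_compose[OF c tendsto_min[OF tendsto_const r(2)]])
        (use t r(1) U[OF that] in \<open>auto intro!: always_eventually order_trans[OF t]\<close>)
  qed
  moreover have "(\<lambda>n. sqrt (r n - t)) \<longlonglongrightarrow> sqrt (t - t)"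
    by (intro tendsto_intros r)
  ultimately have "(\<lambda>n. L * (\<Sum>u\<in>U. \<bar>B (min u (r n)) w - B (min u t) w\<bar> + sqrt (2 / pi) * sqrt (r n - t)))
     \<longlonglongrightarrow> L * (\<Sum>u\<in>U. \<bar>B (min u t) w - B (min u t) w\<bar> + sqrt (2 / pi) * sqrt (t - t))"
    by (intro tendsto_mult tendsto_const tendsto_sum tendsto_add tendsto_rabs) auto
  then have lim: "(\<lambda>n. L * (\<Sum>u\<in>U. \<bar>B (min u (r n)) w - B (min u t) w\<bar> + sqrt (2 / pi) * sqrt (r n - t))) \<longlonglongrightarrow> 0"
    by simp
  have "(\<lambda>n. conditional \<Phi> (r n) w - conditional \<Phi> t w) \<longlonglongrightarrow> 0"
    by (rule tendsto_rabs_zero_cancel[OF real_tendsto_sandwich[OF _ _ tendsto_const lim]])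
      (use conditional_oscillation[OF \<Phi> t r(1)] in \<open>auto intro: always_eventually\<close>)
  then show ?thesis by (simp add: LIM_zero_iff)
qed

text \<open>At each time \<open>t + 1/(n+1)\<close> the event is measurable, so conditioning there
  keeps the L1 error below \<open>\<eta>\<close>. Right-continuity of \<open>conditional\<close> on
  continuous paths carries the bound down to \<open>t\<close>.\<close>

lemma G_right_continuous:
  assumes t: "0 \<le> t" and A: "\<And>\<epsilon>. \<epsilon> > 0 \<Longrightarrow> A \<in> sets (G (ennreal (t + \<epsilon>)))"
  shows "A \<in> sets (G (ennreal t))"
proof (rule in_G_of_approximation)
  have ap: "approximable A" using A[of 1] by (intro approximable_G) auto
  then show m: "A \<in> events" by (simp add: approximable_def)
  fix \<eta> :: real assume "\<eta> > 0"
  then obtain U L \<Phi> where \<Phi>: "lipschitz_functional U L \<Phi>" "(\<integral>w. \<bar>indicator A w - \<Phi> (\<lambda>u. B u w)\<bar> \<partial>M) < \<eta>"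
    using ap by (auto simp: approximable_def)
  define r where "r = (\<lambda>n. t + inverse (real (Suc n)))"
  have r: "t \<le> r n" "0 \<le> r n" for n using t by (auto simp: r_def)
  have r_lim: "r \<longlonglongrightarrow> t" unfolding r_def by (rule LIMSEQ_inverse_real_of_nat_add)
  have "(\<lambda>n. \<integral>w. \<bar>indicator A w - conditional \<Phi> (r n) w\<bar> \<partial>M) \<longlonglongrightarrow> (\<integral>w. \<bar>indicator A w - conditional \<Phi> t w\<bar> \<partial>M)"
  proof (rule integral_dominated_convergence[where w = "\<lambda>_. 1"])
    show "AE w in M. (\<lambda>n. \<bar>indicator A w - conditional \<Phi> (r n) w\<bar>) \<longlonglongrightarrow> \<bar>indicator A w - conditional \<Phi> t w\<bar>"
      using B_continuous by eventually_elim (intro tendsto_intros conditional_continuous[OF \<Phi>(1) t _ r(1) r_lim])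
    show "AE w in M. norm \<bar>indicator A w - conditional \<Phi> (r n) w\<bar> \<le> 1" for n
    proof (rule AE_I2)
      fix w show "norm \<bar>indicator A w - conditional \<Phi> (r n) w\<bar> \<le> 1"
        using conditional_bounds[OF \<Phi>(1) r(2)[of n], of w] by (auto simp: indicator_def)
    qed
  qed (use m conditional_measurable_M[OF \<Phi>(1)] t r in auto)
  moreover have "(\<integral>w. \<bar>indicator A w - conditional \<Phi> (r n) w\<bar> \<partial>M) \<le> \<eta>" for n
    using conditional_approximation[OF \<Phi>(1) r(2), of A n] A[of "inverse (real (Suc n))"] \<Phi>(2)
    by (simp add: r_def)
  ultimately have "(\<integral>w. \<bar>indicator A w - conditional \<Phi> t w\<bar> \<partial>M) \<le> \<eta>"
    using LIMSEQ_le_const2 by blast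
  then show "\<exists>g\<in>borel_measurable (G (ennreal t)). (\<forall>w. 0 \<le> g w \<and> g w \<le> 1) \<and> (\<integral>w. \<bar>indicator A w - g w\<bar> \<partial>M) \<le> \<eta>"
    using conditional_measurable[OF \<Phi>(1) t] conditional_bounds[OF \<Phi>(1) t] by blast
qed

end

section \<open>Stopping times avoid the last passage time\<close>

text \<open>The standard normal distribution function.\<close>

definition std_normal_below :: "real \<Rightarrow> real" where
  "std_normal_below a = measure (density lborel std_normal_density) {..<a}"

lemma std_normal_below_pos: "0 < std_normal_below a"
proof -
  interpret N: prob_space "density lborel std_normal_density" by (rule prob_space_normal_density) simp
  have "std_normal_below a \<noteq> 0"
  proof
    assume "std_normal_below a = 0"
    then have "emeasure (density lborel std_normal_density) {..<a} = 0"
      by (simp add: std_normal_below_def N.emeasure_eq_measure)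
    then have "AE x in lborel. ennreal (std_normal_density x) * indicator {..<a} x = 0"
      by (subst (asm) emeasure_density) (auto simp: nn_integral_0_iff_AE)
    then have "AE x in lborel. x \<notin> {..<a}"
      by eventually_elim (use normal_density_pos[of 1 0] in \<open>auto simp: indicator_def split: if_splits\<close>,
          metis less_numeral_extra(3) normal_density_pos zero_less_one)
    then have "{..<a} \<in> null_sets lborel" by (subst AE_iff_null_sets) auto
    then have "{a - 1<..<a} \<in> null_sets lborel" by (rule null_sets_subset) auto
    then show False by (simp add: null_sets_def)
  qed
  then show ?thesis unfolding std_normal_below_def by (simp add: less_le)
qed

lemma std_normal_below_tendsto_0: "(\<lambda>n. std_normal_below (- real n)) \<longlonglongrightarrow> 0"
proof -
  interpret N: prob_space "density lborel std_normal_density" by (rule prob_space_normal_density) simp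
  have "(\<lambda>n. measure (density lborel std_normal_density) {..<- real n}) \<longlonglongrightarrow>
      measure (density lborel std_normal_density) (\<Inter>n. {..<- real n})"
    by (rule N.finite_Lim_measure_decseq) (auto simp: decseq_def)
  moreover have "(\<Inter>n. {..<- real n}) = {}"
  proof (rule equals0I)
    fix x assume x: "x \<in> (\<Inter>n. {..<- real n})"
    obtain n :: nat where "- x < real n" using reals_Archimedean2 by blast
    moreover have "x < - real n" using x by blast
    ultimately show False by simp
  qed
  ultimately show ?thesis by (simp add: std_normal_below_def)
qed

lemma (in prob_space) prob_std_normal_below:
  assumes "distributed M lborel Y std_normal_density"
  shows "prob {w \<in> space M. Y w < a} = std_normal_below a"
proof -
  have Y: "Y \<in> measurable M lborel" and d: "distr M lborel Y = density lborel std_normal_density"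
    using assms by (auto simp: distributed_def)
  have "std_normal_below a = measure (distr M lborel Y) {..<a}" by (simp add: std_normal_below_def d)
  also have "\<dots> = prob (Y -` {..<a} \<inter> space M)" by (rule measure_distr[OF Y]) simp
  also have "Y -` {..<a} \<inter> space M = {w \<in> space M. Y w < a}" by auto
  finally show ?thesis by simp
qed

text \<open>The supremum is attained: if the path were off the level at \<open>t\<close>, continuity
  would leave an interval around \<open>t\<close> without visits, and the supremum would be at most
  \<open>t - d\<close>.\<close>

lemma last_passage_exit:
  assumes c: "continuous_on {0..} (\<lambda>t. B t w)" and \<sigma>: "last_passage B \<mu> z w = ennreal t" "0 < t"
  shows "drifted B \<mu> t w = z" "t < s \<Longrightarrow> drifted B \<mu> s w \<noteq> z"
proof -
  let ?V = "{ennreal s | s. 0 < s \<and> drifted B \<mu> s w = z}"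
  have sup: "Sup ?V = ennreal t" using \<sigma>(1) by (simp add: last_passage_def)
  show after: "drifted B \<mu> s w \<noteq> z" if "t < s" for s
  proof
    assume "drifted B \<mu> s w = z"
    then have "ennreal s \<le> Sup ?V" using that \<sigma>(2) by (intro Sup_upper) auto
    then show False using sup that \<sigma>(2) by simp
  qed
  have cX: "continuous_on {0..} (\<lambda>t. drifted B \<mu> t w)"
    unfolding drifted_def by (intro continuous_intros c)
  show "drifted B \<mu> t w = z"
  proof (rule ccontr)
    assume ne: "drifted B \<mu> t w \<noteq> z"
    have "(\<lambda>t. drifted B \<mu> t w) \<midarrow>t\<rightarrow> drifted B \<mu> t w"
      using continuous_on_interior[OF cX, of t] \<sigma>(2) by (simp add: isCont_def)
    then have "eventually (\<lambda>s. drifted B \<mu> s w \<noteq> z) (at t)"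
      by (rule tendsto_imp_eventually_ne[OF _ ne])
    then obtain d where d: "d > 0" "\<And>s. s \<noteq> t \<Longrightarrow> dist s t < d \<Longrightarrow> drifted B \<mu> s w \<noteq> z"
      by (auto simp: eventually_at)
    have "Sup ?V \<le> ennreal (t - d)"
    proof (rule Sup_least, clarify)
      fix s assume s: "0 < s" "z = drifted B \<mu> s w"
      have "s \<noteq> t" using s ne by auto
      then have "\<not> dist s t < d" "s \<le> t" using d(2)[of s] after[of s] s by (auto intro: leI)
      then show "ennreal s \<le> ennreal (t - d)" by (intro ennreal_leI) (auto simp: dist_real_def)
    qed
    then have "ennreal t \<le> ennreal (t - d)" using sup by simp
    \<comment> \<open>\<open>ennreal\<close> truncates a negative \<open>t - d\<close> to 0; in that
      case \<open>0 < t\<close> gives the contradiction.\<close>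
    then show False using d(1) \<sigma>(2) by (cases "t - d \<ge> 0") (auto simp: ennreal_neg)
  qed
qed

text \<open>A path that avoids the level after \<open>t\<close> cannot take values on both sides of
  it, by the intermediate value theorem. The sign \<open>c\<close> records the side; both signs are
  kept because the argument below excludes each of them.\<close>

lemma last_passage_one_sided:
  assumes c: "continuous_on {0..} (\<lambda>t. B t w)" and \<sigma>: "last_passage B \<mu> z w = ennreal t" "0 < t"
  shows "\<exists>c\<in>{1, -1}. \<forall>s>t. 0 < c * (drifted B \<mu> s w - drifted B \<mu> t w)"
proof -
  have z: "drifted B \<mu> t w = z" "\<And>s. t < s \<Longrightarrow> drifted B \<mu> s w \<noteq> z"
    using last_passage_exit[OF c \<sigma>] by auto
  have cX: "continuous_on {t<..} (\<lambda>t. drifted B \<mu> t w)"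
    unfolding drifted_def by (intro continuous_intros continuous_on_subset[OF c]) (use \<sigma>(2) in auto)
  have "connected ((\<lambda>t. drifted B \<mu> t w) ` {t<..})"
    by (rule connected_continuous_image[OF cX]) simp
  then have iv: "is_interval ((\<lambda>t. drifted B \<mu> t w) ` {t<..})" by (simp add: is_interval_connected_1)
  have no: "\<not> (drifted B \<mu> a w \<le> z \<and> z \<le> drifted B \<mu> b w)" if "t < a" "t < b" for a b
  proof
    assume le: "drifted B \<mu> a w \<le> z \<and> z \<le> drifted B \<mu> b w"
    have "z \<in> (\<lambda>t. drifted B \<mu> t w) ` {t<..}"
      by (rule mem_is_interval_1_I[OF iv imageI imageI le[THEN conjunct1] le[THEN conjunct2]]) (use that in simp_all)
    then show False using z(2) by auto
  qed
  have "(\<forall>s>t. z < drifted B \<mu> s w) \<or> (\<forall>s>t. drifted B \<mu> s w < z)"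
  proof (cases "\<forall>s>t. z < drifted B \<mu> s w")
    case False
    then obtain a where a: "t < a" "drifted B \<mu> a w \<le> z" by (auto simp: not_less)
    have "drifted B \<mu> s w < z" if "t < s" for s using no[OF a(1) that] a(2) by linarith
    then show ?thesis by blast
  qed blast
  then show ?thesis using z(1) by auto
qed

section \<open>The zero-one law at time 0 and positivity of the last passage time\<close>

locale drifted_setting = brownian_setting M B for M :: "'a measure" and B +
  fixes \<mu> z :: real
  assumes drift_pos: "0 < \<mu>" and level_pos: "0 < z"
begin

abbreviation X :: "real \<Rightarrow> 'a \<Rightarrow> real" where "X \<equiv> drifted B \<mu>"
abbreviation \<sigma> :: "'a \<Rightarrow> ennreal" where "\<sigma> \<equiv> last_passage B \<mu> z"

lemma X_measurable_G:
  "0 \<le> s \<Longrightarrow> ennreal s \<le> t \<Longrightarrow> X s \<in> borel_measurable (G t)"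
  using measurable_natural_filtration[of s t B M] unfolding drifted_def by measurable

lemma X_measurable [measurable]: "0 \<le> s \<Longrightarrow> X s \<in> borel_measurable M"
  unfolding drifted_def by measurable

text \<open>The cylinders at time 0 only see \<open>B 0 - B 0\<close>, which is constant, so up to
  null sets the sigma-algebra is trivial. Right-continuity of \<open>G\<close> turns this into
  Blumenthal's law.\<close>

lemma G_zero_trivial:
  assumes "D \<in> sets (G (ennreal 0))" shows "prob D = 0 \<or> prob D = 1"
proof -
  let ?P = "{(\<lambda>w. \<lambda>s\<in>S. B s w - B 0 w) -` E \<inter> space M | S E.
         finite S \<and> S \<subseteq> {0..0} \<and> E \<in> sets (PiM S (\<lambda>_. borel))}"
  obtain D' where D': "D' \<in> sigma_sets (space M) ?P" "AE w in M. w \<in> D \<longleftrightarrow> w \<in> D'"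
    using past_AE_eq_cylinder[OF order_refl assms] by blast
  have "?P \<subseteq> {{}, space M}"
  proof
    fix a assume "a \<in> ?P"
    then obtain S E where a: "a = (\<lambda>w. \<lambda>s\<in>S. B s w - B 0 w) -` E \<inter> space M" and S: "S \<subseteq> {0..0}" by blast
    have "(\<lambda>s\<in>S. B s w - B 0 w) = (\<lambda>s\<in>S. 0)" for w
      by (rule ext) (use S in \<open>auto simp: restrict_def\<close>)
    then have "a = (if (\<lambda>s\<in>S. 0) \<in> E then space M else {})" unfolding a by auto
    then show "a \<in> {{}, space M}" by simp
  qed
  then have "sigma_sets (space M) ?P \<subseteq> {{}, space M}"
    by (rule sigma_algebra.sigma_sets_subset[OF sigma_algebra_trivial])
  then have "D' = {} \<or> D' = space M" using D'(1) by blast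
  then have "D' \<in> events" "prob D' = 0 \<or> prob D' = 1" by (auto simp: prob_space)
  moreover have "prob D = prob D'"
    using D' assms \<open>D' \<in> events\<close> by (intro measure_eq_AE) (auto dest: G_sets_M)
  ultimately show ?thesis by simp
qed

lemma B_std_normal:
  assumes t: "0 < t" and c: "c \<in> {1, -1}"
  shows "distributed M lborel (\<lambda>w. c / sqrt t * (B t w - B 0 w)) std_normal_density"
proof -
  have eq: "\<bar>c / sqrt t\<bar> * sqrt (t - 0) = 1" using t c by auto
  have "distributed M lborel (\<lambda>w. 0 + c / sqrt t * (B t w - B 0 w))
      (normal_density (0 + c / sqrt t * 0) (\<bar>c / sqrt t\<bar> * sqrt (t - 0)))"
    by (rule normal_density_affine[OF B_increment]) (use t c in auto)
  then show ?thesis unfolding eq by simp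
qed

text \<open>For \<open>t \<le> 1\<close> the drift contributes at most
  \<open>\<mu> * t \<le> \<mu> * sqrt t\<close>, so a normalised Brownian value below
  \<open>- \<mu>\<close> outweighs it. What matters is that the bound is positive and independent of
  \<open>t\<close>.\<close>

lemma prob_negative:
  assumes t: "0 < t" "t \<le> 1" and c: "c \<in> {1, -1}"
  shows "std_normal_below (- \<mu>) \<le> prob {w \<in> space M. c * X t w < 0}"
proof -
  have "std_normal_below (- \<mu>) = prob {w \<in> space M. c / sqrt t * (B t w - B 0 w) < - \<mu>}"
    by (rule prob_std_normal_below[symmetric, OF B_std_normal[OF t(1) c]])
  also have "\<dots> \<le> prob {w \<in> space M. c * X t w < 0}"
  proof (rule finite_measure_mono_AE)
    show "AE w in M. w \<in> {w \<in> space M. c / sqrt t * (B t w - B 0 w) < - \<mu>} \<longrightarrow>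
        w \<in> {w \<in> space M. c * X t w < 0}"
      using B_zero
    proof eventually_elim
      case (elim w)
      have "c * X t w < 0" if "c / sqrt t * B t w < - \<mu>"
      proof -
        have "c * B t w < - \<mu> * sqrt t" using that t by (simp add: field_simps)
        moreover have "sqrt t * 1 \<ge> sqrt t * sqrt t" using t by (intro mult_left_mono) auto
        then have "\<mu> * t \<le> \<mu> * sqrt t" using t drift_pos by simp
        moreover have "c * (\<mu> * t) \<le> \<mu> * t" using c t drift_pos by auto
        ultimately show ?thesis unfolding drifted_def by (simp add: algebra_simps)
      qed
      then show ?case using elim by auto
    qed
    have [measurable]: "X t \<in> borel_measurable M" using t by simp
    show "{w \<in> space M. c * X t w < 0} \<in> events" by measurable
  qed
  finally show ?thesis .
qed

text \<open>The events \<open>E N\<close> increase, so their union can be started at any index and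
  is decided by arbitrarily small times: it lies in \<open>G 0\<close> and has probability 0 or 1.
  The uniform bound of \<open>prob_negative\<close> excludes 1.\<close>

lemma AE_negative_near_zero:
  assumes c: "c \<in> {1, -1}"
  shows "AE w in M. \<exists>i. c * X (inverse (real (Suc i))) w < 0"
proof -
  let ?s = "\<lambda>i. inverse (real (Suc i))"
  define E where "E = (\<lambda>N. {w \<in> space M. \<forall>i\<ge>N. 0 \<le> c * X (?s i) w})"
  have inc: "incseq E" by (auto simp: E_def incseq_def)
  have EG: "E N \<in> sets (G (ennreal \<epsilon>))" if "?s N < \<epsilon>" for N \<epsilon>
  proof -
    have "{w \<in> space M. 0 \<le> c * X (?s i) w} \<in> sets (G (ennreal \<epsilon>))" if "i \<in> {N..}" for i
    proof -
      have "?s i \<le> ?s N" using that by (intro le_imp_inverse_le) auto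
      then have "?s i \<le> \<epsilon>" by (rule order_trans[OF _ less_imp_le[OF \<open>?s N < \<epsilon>\<close>]])
      then have [measurable]: "X (?s i) \<in> borel_measurable (G (ennreal \<epsilon>))"
        by (intro X_measurable_G ennreal_leI) simp_all
      have "{w \<in> space (G (ennreal \<epsilon>)). 0 \<le> c * X (?s i) w} \<in> sets (G (ennreal \<epsilon>))" by measurable
      then show ?thesis by simp
    qed
    then have "(\<Inter>i\<in>{N..}. {w \<in> space M. 0 \<le> c * X (?s i) w}) \<in> sets (G (ennreal \<epsilon>))"
      by (intro sets.countable_INT') auto
    moreover have "(\<Inter>i\<in>{N..}. {w \<in> space M. 0 \<le> c * X (?s i) w}) = E N" by (auto simp: E_def)
    ultimately show ?thesis by simp
  qed
  have "(\<Union>N. E N) \<in> sets (G (ennreal 0))"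
  proof (rule G_right_continuous)
    fix \<epsilon> :: real assume "\<epsilon> > 0"
    then obtain N0 where N0: "?s N0 < \<epsilon>" using reals_Archimedean by blast
    have "(\<Union>N\<in>{N0..}. E N) \<in> sets (G (ennreal (0 + \<epsilon>)))"
    proof (rule sets.countable_UN'')
      fix N assume "N \<in> {N0..}"
      then have "?s N \<le> ?s N0" by (intro le_imp_inverse_le) auto
      then show "E N \<in> sets (G (ennreal (0 + \<epsilon>)))" using EG[OF le_less_trans[OF _ N0]] by simp
    qed auto
    moreover have "(\<Union>N\<in>{N0..}. E N) = (\<Union>N. E N)"
    proof
      show "(\<Union>N. E N) \<subseteq> (\<Union>N\<in>{N0..}. E N)"
      proof
        fix w assume "w \<in> (\<Union>N. E N)"
        then obtain N where "w \<in> E N" by blast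
        then have "w \<in> E (max N N0)" using incseqD[OF inc, of N "max N N0"] by auto
        then show "w \<in> (\<Union>N\<in>{N0..}. E N)" by (auto intro: bexI[of _ "max N N0"])
      qed
    qed auto
    ultimately show "(\<Union>N. E N) \<in> sets (G (ennreal (0 + \<epsilon>)))" by simp
  qed simp
  then have triv: "prob (\<Union>N. E N) = 0 \<or> prob (\<Union>N. E N) = 1" and ev: "(\<Union>N. E N) \<in> events"
    by (rule G_zero_trivial, rule G_sets_M)
  have Ee: "E N \<in> events" for N using EG[of N "?s N + 1"] by (intro G_sets_M) auto
  have bound: "prob (E N) \<le> 1 - std_normal_below (- \<mu>)" for N
  proof -
    have [measurable]: "X (?s N) \<in> borel_measurable M" by simp
    have m: "{w \<in> space M. c * X (?s N) w < 0} \<in> events" by measurable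
    have "prob (E N) \<le> prob (space M - {w \<in> space M. c * X (?s N) w < 0})"
      using m by (intro finite_measure_mono) (auto simp: E_def)
    also have "\<dots> = 1 - prob {w \<in> space M. c * X (?s N) w < 0}" by (rule prob_compl[OF m])
    also have "\<dots> \<le> 1 - std_normal_below (- \<mu>)"
      using prob_negative[of "?s N" c] c by (simp add: inverse_le_1_iff)
    finally show ?thesis .
  qed
  have "(\<lambda>N. prob (E N)) \<longlonglongrightarrow> prob (\<Union>N. E N)"
    using Ee inc by (intro finite_Lim_measure_incseq) auto
  then have "prob (\<Union>N. E N) \<le> 1 - std_normal_below (- \<mu>)"
    using bound by (intro LIMSEQ_le_const2) auto
  then have "prob (\<Union>N. E N) = 0" using triv std_normal_below_pos[of "- \<mu>"] by auto
  then have "(\<Union>N. E N) \<in> null_sets M" using ev by (simp add: null_sets_def emeasure_eq_measure)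
  then have "AE w in M. w \<notin> (\<Union>N. E N)" by (rule AE_not_in)
  then show ?thesis using AE_space
  proof eventually_elim
    case (elim w)
    then have "w \<notin> E 0" by blast
    then show ?case using elim(2) by (auto simp: E_def not_le)
  qed
qed

text \<open>The supremum is 0 exactly when no visit occurs, so a visit has to be produced. Staying
  below \<open>z\<close> at all times \<open>m^2\<close> would force the normalised Brownian value
  there below any given bound, which has probability 0; a path that reaches \<open>z\<close> or more
  crosses the level after time 0, where it starts below.\<close>

lemma AE_last_passage_pos: "AE w in M. 0 < \<sigma> w"
proof -
  define A where "A = {w \<in> space M. \<forall>m\<ge>1::nat. X (real m ^ 2) w < z}"
  have A: "A \<in> events"
  proof -
    have "{w \<in> space M. X (real m ^ 2) w < z} \<in> events" for m :: nat
    proof -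
      have [measurable]: "X (real m ^ 2) \<in> borel_measurable M" by simp
      show ?thesis by measurable
    qed
    then have "(\<Inter>m\<in>{1..}. {w \<in> space M. X (real m ^ 2) w < z}) \<in> events"
      by (intro sets.countable_INT') auto
    moreover have "(\<Inter>m\<in>{1..}. {w \<in> space M. X (real m ^ 2) w < z}) = A" by (auto simp: A_def)
    ultimately show ?thesis by metis
  qed
  have "prob A \<le> std_normal_below (- real k)" for k
  proof -
    \<comment> \<open>The choice gives \<open>z - \<mu> * m \<le> - k\<close>; together with
      \<open>z \<le> z * m\<close>, for \<open>m \<ge> 1\<close>, this yields
      \<open>B (m^2) < - k * m\<close>.\<close>
    obtain m0 :: nat where m0: "(z + real k) / \<mu> < real m0" using reals_Archimedean2 by blast
    define m where "m = max 1 m0"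
    have m: "m \<ge> 1" "z + real k \<le> \<mu> * real m"
      using m0 drift_pos by (auto simp: m_def field_simps intro: order_trans less_imp_le)
    have "prob A \<le> prob {w \<in> space M. 1 / sqrt (real m ^ 2) * (B (real m ^ 2) w - B 0 w) < - real k}"
    proof (rule finite_measure_mono_AE)
      have [measurable]: "B (real m ^ 2) \<in> borel_measurable M" "B 0 \<in> borel_measurable M" by auto
      show "{w \<in> space M. 1 / sqrt (real m ^ 2) * (B (real m ^ 2) w - B 0 w) < - real k} \<in> events" by measurable
      show "AE w in M. w \<in> A \<longrightarrow> w \<in> {w \<in> space M. 1 / sqrt (real m ^ 2) * (B (real m ^ 2) w - B 0 w) < - real k}"
        using B_zero
      proof eventually_elim
        case (elim w)
        have "B (real m ^ 2) w < - real k * real m" if "X (real m ^ 2) w < z"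
        proof -
          have "B (real m ^ 2) w < z - \<mu> * real m * real m"
            using that by (simp add: drifted_def power2_eq_square algebra_simps)
          also have "\<dots> \<le> z * real m - \<mu> * real m * real m" using m level_pos by simp
          also have "\<dots> = (z - \<mu> * real m) * real m" by (simp add: algebra_simps)
          also have "\<dots> \<le> - real k * real m" using m by (intro mult_right_mono) auto
          finally show ?thesis .
        qed
        then show ?case using m elim by (auto simp: A_def field_simps)
      qed
    qed
    also have "\<dots> = std_normal_below (- real k)"
      by (rule prob_std_normal_below[OF B_std_normal]) (use m in auto)
    finally show ?thesis .
  qed
  then have "prob A \<le> 0"
    by (intro LIMSEQ_le_const[OF std_normal_below_tendsto_0]) blast
  then have "A \<in> null_sets M" using A by (simp add: null_sets_def emeasure_eq_measure measure_le_0_iff)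
  then have "AE w in M. w \<notin> A" by (rule AE_not_in)
  then show ?thesis using AE_space B_zero B_continuous
  proof eventually_elim
    case (elim w)
    then obtain m :: nat where m: "m \<ge> 1" "z \<le> X (real m ^ 2) w" by (auto simp: A_def not_less)
    have "continuous_on {0..real m ^ 2} (\<lambda>t. X t w)"
      unfolding drifted_def by (intro continuous_intros continuous_on_subset[OF elim(4)]) auto
    then obtain t where t: "0 \<le> t" "t \<le> real m ^ 2" "X t w = z"
      using IVT'[of "\<lambda>t. X t w" 0 z "real m ^ 2"] elim(3) level_pos m by (auto simp: drifted_def)
    have "t \<noteq> 0" using t(3) elim(3) level_pos by (auto simp: drifted_def)
    then have "0 < ennreal t" using t by simp
    also have "ennreal t \<le> \<sigma> w" unfolding last_passage_def using t \<open>t \<noteq> 0\<close> by (intro Sup_upper) auto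
    finally show ?case .
  qed
qed

text \<open>A test at finitely many times after \<open>r\<close> of whether the path stays on side
  \<open>c\<close> of its value at \<open>r\<close>. The tolerance \<open>\<delta>\<close> lets a
  strict inequality after a random time pass to the nearby grid times.\<close>

definition above_after :: "real \<Rightarrow> real \<Rightarrow> nat \<Rightarrow> real \<Rightarrow> 'a set" where
  "above_after c r m \<delta> =
     {w \<in> space M. \<forall>i<m. - \<delta> \<le> c * (X (r + inverse (real (Suc i))) w - X r w)}"

lemma X_diff: "X (r + s) w - X r w = B (r + s) w - B r w + \<mu> * s"
  by (simp add: drifted_def algebra_simps)

lemma above_after_events [measurable]:
  assumes "0 \<le> r" shows "above_after c r m \<delta> \<in> events"
proof -
  have [measurable]: "X (r + inverse (real (Suc i))) \<in> borel_measurable M" "X r \<in> borel_measurable M" for i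
    using assms by auto
  show ?thesis unfolding above_after_def by measurable
qed

text \<open>The test is a function of the increments between consecutive test times, whose joint law
  is a product of Gaussian laws that does not involve \<open>r\<close>.\<close>

lemma prob_above_after_stationary:
  assumes r: "0 \<le> r" and m: "0 < m"
  shows "prob (above_after c r m \<delta>) = prob (above_after c 0 m \<delta>)"
proof -
  let ?s = "\<lambda>i. inverse (real (Suc i))"
  \<comment> \<open>The test times \<open>1/(i+1)\<close> decrease in \<open>i\<close>;
    \<open>v\<close> lists them in increasing order after 0, so that test \<open>i\<close> sits at
    position \<open>m - i\<close>.\<close>
  define v where "v = (\<lambda>k. if k = 0 then 0 else ?s (m - k))"
  define \<nu> where "\<nu> = (\<lambda>k. density lborel (\<lambda>x. ennreal (normal_density 0 (sqrt (v (Suc k) - v k)) x)))"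
  define S where "S = {x \<in> space (PiM {..<m} (\<lambda>_. borel)). \<forall>i<m. - \<delta> \<le> c * ((\<Sum>k<m - i. x k) + \<mu> * ?s i)}"
  have v: "v k < v (Suc k)" "0 \<le> v k" if "k < m" for k
  proof -
    have "m - Suc k < m - k" using that by simp
    then show "v k < v (Suc k)" "0 \<le> v k" by (auto simp: v_def intro!: less_imp_inverse_less)
  qed
  have S: "S \<in> sets (PiM {..<m} (\<lambda>_. borel))"
  proof -
    have "(\<lambda>x. (\<Sum>k<m - i. x k :: real)) \<in> borel_measurable (PiM {..<m} (\<lambda>_. borel))" for i
      by (intro borel_measurable_sum measurable_component_singleton) auto
    note [measurable] = this
    show ?thesis unfolding S_def by measurable
  qed
  have key: "prob (above_after c r m \<delta>) = measure (PiM {..<m} (\<lambda>k. distr (\<nu> k) borel (\<lambda>x. x))) S" if r: "0 \<le> r" for r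
  proof -
    let ?D = "\<lambda>k w. B (r + v (Suc k)) w - B (r + v k) w"
    have ind: "indep_vars (\<lambda>_. borel) ?D {..<m}"
      by (rule B_indep_increments[of "\<lambda>k. r + v k"]) (use r v in \<open>auto simp: v_def\<close>)
    have rv: "?D k \<in> borel_measurable M" if "k \<in> {..<m}" for k
      using indep_vars_def ind that by (auto simp: indep_vars_def)
    have d: "distributed M lborel (?D k) (\<lambda>x. ennreal (normal_density 0 (sqrt (v (Suc k) - v k)) x))" if "k < m" for k
      using B_increment[of "r + v k" "r + v (Suc k)"] r v[OF that] by simp
    have deq: "distr M borel (?D k) = distr (\<nu> k) borel (\<lambda>x. x)" if "k \<in> {..<m}" for k
    proof -
      have "distr M lborel (?D k) = \<nu> k" using d[of k] that by (simp add: distributed_def \<nu>_def)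
      moreover have "distr (distr M lborel (?D k)) borel (\<lambda>x. x) = distr M borel ((\<lambda>x. x) \<circ> ?D k)"
        by (rule distr_distr) (use rv[OF that] in auto)
      ultimately show ?thesis by (simp add: comp_def)
    qed
    have ne: "{..<m} \<noteq> {}" using m by auto
    have "distr M (PiM {..<m} (\<lambda>_. borel)) (\<lambda>w. \<lambda>k\<in>{..<m}. ?D k w) = PiM {..<m} (\<lambda>k. distr M borel (?D k))"
      by (rule indep_vars_iff_distr_eq_PiM'[where I = "{..<m}" and M' = "\<lambda>_. borel" and X = ?D, THEN iffD1, OF ne rv ind])
    also have "\<dots> = PiM {..<m} (\<lambda>k. distr (\<nu> k) borel (\<lambda>x. x))"
      by (rule PiM_cong) (simp_all add: deq)
    finally have PiM_eq: "distr M (PiM {..<m} (\<lambda>_. borel)) (\<lambda>w. \<lambda>k\<in>{..<m}. ?D k w) =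
      PiM {..<m} (\<lambda>k. distr (\<nu> k) borel (\<lambda>x. x))" .
    have mD: "(\<lambda>w. \<lambda>k\<in>{..<m}. ?D k w) \<in> measurable M (PiM {..<m} (\<lambda>_. borel))"
      using rv by (intro measurable_restrict)
    have "above_after c r m \<delta> = (\<lambda>w. \<lambda>k\<in>{..<m}. ?D k w) -` S \<inter> space M"
    proof -
      have "(\<Sum>k<m - i. (\<lambda>k\<in>{..<m}. ?D k w) k) + \<mu> * ?s i = X (r + ?s i) w - X r w" if "i < m" for i w
      proof -
        have "(\<Sum>k<m - i. (\<lambda>k\<in>{..<m}. ?D k w) k) = (\<Sum>k<m - i. ?D k w)" by (intro sum.cong) auto
        also have "\<dots> = B (r + v (m - i)) w - B (r + v 0) w"
          by (rule sum_lessThan_telescope)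
        also have "\<dots> = B (r + ?s i) w - B r w" using that by (simp add: v_def)
        finally show ?thesis by (simp add: X_diff)
      qed
      then show ?thesis
        unfolding above_after_def S_def using measurable_space[OF mD] by auto
    qed
    then have "prob (above_after c r m \<delta>) = measure (distr M (PiM {..<m} (\<lambda>_. borel)) (\<lambda>w. \<lambda>k\<in>{..<m}. ?D k w)) S"
      using measure_distr[OF mD S] by simp
    then show ?thesis unfolding PiM_eq .
  qed
  show ?thesis using key[OF r] key[OF order_refl] by simp
qed

text \<open>The Markov property at the deterministic time \<open>r\<close>, in the form needed for
  the cells of a discretised stopping time.\<close>

lemma prob_Int_above_after:
  assumes r: "0 \<le> r" and m: "0 < m" and D: "D \<in> sets (G (ennreal r))"
  shows "prob (D \<inter> above_after c r m \<delta>) = prob D * prob (above_after c 0 m \<delta>)"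
proof -
  let ?s = "\<lambda>i. inverse (real (Suc i))"
  let ?U = "(\<lambda>i. r + ?s i) ` {..<m}"
  let ?Y = "\<lambda>w. \<lambda>u\<in>?U. B (max u r) w - B r w"
  let ?E = "{y \<in> space (PiM ?U (\<lambda>_. borel)). \<forall>i<m. - \<delta> \<le> c * (y (r + ?s i) + \<mu> * ?s i)}"
  have E: "?E \<in> sets (PiM ?U (\<lambda>_. borel))"
  proof -
    have "?E = (\<Inter>i\<in>{..<m}. {y \<in> space (PiM ?U (\<lambda>_. borel)). - \<delta> \<le> c * (y (r + ?s i) + \<mu> * ?s i)})"
      using m by auto
    also have "\<dots> \<in> sets (PiM ?U (\<lambda>_. borel))"
    proof (rule sets.finite_INT)
      fix i assume "i \<in> {..<m}"
      then have "(\<lambda>y. y (r + ?s i) :: real) \<in> borel_measurable (PiM ?U (\<lambda>_. borel))"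
        by (intro measurable_component_singleton) auto
      note [measurable] = this
      show "{y \<in> space (PiM ?U (\<lambda>_. borel)). - \<delta> \<le> c * (y (r + ?s i) + \<mu> * ?s i)} \<in> sets (PiM ?U (\<lambda>_. borel))"
        by measurable
    qed (use m in auto)
    finally show ?thesis .
  qed
  have "?Y -` ?E \<inter> space M = above_after c r m \<delta>"
    unfolding above_after_def by (auto simp: space_PiM X_diff max_def)
  then have "prob (D \<inter> above_after c r m \<delta>) = prob D * prob (above_after c r m \<delta>)"
    using prob_past_future[OF r D _ E] by simp
  then show ?thesis using prob_above_after_stationary[OF r m] by simp
qed

text \<open>With \<open>m\<close> both the number of tests grows and the tolerance shrinks. In the
  limit the path would be on side \<open>c\<close>, or at its starting value, at all times
  \<open>1/(i+1)\<close>, against \<open>AE_negative_near_zero\<close>.\<close>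

lemma prob_above_after_tendsto_0:
  assumes c: "c \<in> {1, -1}"
  shows "(\<lambda>m. prob (above_after c 0 m (inverse (real (Suc m))))) \<longlonglongrightarrow> 0"
proof -
  let ?s = "\<lambda>i. inverse (real (Suc i))"
  let ?A = "\<lambda>m. above_after c 0 m (?s m)"
  have dec: "decseq ?A"
  proof (rule decseq_SucI)
    show "?A (Suc m) \<subseteq> ?A m" for m
    proof
      fix w assume w: "w \<in> ?A (Suc m)"
      have s: "?s (Suc m) \<le> ?s m" by (intro le_imp_inverse_le) auto
      have "- ?s (Suc m) \<le> c * (X (0 + ?s i) w - X 0 w)" if "i < m" for i
        using w that unfolding above_after_def by auto
      then have "- ?s m \<le> c * (X (0 + ?s i) w - X 0 w)" if "i < m" for i
        by (rule order_trans[OF le_imp_neg_le[OF s]]) (rule that)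
      then show "w \<in> ?A m" using w unfolding above_after_def by blast
    qed
  qed
  have "(\<lambda>m. prob (?A m)) \<longlonglongrightarrow> prob (\<Inter>m. ?A m)"
    by (rule finite_Lim_measure_decseq[OF _ dec]) auto
  moreover have "AE w in M. w \<notin> (\<Inter>m. ?A m)"
    using AE_negative_near_zero[OF c] B_zero
  proof eventually_elim
    case (elim w)
    then obtain i where i: "c * X (?s i) w < 0" by blast
    show ?case
    proof
      assume *: "w \<in> (\<Inter>m. ?A m)"
      have "- ?s m \<le> c * X (?s i) w" if "m > i" for m
      proof -
        have "w \<in> ?A m" using * by blast
        then have "- ?s m \<le> c * (X (0 + ?s i) w - X 0 w)" using that unfolding above_after_def by blast
        then show ?thesis using elim(2) by (simp add: drifted_def)
      qed
      moreover have "(\<lambda>m. - ?s m) \<longlonglongrightarrow> - 0"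
        by (intro tendsto_minus LIMSEQ_inverse_real_of_nat)
      ultimately have "- 0 \<le> c * X (?s i) w"
        by (intro LIMSEQ_le_const2[of "\<lambda>m. - ?s m"]) (auto intro!: exI[of _ "Suc i"])
      then show False using i by simp
    qed
  qed
  then have "prob (\<Inter>m. ?A m) = 0"
    by (subst prob_eq_0) auto
  ultimately show ?thesis by simp
qed

text \<open>The event that \<open>\<tau>\<close>, rounded up to the grid of step
  \<open>1 / (N + 1)\<close>, takes its \<open>k\<close>-th value.\<close>

definition grid_cell :: "('a \<Rightarrow> ennreal) \<Rightarrow> nat \<Rightarrow> nat \<Rightarrow> 'a set" where
  "grid_cell \<tau> N k = {w \<in> space M. \<tau> w \<le> ennreal (real k / real (Suc N)) \<and>
     (\<forall>j<k. ennreal (real j / real (Suc N)) < \<tau> w)}"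

lemma grid_cell_G:
  assumes \<tau>: "stopping_time G \<tau>"
  shows "grid_cell \<tau> N k \<in> sets (G (ennreal (real k / real (Suc N))))"
proof -
  let ?r = "\<lambda>k. real k / real (Suc N)"
  have le: "{w \<in> space M. \<tau> w \<le> ennreal (?r j)} \<in> sets (G (ennreal (?r k)))" if "j \<le> k" for j
  proof -
    have "ennreal (?r j) \<le> ennreal (?r k)" using that by (intro ennreal_leI divide_right_mono) auto
    moreover have "{w \<in> space M. \<tau> w \<le> ennreal (?r j)} \<in> sets (G (ennreal (?r j)))"
      using \<tau> by (simp add: stopping_time_iff)
    ultimately show ?thesis using natural_filtration_mono by blast
  qed
  have "grid_cell \<tau> N k = {w \<in> space M. \<tau> w \<le> ennreal (?r k)} - (\<Union>j\<in>{..<k}. {w \<in> space M. \<tau> w \<le> ennreal (?r j)})"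
    by (auto simp: grid_cell_def not_le)
  then show ?thesis using le by (auto intro!: sets.Diff sets.finite_UN)
qed

text \<open>The strong Markov property by discretisation. Rounded up to grid \<open>N\<close>,
  \<open>\<tau>\<close> passes the test with probability at most that at time 0, whatever
  \<open>N\<close> is. If \<open>\<tau> = \<sigma> < \<infinity>\<close>, the one-sided path passes
  the test for all large \<open>N\<close>, which is the event \<open>J c m\<close>; its probability
  is bounded by a quantity tending to 0 in \<open>m\<close>.\<close>

lemma stopping_time_avoids_last_passage:
  assumes \<tau>: "stopping_time G \<tau>"
  shows "AE w in M. \<tau> w = \<sigma> w \<longrightarrow> \<sigma> w = \<infinity>"
proof -
  let ?s = "\<lambda>i. inverse (real (Suc i))"
  let ?r = "\<lambda>N k. real k / real (Suc N)"
  define E where "E = (\<lambda>c m N. \<Union>k. grid_cell \<tau> N k \<inter> above_after c (?r N k) m (?s m))"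
  have disj: "disjoint_family (grid_cell \<tau> N)" for N
  proof -
    have "grid_cell \<tau> N k \<inter> grid_cell \<tau> N l = {}" if "k < l" for k l
      using that by (auto simp: grid_cell_def not_le[symmetric])
    then show ?thesis unfolding disjoint_family_on_def by (metis Int_commute nat_neq_iff)
  qed
  have cell: "grid_cell \<tau> N k \<in> events" for N k using grid_cell_G[OF \<tau>] by (rule G_sets_M)
  have Em: "E c m N \<in> events" for c m N
    unfolding E_def using cell by (intro sets.countable_UN'') auto
  have pE: "prob (E c m N) \<le> prob (above_after c 0 m (?s m))" if m: "0 < m" for c m N
  proof -
    let ?p = "prob (above_after c 0 m (?s m))"
    have "(\<lambda>k. prob (grid_cell \<tau> N k \<inter> above_after c (?r N k) m (?s m))) sums prob (E c m N)"
      unfolding E_def using cell disj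
      by (intro finite_measure_UNION) (auto simp: disjoint_family_on_def, blast)
    then have 1: "(\<lambda>k. prob (grid_cell \<tau> N k) * ?p) sums prob (E c m N)"
      using prob_Int_above_after[OF _ m grid_cell_G[OF \<tau>]] by simp
    have "(\<lambda>k. prob (grid_cell \<tau> N k) * ?p) sums (prob (\<Union>k. grid_cell \<tau> N k) * ?p)"
      using cell disj by (intro sums_mult2 finite_measure_UNION) auto
    then have "prob (E c m N) = prob (\<Union>k. grid_cell \<tau> N k) * ?p" using 1 by (rule sums_unique2[rotated])
    also have "\<dots> \<le> 1 * ?p" by (intro mult_right_mono) auto
    finally show ?thesis by simp
  qed
  define J where "J = (\<lambda>c m. \<Union>N0. \<Inter>N\<in>{N0..}. E c m N)"
  have Jm: "J c m \<in> events" for c m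
    unfolding J_def using Em by (intro sets.countable_UN'' sets.countable_INT') auto
  have pJ: "prob (J c m) \<le> prob (above_after c 0 m (?s m))" if m: "0 < m" for c m
  proof (rule LIMSEQ_le_const2)
    show "(\<lambda>N0. prob (\<Inter>N\<in>{N0..}. E c m N)) \<longlonglongrightarrow> prob (J c m)"
      unfolding J_def
    proof (rule finite_Lim_measure_incseq)
      show "range (\<lambda>N0. \<Inter>N\<in>{N0..}. E c m N) \<subseteq> events" using Em by (auto intro!: sets.countable_INT')
      show "incseq (\<lambda>N0. \<Inter>N\<in>{N0..}. E c m N)" by (rule incseq_SucI) auto
    qed
    have "prob (\<Inter>N\<in>{N0..}. E c m N) \<le> prob (E c m N0)" for N0
      by (rule finite_measure_mono[OF _ Em]) auto
    then show "\<exists>N. \<forall>n\<ge>N. prob (\<Inter>N\<in>{n..}. E c m N) \<le> prob (above_after c 0 m (?s m))"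
      using pE[OF m] order_trans by blast
  qed
  have null: "AE w in M. w \<notin> (\<Inter>m\<in>{1..}. J c m)" if c: "c \<in> {1, -1}" for c
  proof -
    have Im: "(\<Inter>m\<in>{1..}. J c m) \<in> events" using Jm by (intro sets.countable_INT') auto
    have "prob (\<Inter>m\<in>{1..}. J c m) \<le> 0"
    proof (rule LIMSEQ_le_const[OF prob_above_after_tendsto_0[OF c]])
      have "prob (\<Inter>m\<in>{1..}. J c m) \<le> prob (above_after c 0 m (?s m))" if "m \<ge> 1" for m
      proof -
        have "prob (\<Inter>m\<in>{1..}. J c m) \<le> prob (J c m)"
          by (rule finite_measure_mono[OF _ Jm]) (use that in auto)
        then show ?thesis using pJ[of m c] that by simp
      qed
      then show "\<exists>N. \<forall>n\<ge>N. prob (\<Inter>m\<in>{1..}. J c m) \<le> prob (above_after c 0 n (?s n))" by blast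
    qed
    then have "prob (\<Inter>m\<in>{1..}. J c m) = 0" by (simp add: measure_le_0_iff)
    then show ?thesis using Im by (subst (asm) prob_eq_0) auto
  qed
  show ?thesis
    using null[of 1, simplified] null[of "- 1", simplified] B_continuous AE_last_passage_pos AE_space
  proof eventually_elim
    case (elim w)
    show ?case
    proof (rule impI, rule ccontr)
      assume eq: "\<tau> w = \<sigma> w" and fin: "\<sigma> w \<noteq> \<infinity>"
      then obtain t where t: "\<sigma> w = ennreal t" "0 \<le> t" by (cases "\<sigma> w") auto
      have t0: "0 < t" using elim(4) t by (auto simp: less_le)
      obtain c where c: "c \<in> {1, -1}" "\<And>s. s > t \<Longrightarrow> 0 < c * (X s w - X t w)"
        using last_passage_one_sided[OF elim(3) t(1) t0] by blast
      have cX: "continuous_on {0..} (\<lambda>t. X t w)"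
        unfolding drifted_def by (intro continuous_intros elim(3))
      have "\<exists>k. w \<in> grid_cell \<tau> N k" for N
      proof -
        obtain k0 :: nat where k0: "t * real (Suc N) \<le> real k0" using real_arch_simple by blast
        let ?P = "\<lambda>k. \<tau> w \<le> ennreal (?r N k)"
        have "?P k0" unfolding eq t(1) by (rule ennreal_leI) (use k0 in \<open>simp add: field_simps\<close>)
        then have "?P (LEAST k. ?P k)" "\<And>j. j < (LEAST k. ?P k) \<Longrightarrow> \<not> ?P j"
          by (auto intro: LeastI dest: not_less_Least)
        then show ?thesis using elim(5) by (auto simp: grid_cell_def not_le)
      qed
      then obtain k where k: "\<And>N. w \<in> grid_cell \<tau> N (k N)" by metis
      define r where "r = (\<lambda>N. ?r N (k N))"
      have r1: "t \<le> r N" for N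
      proof -
        have "ennreal t \<le> ennreal (r N)" using k[of N] eq t by (simp add: grid_cell_def r_def)
        then show ?thesis by (simp add: r_def)
      qed
      have r2: "r N \<le> t + ?s N" for N
      proof (cases "k N")
        case (Suc j)
        then have "ennreal (?r N j) < ennreal t" using k[of N] eq t by (simp add: grid_cell_def)
        then have "?r N j < t" using t(2) by (simp add: ennreal_less_iff)
        moreover have "r N = ?r N j + ?s N" using Suc by (simp add: r_def field_simps)
        ultimately show ?thesis by simp
      qed (use t in \<open>simp add: r_def\<close>)
      have r_lim: "r \<longlonglongrightarrow> t"
        by (rule real_tendsto_sandwich[OF _ _ tendsto_const LIMSEQ_inverse_real_of_nat_add])
          (use r1 r2 in \<open>auto intro: always_eventually\<close>)
      have "w \<in> J c m" for m
      proof -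
        have "eventually (\<lambda>N. - ?s m \<le> c * (X (r N + ?s i) w - X (r N) w)) sequentially" for i
        proof -
          have "(\<lambda>N. c * (X (r N + ?s i) w - X (r N) w)) \<longlonglongrightarrow> c * (X (t + ?s i) w - X t w)"
            using t0 order_trans[OF t(2) r1]
            by (intro tendsto_intros continuous_on_tendsto_compose[OF cX] r_lim) auto
          \<comment> \<open>The limit is positive, hence strictly above the negative tolerance; so
            the inequality already holds for \<open>r N\<close> close to \<open>t\<close>.\<close>
          moreover have "- ?s m < c * (X (t + ?s i) w - X t w)"
            using c(2)[of "t + ?s i"] by (smt (verit) inverse_positive_iff_positive of_nat_0_less_iff zero_less_Suc)
          ultimately show ?thesis by (rule eventually_mono[OF order_tendstoD(1)]) simp
        qed
        then have "eventually (\<lambda>N. \<forall>i\<in>{..<m}. - ?s m \<le> c * (X (r N + ?s i) w - X (r N) w)) sequentially"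
          by (intro eventually_ball_finite) auto
        then obtain N0 where "\<And>N i. N \<ge> N0 \<Longrightarrow> i < m \<Longrightarrow> - ?s m \<le> c * (X (r N + ?s i) w - X (r N) w)"
          by (auto simp: eventually_sequentially)
        then have "w \<in> E c m N" if "N \<ge> N0" for N
          unfolding E_def using k[of N] that elim(5)
          by (intro UN_I[of "k N"]) (auto simp: above_after_def r_def)
        then show ?thesis unfolding J_def by blast
      qed
      then show False using c(1) elim(1,2) by auto
    qed
  qed
qed

end

section \<open>Stopping times of the Brownian filtration are predictable\<close>

context brownian_setting
begin

lemma G_mono: "0 \<le> s \<Longrightarrow> s \<le> t \<Longrightarrow> A \<in> sets (G (ennreal s)) \<Longrightarrow> A \<in> sets (G (ennreal t))"
  using natural_filtration_mono[of "ennreal s" "ennreal t" M B] by (auto simp: ennreal_leI)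

lemma sum_disjoint_integral_le:
  assumes D: "\<And>i. i < m \<Longrightarrow> D i \<in> events" "disjoint_family_on D {..<m::nat}"
    and q: "integrable M q" "\<And>w. 0 \<le> (q w :: real)"
  shows "(\<Sum>i<m. \<integral>w. indicator (D i) w * q w \<partial>M) \<le> (\<integral>w. q w \<partial>M)"
proof -
  have i: "integrable M (\<lambda>w. indicator (D i) w * q w)" if "i < m" for i
    using integrable_mult_indicator[OF D(1)[OF that] q(1)] by simp
  have "(\<Sum>i<m. \<integral>w. indicator (D i) w * q w \<partial>M) = (\<integral>w. (\<Sum>i<m. indicator (D i) w * q w) \<partial>M)"
    by (rule Bochner_Integration.integral_sum[symmetric]) (use i in auto)
  also have "\<dots> \<le> (\<integral>w. q w \<partial>M)"
  proof (rule integral_mono)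
    show "integrable M (\<lambda>w. \<Sum>i<m. indicator (D i) w * q w)"
      by (rule Bochner_Integration.integrable_sum) (use i in auto)
    fix w
    have "(\<Sum>i<m. indicator (D i) w * q w) = indicator (\<Union>i<m. D i) w * q w"
      using D(2) by (simp add: sum_distrib_right[symmetric] indicator_UN_disjoint)
    also have "\<dots> \<le> q w" using q(2)[of w] by (auto simp: indicator_def)
    finally show "(\<Sum>i<m. indicator (D i) w * q w) \<le> q w" .
  qed (rule q(1))
  finally show ?thesis .
qed

definition mesh :: "real \<Rightarrow> real \<Rightarrow> nat \<Rightarrow> nat \<Rightarrow> real" where
  "mesh a b m i = a + real i * ((b - a) / real m)"

lemma mesh_Suc: "mesh a b m (Suc i) = mesh a b m i + (b - a) / real m"
  by (simp add: mesh_def distrib_right add_divide_distrib)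

lemma mesh_bounds:
  assumes "a \<le> b" "i \<le> m" shows "a \<le> mesh a b m i" "mesh a b m i \<le> b"
proof -
  show "a \<le> mesh a b m i" using assms by (simp add: mesh_def)
  show "mesh a b m i \<le> b"
  proof (cases "m = 0")
    case False
    have "real i * ((b - a) / real m) \<le> real m * ((b - a) / real m)"
      using assms by (intro mult_right_mono) auto
    then show ?thesis using False by (simp add: mesh_def)
  qed (use assms in \<open>simp add: mesh_def\<close>)
qed

lemma mesh_mono: "a \<le> b \<Longrightarrow> i \<le> j \<Longrightarrow> mesh a b m i \<le> mesh a b m j"
  unfolding mesh_def by (intro add_left_mono mult_right_mono) auto

lemma conditional_mesh_oscillation:
  assumes \<Phi>: "lipschitz_functional U L \<Phi>" and ab: "0 \<le> a" "a \<le> b" and e: "0 < e"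
    and c: "continuous_on {0..} (\<lambda>t. B t w)"
  shows "eventually (\<lambda>m. \<forall>i<m. \<bar>conditional \<Phi> (mesh a b m (Suc i)) w - conditional \<Phi> (mesh a b m i) w\<bar> < e) sequentially"
proof -
  let ?K = "L * real (card U)"
  have K: "0 \<le> ?K" using lipschitz_functionalD(3)[OF \<Phi>] by simp
  \<comment> \<open>Each of the \<open>card U\<close> coordinates will contribute at most
    \<open>2 * \<kappa>\<close>. Adding 1 keeps the denominator positive and makes the final
    inequality strict.\<close>
  define \<kappa> where "\<kappa> = e / (2 * (?K + 1))"
  have \<kappa>: "0 < \<kappa>" using e K by (simp add: \<kappa>_def)
  have "uniformly_continuous_on {0..b} (\<lambda>t. B t w)"
    by (rule compact_uniformly_continuous[OF continuous_on_subset[OF c]]) auto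
  then obtain d where d: "0 < d" "\<And>x y. x \<in> {0..b} \<Longrightarrow> y \<in> {0..b} \<Longrightarrow> dist y x < d \<Longrightarrow> dist (B y w) (B x w) < \<kappa>"
    using \<kappa> unfolding uniformly_continuous_on_def by metis
  have lim: "(\<lambda>m. (b - a) / real m) \<longlonglongrightarrow> 0" by (rule lim_const_over_n)
  then have "(\<lambda>m. sqrt (2 / pi) * sqrt ((b - a) / real m)) \<longlonglongrightarrow> sqrt (2 / pi) * sqrt 0"
    by (intro tendsto_intros)
  then have "eventually (\<lambda>m. sqrt (2 / pi) * sqrt ((b - a) / real m) < \<kappa>) sequentially"
    using \<kappa> by (intro order_tendstoD) auto
  moreover have "eventually (\<lambda>m. (b - a) / real m < d) sequentially"
    using lim d(1) by (intro order_tendstoD)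
  ultimately show ?thesis
  proof eventually_elim
    case (elim m)
    show ?case
    proof (intro allI impI)
      fix i assume i: "i < m"
      let ?s = "mesh a b m i" and ?t = "mesh a b m (Suc i)"
      have st: "0 \<le> ?s" "?s \<le> ?t" "?t \<le> b"
        using mesh_bounds[OF ab(2), of i m] mesh_bounds[OF ab(2), of "Suc i" m] mesh_mono[OF ab(2), of i "Suc i" m] i ab(1)
        by auto
      have diff: "?t - ?s = (b - a) / real m" by (simp add: mesh_Suc)
      have "\<bar>conditional \<Phi> ?t w - conditional \<Phi> ?s w\<bar>
          \<le> L * (\<Sum>u\<in>U. \<bar>B (min u ?t) w - B (min u ?s) w\<bar> + sqrt (2 / pi) * sqrt (?t - ?s))"
        by (rule conditional_oscillation[OF \<Phi> st(1,2)])
      also have "\<dots> \<le> L * (\<Sum>u\<in>U. 2 * \<kappa>)"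
      proof (intro mult_left_mono sum_mono lipschitz_functionalD(3)[OF \<Phi>])
        fix u assume "u \<in> U"
        then have u: "0 \<le> u" using lipschitz_functionalD(2)[OF \<Phi>] by auto
        have "dist (B (min u ?t) w) (B (min u ?s) w) < \<kappa>"
        proof (rule d(2))
          show "dist (min u ?t) (min u ?s) < d"
            using st(2) diff elim(2) by (auto simp: dist_real_def min_def)
        qed (use u st in auto)
        then show "\<bar>B (min u ?t) w - B (min u ?s) w\<bar> + sqrt (2 / pi) * sqrt (?t - ?s) \<le> 2 * \<kappa>"
          using elim(1) unfolding diff dist_real_def by linarith
      qed
      also have "\<dots> = ?K * (2 * \<kappa>)" by simp
      also have "\<dots> < (?K + 1) * (2 * \<kappa>)" using \<kappa> by (intro mult_strict_right_mono) auto
      also have "\<dots> = e" proof -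
        have "?K + 1 \<noteq> 0" using K by linarith
        moreover have "x * (2 * (e / (2 * x))) = e" if "x \<noteq> 0" for x using that by simp
        ultimately show ?thesis unfolding \<kappa>_def by blast
      qed
      finally show "\<bar>conditional \<Phi> ?t w - conditional \<Phi> ?s w\<bar> < e" .
    qed
  qed
qed

lemma prob_tendsto_0_of_AE:
  assumes V: "\<And>m::nat. V m \<in> events" and ae: "AE w in M. eventually (\<lambda>m. w \<notin> V m) sequentially"
  shows "(\<lambda>m. prob (V m)) \<longlonglongrightarrow> 0"
proof -
  have "(\<lambda>m. \<integral>w. indicator (V m) w \<partial>M) \<longlonglongrightarrow> (\<integral>w. (0::real) \<partial>M)"
  proof (rule integral_dominated_convergence[where w = "\<lambda>_. 1"])
    show "AE w in M. (\<lambda>m. indicator (V m) w :: real) \<longlonglongrightarrow> 0"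
      using ae
    proof eventually_elim
      case (elim w)
      then show ?case by (intro tendsto_eventually) (auto elim!: eventually_mono)
    qed
  qed (use V in auto)
  then show ?thesis using V by simp
qed

text \<open>\<open>C i\<close> is an alarm raised at a mesh point before \<open>\<tau>\<close> when
  \<open>\<tau> \<le> b\<close> looks nearly certain. At the first mesh point not before
  \<open>\<tau>\<close> the event \<open>\<tau> \<le> b\<close> has already happened, so its
  approximate conditional probability is near 1 there. It barely moves over one mesh step, hence it
  was near 1 just before \<open>\<tau>\<close>, and the alarm is raised in time. \<open>N\<close>
  collects the false alarms, the missed detections and the large oscillations.\<close>

lemma block_detection:
  assumes \<tau>: "stopping_time G \<tau>" and ab: "0 \<le> a" "a < b" and \<epsilon>: "0 < \<epsilon>" "\<epsilon> \<le> 1"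
  obtains m C N where "0 < m" "\<And>i. i < m \<Longrightarrow> C i \<in> sets (G (ennreal (mesh a b m i)))"
    "\<And>i w. i < m \<Longrightarrow> w \<in> C i \<Longrightarrow> ennreal (mesh a b m i) < \<tau> w"
    "N \<in> events" "prob N \<le> \<epsilon>"
    "\<And>i w. i < m \<Longrightarrow> w \<in> C i - N \<Longrightarrow> \<tau> w \<le> ennreal b"
    "\<And>i w. i < m \<Longrightarrow> w \<in> space M - N \<Longrightarrow> ennreal (mesh a b m i) < \<tau> w \<Longrightarrow>
      \<tau> w \<le> ennreal (mesh a b m (Suc i)) \<Longrightarrow> w \<in> C i"
proof -
  define A where "A = {w \<in> space M. \<tau> w \<le> ennreal b}"
  \<comment> \<open>Budget: false alarms cost at most
    \<open>\<delta> + \<eta> \<le> \<epsilon> / 2\<close>, missed detections at most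
    \<open>2 * \<eta> / \<delta> = \<epsilon> / 4\<close>, and oscillations at most
    \<open>\<epsilon> / 4\<close>.\<close>
  define \<delta> where "\<delta> = \<epsilon> / 4"
  define \<eta> where "\<eta> = \<epsilon> * \<epsilon> / 32"
  have \<delta>: "0 < \<delta>" and \<eta>: "0 < \<eta>" using \<epsilon> by (auto simp: \<delta>_def \<eta>_def)
  have le: "{w \<in> space M. \<tau> w \<le> ennreal t} \<in> sets (G (ennreal t))" if "0 \<le> t" for t
    using \<tau> that by (simp add: stopping_time_iff)
  have A: "A \<in> events" unfolding A_def by (rule G_sets_M[OF le]) (use ab in auto)
  have "approximable A" unfolding A_def by (rule approximable_G[OF le]) (use ab in auto)
  then obtain U L \<Phi> where \<Phi>: "lipschitz_functional U L \<Phi>" and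
    close: "(\<integral>w. \<bar>indicator A w - \<Phi> (\<lambda>u. B u w)\<bar> \<partial>M) < \<eta>"
    using \<eta> unfolding approximable_def by blast
  let ?f = "\<lambda>w. \<Phi> (\<lambda>u. B u w)"
  let ?q = "\<lambda>w. \<bar>indicator A w - ?f w\<bar>"
  let ?g = "conditional \<Phi>"
  have f01: "0 \<le> ?f w" "?f w \<le> 1" for w using lipschitz_functionalD(5,6)[OF \<Phi>] by blast+
  have q: "integrable M ?q"
    by (intro integrable_indicator_diff A functional_measurable[OF \<Phi>] conjI f01)
  define V where "V = (\<lambda>m. {w \<in> space M. \<exists>i\<in>{..<m}. \<delta> / 2 \<le> \<bar>?g (mesh a b m (Suc i)) w - ?g (mesh a b m i) w\<bar>})"
  have mesh0: "0 \<le> mesh a b m i" for m i using ab by (simp add: mesh_def)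
  have V: "V m \<in> events" for m
  proof -
    have [measurable]: "?g (mesh a b m i) \<in> borel_measurable M" for i
      by (rule conditional_measurable_M[OF \<Phi> mesh0])
    show ?thesis unfolding V_def by measurable
  qed
  have "(\<lambda>m. prob (V m)) \<longlonglongrightarrow> 0"
  proof (rule prob_tendsto_0_of_AE[OF V])
    show "AE w in M. eventually (\<lambda>m. w \<notin> V m) sequentially"
      using B_continuous
    proof eventually_elim
      case (elim w)
      have "0 < \<delta> / 2" using \<delta> by simp
      from conditional_mesh_oscillation[OF \<Phi> ab(1) less_imp_le[OF ab(2)] this elim]
      show ?case by eventually_elim (auto simp: V_def not_le)
    qed
  qed
  then have "eventually (\<lambda>m. prob (V m) < \<epsilon> / 4) sequentially"
    using \<epsilon> by (intro order_tendstoD) auto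
  then have "eventually (\<lambda>m. prob (V m) < \<epsilon> / 4 \<and> 0 < m) sequentially"
    using eventually_gt_at_top[of 0] by eventually_elim auto
  then obtain m where m: "prob (V m) < \<epsilon> / 4" "0 < m"
    by (auto simp: eventually_sequentially)
  define s where "s = mesh a b m"
  have s0: "0 \<le> s i" for i using mesh0 by (simp add: s_def)
  have s_mono: "i \<le> j \<Longrightarrow> s i \<le> s j" for i j using ab by (auto simp: s_def intro: mesh_mono)
  have sb: "s i \<le> b" if "i \<le> m" for i using mesh_bounds(2)[of a b i m] ab that by (simp add: s_def)
  define C where "C = (\<lambda>i. {w \<in> space M. ennreal (s i) < \<tau> w \<and> 1 - \<delta> < ?g (s i) w})"
  have gm: "?g (s i) \<in> borel_measurable (G (ennreal (s i)))" for i by (rule conditional_measurable[OF \<Phi> s0])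
  have C: "C i \<in> sets (G (ennreal (s i)))" for i
  proof -
    have "{w \<in> space (G (ennreal (s i))). 1 - \<delta> < ?g (s i) w} \<in> sets (G (ennreal (s i)))"
      using gm by measurable
    then have "(space M - {w \<in> space M. \<tau> w \<le> ennreal (s i)}) \<inter> {w \<in> space M. 1 - \<delta> < ?g (s i) w} \<in> sets (G (ennreal (s i)))"
      using sets.compl_sets[OF le[OF s0[of i]]] by (intro sets.Int) auto
    also have "(space M - {w \<in> space M. \<tau> w \<le> ennreal (s i)}) \<inter> {w \<in> space M. 1 - \<delta> < ?g (s i) w} = C i"
      by (auto simp: C_def not_le)
    finally show ?thesis .
  qed
  have fi: "integrable M (\<lambda>w. indicator D w * h w)" if "D \<in> events" "h \<in> borel_measurable M" "\<And>w. 0 \<le> h w" "\<And>w. h w \<le> 1" for D and h :: "'a \<Rightarrow> real"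
    by (rule integrable_bounded[where c = 1]) (use that in \<open>auto simp: indicator_def\<close>)
  have int_1: "(\<integral>w. indicator D w * (1 - ?f w) \<partial>M) = (\<integral>w. indicator D w * (1 - ?g t w) \<partial>M)"
    if D: "D \<in> sets (G (ennreal t))" and t: "0 \<le> t" for D t
  proof -
    have "(\<integral>w. indicator D w * (1 - h w) \<partial>M) = prob D - (\<integral>w. indicator D w * h w \<partial>M)"
      if h: "h \<in> borel_measurable M" "\<And>w. 0 \<le> h w" "\<And>w. h w \<le> 1" for h :: "'a \<Rightarrow> real"
      using fi[OF G_sets_M[OF D] h] G_sets_M[OF D] by (simp add: right_diff_distrib emeasure_eq_measure)
    from this[OF functional_measurable[OF \<Phi>] f01] this[OF conditional_measurable_M[OF \<Phi> t] conditional_bounds[OF \<Phi> t]]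
    show ?thesis using integral_conditional[OF \<Phi> t D] by simp
  qed

  \<comment> \<open>The conditional probability of \<open>A\<close> is close to 1 although \<open>A\<close> fails: decompose according to the first such mesh point.\<close>
  define D where "D = (\<lambda>i. C i - (\<Union>j<i. C j))"
  have D: "D i \<in> sets (G (ennreal (s i)))" for i
  proof -
    have "C j \<in> sets (G (ennreal (s i)))" if "j \<in> {..<i}" for j
      by (rule G_mono[OF s0 s_mono C]) (use that in simp)
    then show ?thesis unfolding D_def using C[of i] by (intro sets.Diff sets.finite_UN) simp_all
  qed
  have D_disj: "disjoint_family_on D I" for I
  proof -
    have "D i \<inter> D j = {}" if "i < j" for i j using that by (auto simp: D_def)
    then show ?thesis unfolding disjoint_family_on_def by (metis Int_commute nat_neq_iff)
  qed
  have D_Un: "(\<Union>i<m. D i) = (\<Union>i<m. C i)"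
  proof
    show "(\<Union>i<m. C i) \<subseteq> (\<Union>i<m. D i)"
    proof
      fix w assume "w \<in> (\<Union>i<m. C i)"
      then obtain i where i: "i < m" "w \<in> C i" by auto
      obtain k where k: "w \<in> C k" "k \<le> i" "\<And>j. j < k \<Longrightarrow> w \<notin> C j"
        using i(2) LeastI[of "\<lambda>i. w \<in> C i" i] Least_le[of "\<lambda>i. w \<in> C i" i] not_less_Least[of _ "\<lambda>i. w \<in> C i"]
        by blast
      then have "w \<in> D k" unfolding D_def by blast
      then show "w \<in> (\<Union>i<m. D i)" using i(1) k(2) by (intro UN_I[of k]) auto
    qed
  qed (auto simp: D_def)
  define N1 where "N1 = (\<Union>i<m. C i) - A"
  have N1: "N1 \<in> events" unfolding N1_def using C[THEN G_sets_M] A by auto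
  have pN1: "prob N1 \<le> \<delta> + \<eta>"
  proof -
    \<comment> \<open>On \<open>D i\<close> the conditional mean of \<open>1 - \<Phi>\<close> is
      below \<open>\<delta>\<close>; off \<open>A\<close>, the number 1 is the sum of
      \<open>1 - \<Phi>\<close> and the approximation error \<open>?q\<close>.\<close>
    have one: "prob (D i - A) \<le> \<delta> * prob (D i) + (\<integral>w. indicator (D i) w * ?q w \<partial>M)" for i
    proof -
      have De: "D i \<in> events" by (rule G_sets_M[OF D])
      have iq: "integrable M (\<lambda>w. indicator (D i) w * ?q w)"
        using integrable_mult_indicator[OF De q] by simp
      have i1: "integrable M (\<lambda>w. indicator (D i) w * (1 - ?f w))"
        by (rule fi[OF De]) (use functional_measurable[OF \<Phi>] f01 in auto)
      have i2: "integrable M (\<lambda>w. indicator (D i) w * (1 - ?g (s i) w))"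
        by (rule fi[OF De]) (use conditional_measurable_M[OF \<Phi> s0] conditional_bounds[OF \<Phi> s0] in auto)
      have "prob (D i - A) = (\<integral>w. indicator (D i - A) w \<partial>M)" using De A by simp
      also have "\<dots> \<le> (\<integral>w. indicator (D i) w * (1 - ?f w) + indicator (D i) w * ?q w \<partial>M)"
      proof (rule integral_mono)
        show "integrable M (indicator (D i - A) :: 'a \<Rightarrow> real)" using De A by (simp add: emeasure_eq_measure)
        show "indicator (D i - A) w \<le> indicator (D i) w * (1 - ?f w) + indicator (D i) w * ?q w" for w
          using f01[of w] by (auto simp: indicator_def)
      qed (use iq i1 in auto)
      also have "\<dots> = (\<integral>w. indicator (D i) w * (1 - ?g (s i) w) \<partial>M) + (\<integral>w. indicator (D i) w * ?q w \<partial>M)"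
        using iq i1 int_1[OF D s0, of i] by simp
      also have "(\<integral>w. indicator (D i) w * (1 - ?g (s i) w) \<partial>M) \<le> (\<integral>w. \<delta> * indicator (D i) w \<partial>M)"
      proof (rule integral_mono[OF i2])
        show "integrable M (\<lambda>w. \<delta> * indicator (D i) w)" using De by (simp add: emeasure_eq_measure)
        show "indicator (D i) w * (1 - ?g (s i) w) \<le> \<delta> * indicator (D i) w" for w
          by (auto simp: D_def C_def indicator_def)
      qed
      also have "(\<integral>w. \<delta> * indicator (D i) w \<partial>M) = \<delta> * prob (D i)" using De by simp
      finally show ?thesis by simp
    qed
    have N1_eq: "N1 = (\<Union>i<m. D i - A)" unfolding N1_def D_Un[symmetric] by auto
    have "prob N1 \<le> (\<Sum>i<m. prob (D i - A))"
      unfolding N1_eq by (rule finite_measure_subadditive_finite) (use D[THEN G_sets_M] A in auto)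
    also have "\<dots> \<le> (\<Sum>i<m. \<delta> * prob (D i) + (\<integral>w. indicator (D i) w * ?q w \<partial>M))"
      by (rule sum_mono) (rule one)
    also have "\<dots> = \<delta> * (\<Sum>i<m. prob (D i)) + (\<Sum>i<m. \<integral>w. indicator (D i) w * ?q w \<partial>M)"
      by (simp add: sum.distrib sum_distrib_left)
    also have "(\<Sum>i<m. prob (D i)) = prob (\<Union>i<m. D i)"
      using D[THEN G_sets_M] D_disj by (intro finite_measure_finite_Union[symmetric]) auto
    also have "\<delta> * prob (\<Union>i<m. D i) \<le> \<delta> * 1" using \<delta> by (intro mult_left_mono) auto
    also have "(\<Sum>i<m. \<integral>w. indicator (D i) w * ?q w \<partial>M) \<le> (\<integral>w. ?q w \<partial>M)"
      by (rule sum_disjoint_integral_le) (use D[THEN G_sets_M] D_disj q in auto)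
    finally show ?thesis using close by simp
  qed

  \<comment> \<open>The opposite error: \<open>A\<close> has occurred by the mesh point after
    \<open>\<tau>\<close>, but the conditional value there is still not near 1. Since
    \<open>D' i\<close> is contained in \<open>A\<close>, the deficit \<open>1 - \<Phi>\<close> is
    the approximation error itself. The events are disjoint because the mesh intervals are.\<close>
  define D' where "D' = (\<lambda>i. {w \<in> space M. ennreal (s i) < \<tau> w \<and> \<tau> w \<le> ennreal (s (Suc i)) \<and> ?g (s (Suc i)) w \<le> 1 - \<delta> / 2})"
  have D': "D' i \<in> sets (G (ennreal (s (Suc i))))" for i
  proof -
    have "{w \<in> space (G (ennreal (s (Suc i)))). ?g (s (Suc i)) w \<le> 1 - \<delta> / 2} \<in> sets (G (ennreal (s (Suc i))))"
      using gm[of "Suc i"] by measurable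
    moreover have "{w \<in> space M. \<tau> w \<le> ennreal (s i)} \<in> sets (G (ennreal (s (Suc i))))"
      by (rule G_mono[OF s0 s_mono le[OF s0]]) simp
    ultimately have "({w \<in> space M. \<tau> w \<le> ennreal (s (Suc i))} - {w \<in> space M. \<tau> w \<le> ennreal (s i)}) \<inter>
        {w \<in> space M. ?g (s (Suc i)) w \<le> 1 - \<delta> / 2} \<in> sets (G (ennreal (s (Suc i))))"
      using le[OF s0[of "Suc i"]] by auto
    also have "({w \<in> space M. \<tau> w \<le> ennreal (s (Suc i))} - {w \<in> space M. \<tau> w \<le> ennreal (s i)}) \<inter>
        {w \<in> space M. ?g (s (Suc i)) w \<le> 1 - \<delta> / 2} = D' i"
      by (auto simp: D'_def not_le)
    finally show ?thesis .
  qed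
  have D'_disj: "disjoint_family_on D' I" for I
  proof -
    have "D' i \<inter> D' j = {}" if "i < j" for i j
    proof -
      have "ennreal (s (Suc i)) \<le> ennreal (s j)" using that by (intro ennreal_leI s_mono) simp
      then show ?thesis unfolding D'_def by (auto dest: order_trans simp: not_le[symmetric])
    qed
    then show ?thesis unfolding disjoint_family_on_def by (metis Int_commute nat_neq_iff)
  qed
  define N2 where "N2 = (\<Union>i<m. D' i)"
  have N2: "N2 \<in> events" unfolding N2_def using D'[THEN G_sets_M] by auto
  have pN2: "\<delta> / 2 * prob N2 \<le> \<eta>"
  proof -
    have one: "\<delta> / 2 * prob (D' i) \<le> (\<integral>w. indicator (D' i) w * ?q w \<partial>M)" if i: "i < m" for i
    proof -
      have De: "D' i \<in> events" by (rule G_sets_M[OF D'])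
      have DA: "D' i \<subseteq> A"
      proof -
        have "ennreal (s (Suc i)) \<le> ennreal b" using i by (intro ennreal_leI sb) simp
        then show ?thesis unfolding D'_def A_def by (auto dest: order_trans)
      qed
      have "\<delta> / 2 * prob (D' i) = (\<integral>w. \<delta> / 2 * indicator (D' i) w \<partial>M)" using De by simp
      also have "\<dots> \<le> (\<integral>w. indicator (D' i) w * (1 - ?g (s (Suc i)) w) \<partial>M)"
      proof (rule integral_mono)
        show "integrable M (\<lambda>w. \<delta> / 2 * indicator (D' i) w)" using De by (simp add: emeasure_eq_measure)
        show "integrable M (\<lambda>w. indicator (D' i) w * (1 - ?g (s (Suc i)) w))"
          by (rule fi[OF De]) (use conditional_measurable_M[OF \<Phi> s0] conditional_bounds[OF \<Phi> s0] in auto)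
        show "\<delta> / 2 * indicator (D' i) w \<le> indicator (D' i) w * (1 - ?g (s (Suc i)) w)" for w
          by (auto simp: D'_def indicator_def)
      qed
      also have "\<dots> = (\<integral>w. indicator (D' i) w * (1 - ?f w) \<partial>M)"
        by (rule int_1[OF D' s0, symmetric])
      also have "\<dots> = (\<integral>w. indicator (D' i) w * ?q w \<partial>M)"
      proof (rule Bochner_Integration.integral_cong[OF refl])
        fix w
        show "indicator (D' i) w * (1 - ?f w) = indicator (D' i) w * ?q w"
          using f01[of w] DA by (auto simp: indicator_def)
      qed
      finally show ?thesis .
    qed
    have "\<delta> / 2 * prob N2 = (\<Sum>i<m. \<delta> / 2 * prob (D' i))"
      unfolding N2_def sum_distrib_left[symmetric]
      using D'[THEN G_sets_M] D'_disj by (subst finite_measure_finite_Union) auto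
    also have "\<dots> \<le> (\<Sum>i<m. \<integral>w. indicator (D' i) w * ?q w \<partial>M)"
      by (rule sum_mono) (use one in auto)
    also have "\<dots> \<le> (\<integral>w. ?q w \<partial>M)"
      by (rule sum_disjoint_integral_le) (use D'[THEN G_sets_M] D'_disj q in auto)
    finally show ?thesis using close by simp
  qed
  show ?thesis
  proof (rule that[of m C "N1 \<union> N2 \<union> V m"])
    show "0 < m" by (rule m)
    show "C i \<in> sets (G (ennreal (mesh a b m i)))" for i using C[of i] by (simp add: s_def)
    show "ennreal (mesh a b m i) < \<tau> w" if "w \<in> C i" for i w using that by (simp add: C_def s_def)
    show "N1 \<union> N2 \<union> V m \<in> events" using N1 N2 V by auto
    have "prob (N1 \<union> N2 \<union> V m) \<le> prob N1 + prob N2 + prob (V m)"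
      using measure_Un_le[of "N1 \<union> N2" M "V m"] measure_Un_le[of N1 M N2] N1 N2 V[of m] by auto
    also have "\<dots> \<le> \<epsilon>"
    proof -
      have "prob N2 \<le> \<epsilon> / 4" using pN2 \<epsilon> by (simp add: \<delta>_def \<eta>_def field_simps)
      moreover have "\<delta> + \<eta> \<le> \<epsilon> / 2" using \<epsilon> by (simp add: \<delta>_def \<eta>_def) (use mult_left_mono[of \<epsilon> 1 \<epsilon>] in linarith)
      ultimately show ?thesis using pN1 m(1) by linarith
    qed
    finally show "prob (N1 \<union> N2 \<union> V m) \<le> \<epsilon>" .
    show "\<tau> w \<le> ennreal b" if "i < m" "w \<in> C i - (N1 \<union> N2 \<union> V m)" for i w
      using that by (auto simp: N1_def A_def C_def)
    show "w \<in> C i" if i: "i < m" and w: "w \<in> space M - (N1 \<union> N2 \<union> V m)" and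
      t: "ennreal (mesh a b m i) < \<tau> w" "\<tau> w \<le> ennreal (mesh a b m (Suc i))" for i w
    proof -
      have "w \<notin> D' i" using w i by (auto simp: N2_def)
      then have "1 - \<delta> / 2 < ?g (s (Suc i)) w" using w t by (auto simp: D'_def s_def)
      moreover have "\<bar>?g (s (Suc i)) w - ?g (s i) w\<bar> < \<delta> / 2"
        using w i by (auto simp: V_def s_def not_le)
      ultimately have "1 - \<delta> < ?g (s i) w" by linarith
      then show ?thesis using w t by (auto simp: C_def s_def)
    qed
  qed
qed

text \<open>\<open>[0, n]\<close> is cut into \<open>K = n * (n + 1)\<close> blocks of length
  \<open>1 / (n + 1)\<close>, and \<open>S\<close> is the first alarm, capped at \<open>n\<close>.
  Outside the exceptional set some alarm comes before a positive \<open>\<tau> \<le> n\<close>, and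
  an alarm in a block means that \<open>\<tau>\<close> is at most the end of that block, so it is
  early by at most the block length.\<close>

lemma announcing_approximation:
  assumes \<tau>: "stopping_time G \<tau>" and \<epsilon>: "0 < \<epsilon>"
  shows "\<exists>S. \<exists>N\<in>events. stopping_time G S \<and> prob N \<le> \<epsilon> \<and>
    (\<forall>w\<in>space M - N. (\<tau> w = 0 \<longrightarrow> S w = 0) \<and> (0 < \<tau> w \<longrightarrow> S w < \<tau> w) \<and>
      min (\<tau> w) (ennreal (real n)) \<le> S w + ennreal (1 / real (Suc n)))"
proof -
  define h where "h = 1 / real (Suc n)"
  define K where "K = n * Suc n"
  define t where "t = (\<lambda>k. real k * h)"
  define \<epsilon>' where "\<epsilon>' = min 1 (\<epsilon> / real (Suc K))"
  have h: "0 < h" by (simp add: h_def)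
  have \<epsilon>': "0 < \<epsilon>'" "\<epsilon>' \<le> 1" using \<epsilon> by (auto simp: \<epsilon>'_def)
  have t: "0 \<le> t k" "t k < t (Suc k)" "t (Suc k) = t k + h" for k
    using h by (auto simp: t_def distrib_right)
  have tK: "t K = real n" by (simp add: t_def K_def h_def del: of_nat_Suc mult_Suc_right)
  define P where "P = (\<lambda>k m C N. 0 < m \<and> (\<forall>i<m. C i \<in> sets (G (ennreal (mesh (t k) (t (Suc k)) m i)))) \<and>
      (\<forall>i w. i < m \<longrightarrow> w \<in> C i \<longrightarrow> ennreal (mesh (t k) (t (Suc k)) m i) < \<tau> w) \<and>
      N \<in> events \<and> prob N \<le> \<epsilon>' \<and>
      (\<forall>i w. i < m \<longrightarrow> w \<in> C i - N \<longrightarrow> \<tau> w \<le> ennreal (t (Suc k))) \<and>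
      (\<forall>i w. i < m \<longrightarrow> w \<in> space M - N \<longrightarrow> ennreal (mesh (t k) (t (Suc k)) m i) < \<tau> w \<longrightarrow>
        \<tau> w \<le> ennreal (mesh (t k) (t (Suc k)) m (Suc i)) \<longrightarrow> w \<in> C i))"
  have "\<forall>k. \<exists>m C N. P k m C N"
  proof
    fix k
    show "\<exists>m C N. P k m C N"
      by (rule block_detection[OF \<tau> t(1,2) \<epsilon>', of k]) (unfold P_def, blast)
  qed
  then obtain m C N where "\<forall>k. P k (m k) (C k) (N k)" by metis
  then have P: "0 < m k" "i < m k \<Longrightarrow> C k i \<in> sets (G (ennreal (mesh (t k) (t (Suc k)) (m k) i)))"
    "i < m k \<Longrightarrow> w \<in> C k i \<Longrightarrow> ennreal (mesh (t k) (t (Suc k)) (m k) i) < \<tau> w"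
    "N k \<in> events" "prob (N k) \<le> \<epsilon>'"
    "i < m k \<Longrightarrow> w \<in> C k i - N k \<Longrightarrow> \<tau> w \<le> ennreal (t (Suc k))"
    "i < m k \<Longrightarrow> w \<in> space M - N k \<Longrightarrow> ennreal (mesh (t k) (t (Suc k)) (m k) i) < \<tau> w \<Longrightarrow>
        \<tau> w \<le> ennreal (mesh (t k) (t (Suc k)) (m k) (Suc i)) \<Longrightarrow> w \<in> C k i" for k i w
    unfolding P_def by blast+
  define I where "I = Sigma {..<K} (\<lambda>k. {..<m k})"
  define v where "v = (\<lambda>(k, i). mesh (t k) (t (Suc k)) (m k) i)"
  \<comment> \<open>The candidate 0 is present only if \<open>\<tau> w = 0\<close>, which is known
    at time 0; the candidate \<open>n\<close> is the cap and makes the minimum exist.\<close>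
  define W where "W = (\<lambda>w. insert (ennreal (real n)) ({x. x = 0 \<and> \<tau> w = 0} \<union> (\<lambda>p. ennreal (v p)) ` {p \<in> I. w \<in> C (fst p) (snd p)}))"
  define S where "S = (\<lambda>w. Min (W w))"
  have fI: "finite I" by (simp add: I_def)
  have fW: "finite (W w)" "W w \<noteq> {}" for w using fI by (auto simp: W_def)
  have v0: "0 \<le> v p" for p using t by (auto simp: v_def mesh_def split: prod.split intro!: add_nonneg_nonneg mult_nonneg_nonneg less_imp_le)
  have "stopping_time G S"
    unfolding stopping_time_iff
  proof (intro allI impI)
    fix r :: real assume r: "0 \<le> r"
    have "S w \<le> ennreal r \<longleftrightarrow> (\<exists>x\<in>W w. x \<le> ennreal r)" for w
      unfolding S_def by (rule Min_le_iff[OF fW])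
    moreover have "(\<exists>x\<in>W w. x \<le> ennreal r) \<longleftrightarrow>
        real n \<le> r \<or> \<tau> w = 0 \<or> (\<exists>p\<in>I. v p \<le> r \<and> w \<in> C (fst p) (snd p))" for w
    proof -
      have "ennreal (v p) \<le> ennreal r \<longleftrightarrow> v p \<le> r" "ennreal (real n) \<le> ennreal r \<longleftrightarrow> real n \<le> r" for p
        using r by auto
      then show ?thesis unfolding W_def by auto
    qed
    ultimately have "{w \<in> space M. S w \<le> ennreal r} =
      (if real n \<le> r then space M else {}) \<union> {w \<in> space M. \<tau> w \<le> ennreal 0} \<union> (\<Union>p\<in>{p \<in> I. v p \<le> r}. C (fst p) (snd p) \<inter> space M)"
      by auto
    also have "\<dots> \<in> sets (G (ennreal r))"
    proof (intro sets.Un sets.finite_UN)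
      show "(if real n \<le> r then space M else {}) \<in> sets (G (ennreal r))"
        using sets.top[of "G (ennreal r)"] by simp
      show "{w \<in> space M. \<tau> w \<le> ennreal 0} \<in> sets (G (ennreal r))"
        using \<tau> r by (intro G_mono[of 0 r]) (auto simp: stopping_time_iff simp del: ennreal_0)
      show "finite {p \<in> I. v p \<le> r}" using fI by simp
      fix p assume p: "p \<in> {p \<in> I. v p \<le> r}"
      obtain k i where ki: "p = (k, i)" by (cases p)
      then have "C k i \<in> sets (G (ennreal (v p)))" using p P(2)[of i k] by (simp add: I_def v_def)
      then have *: "C k i \<in> sets (G (ennreal r))" using p v0 by (intro G_mono[of "v p" r]) auto
      moreover have "C k i \<inter> space M = C k i" using sets.sets_into_space[OF *] by auto
      ultimately show "C (fst p) (snd p) \<inter> space M \<in> sets (G (ennreal r))" by (simp add: ki)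
    qed
    finally show "{w \<in> space M. S w \<le> ennreal r} \<in> sets (G (ennreal r))" .
  qed
  moreover have "(\<Union>k<K. N k) \<in> events" using P(4) by auto
  moreover have "prob (\<Union>k<K. N k) \<le> \<epsilon>"
  proof -
    have "prob (\<Union>k<K. N k) \<le> (\<Sum>k<K. prob (N k))"
      by (rule finite_measure_subadditive_finite) (use P(4) in auto)
    also have "\<dots> \<le> (\<Sum>k<K. \<epsilon> / real (Suc K))" by (rule sum_mono) (use P(5) \<epsilon>'_def in auto)
    also have "\<dots> \<le> \<epsilon>" using \<epsilon> by (simp add: field_simps)
    finally show ?thesis .
  qed
  moreover have "S w = 0" if "\<tau> w = 0" for w
  proof -
    have "S w \<le> 0" unfolding S_def using that fW by (intro Min_le) (auto simp: W_def)
    then show ?thesis by simp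
  qed
  moreover have "S w < \<tau> w" if w: "w \<in> space M - (\<Union>k<K. N k)" and pos: "0 < \<tau> w" for w
  proof (cases "ennreal (real n) < \<tau> w")
    case True
    have "S w \<le> ennreal (real n)" unfolding S_def using fW by (intro Min_le) (auto simp: W_def)
    then show ?thesis using True by simp
  next
    case False
    then have "\<tau> w \<le> ennreal (t K)" by (simp add: tK)
    moreover have "\<not> \<tau> w \<le> ennreal (t 0)" using pos by (simp add: t_def)
    ultimately obtain k where k: "k < K" "\<not> \<tau> w \<le> ennreal (t k)" "\<tau> w \<le> ennreal (t (Suc k))"
      using ex_least_nat_less[of "\<lambda>k. \<tau> w \<le> ennreal (t k)" K] by auto
    let ?s = "mesh (t k) (t (Suc k)) (m k)"
    have "?s 0 = t k" "?s (m k) = t (Suc k)" using P(1)[of k] by (auto simp: mesh_def)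
    then obtain i where i: "i < m k" "\<not> \<tau> w \<le> ennreal (?s i)" "\<tau> w \<le> ennreal (?s (Suc i))"
      using ex_least_nat_less[of "\<lambda>i. \<tau> w \<le> ennreal (?s i)" "m k"] k by auto
    then have "w \<in> C k i" using P(7)[of i k w] w k by (auto simp: not_le)
    then have "S w \<le> ennreal (v (k, i))" unfolding S_def
      using fW i k by (intro Min_le) (auto simp: W_def I_def intro!: image_eqI[of _ _ "(k, i)"])
    also have "\<dots> < \<tau> w" using i by (simp add: v_def not_le)
    finally show ?thesis .
  qed
  moreover have "min (\<tau> w) (ennreal (real n)) \<le> S w + ennreal (1 / real (Suc n))" if w: "w \<in> space M - (\<Union>k<K. N k)" for w
  proof -
    have "S w \<in> W w" unfolding S_def by (rule Min_in[OF fW])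
    then consider "S w = ennreal (real n)" | "\<tau> w = 0" | k i where "k < K" "i < m k" "w \<in> C k i" "S w = ennreal (v (k, i))"
      by (auto simp: W_def I_def)
    then show ?thesis
    proof cases
      case 1
      have "min (\<tau> w) (ennreal (real n)) \<le> ennreal (real n)" by simp
      also have "\<dots> \<le> ennreal (real n) + ennreal (1 / real (Suc n))" by simp
      finally show ?thesis using 1 by simp
    next
      case 2
      then show ?thesis by simp
    next
      case 3
      have "min (\<tau> w) (ennreal (real n)) \<le> \<tau> w" by simp
      also have "\<dots> \<le> ennreal (t (Suc k))" using P(6)[of i k w] 3 w by auto
      also have "\<dots> \<le> ennreal (v (k, i) + h)"
        using mesh_bounds(1)[of "t k" "t (Suc k)" i "m k"] t(2,3)[of k] 3 by (intro ennreal_leI) (auto simp: v_def)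
      also have "\<dots> = S w + ennreal (1 / real (Suc n))" using 3 v0 h by (simp add: h_def ennreal_plus)
      finally show ?thesis .
    qed
  qed
  ultimately show ?thesis by (intro exI[of _ S] bexI[of _ "\<Union>k<K. N k"] conjI ballI impI)
qed

text \<open>Applied path by path. Approximate announcing times need not be ordered, but their tail
  infima are, and the error bounds pass to them because they improve with \<open>m\<close>. For the
  last claim: when \<open>R n < \<tau>\<close>, only finitely many \<open>S m\<close> lie below a
  level strictly between the two, so the infimum is a minimum.\<close>

lemma announcing_limit:
  fixes S :: "nat \<Rightarrow> ennreal"
  assumes zero: "\<And>m. m \<ge> N \<Longrightarrow> \<tau> = 0 \<Longrightarrow> S m = 0"
    and less: "\<And>m. m \<ge> N \<Longrightarrow> 0 < \<tau> \<Longrightarrow> S m < \<tau>"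
    and close: "\<And>m. m \<ge> N \<Longrightarrow> min \<tau> (ennreal (real m)) \<le> S m + ennreal (1 / real (Suc m))"
  defines "R \<equiv> \<lambda>n. INF m\<in>{n..}. S m"
  shows "incseq R" "0 < \<tau> \<Longrightarrow> R n < \<tau>" "R \<longlonglongrightarrow> \<tau>" "R n \<le> r \<Longrightarrow> \<exists>m\<ge>n. S m \<le> r"
proof -
  show inc: "incseq R" unfolding R_def incseq_def by (auto intro!: INF_superset_mono)
  have le: "R n \<le> S m" if "n \<le> m" for n m unfolding R_def by (rule INF_lower) (use that in auto)
  show less': "R n < \<tau>" if "0 < \<tau>" for n
    using le_less_trans[OF le[of n "max n N"] less[of "max n N"]] that by simp
  have R0: "R n = 0" if "\<tau> = 0" for n
    using le[of n "max n N"] zero[of "max n N"] that by simp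
  have R_close: "min \<tau> (ennreal (real n)) \<le> R n + ennreal (1 / real (Suc n))" if n: "n \<ge> N" for n
  proof -
    \<comment> \<open>Truncated subtraction makes this a common lower bound of the single terms,
      which an infimum inherits.\<close>
    have "min \<tau> (ennreal (real n)) - ennreal (1 / real (Suc n)) \<le> R n"
      unfolding R_def
    proof (rule INF_greatest)
      fix m assume m: "m \<in> {n..}"
      have "min \<tau> (ennreal (real n)) \<le> min \<tau> (ennreal (real m))"
        using m by (intro min.mono) (auto simp: ennreal_leI)
      also have "\<dots> \<le> S m + ennreal (1 / real (Suc m))" using close m n by auto
      also have "\<dots> \<le> S m + ennreal (1 / real (Suc n))"
        using m by (intro add_left_mono ennreal_leI) (simp add: frac_le)
      finally show "min \<tau> (ennreal (real n)) - ennreal (1 / real (Suc n)) \<le> S m"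
        by (simp add: ennreal_minus_le_iff add.commute)
    qed
    then show ?thesis by (simp add: ennreal_minus_le_iff add.commute)
  qed
  define L where "L = (SUP n. R n)"
  have RL: "R \<longlonglongrightarrow> L" unfolding L_def by (rule LIMSEQ_SUP[OF inc])
  have "R n \<le> \<tau>" for n using less'[of n] R0[of n] by (cases "\<tau> = 0") (auto simp: zero_less_iff_neq_zero less_imp_le)
  then have "L \<le> \<tau>" unfolding L_def by (rule SUP_least)
  moreover have "\<tau> \<le> L"
  proof (rule ccontr)
    assume "\<not> \<tau> \<le> L"
    then have lt: "L < \<tau>" by simp
    then obtain l where l: "L = ennreal l" "0 \<le> l" by (cases L) auto
    obtain l' where l': "l < l'" "ennreal l' \<le> \<tau>"
    proof (cases \<tau>)
      case (real x)
      then show ?thesis using that[of x] lt l by (auto simp: ennreal_less_iff)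
    next
      case top
      then show ?thesis using that[of "l + 1"] by simp
    qed
    have "eventually (\<lambda>n. 1 / real (Suc n) < l' - l) sequentially"
      using LIMSEQ_inverse_real_of_nat l'(1) by (intro order_tendstoD(2)[of _ 0]) (auto simp: inverse_eq_divide)
    then obtain n1 where n1: "\<And>n. n \<ge> n1 \<Longrightarrow> 1 / real (Suc n) < l' - l" by (auto simp: eventually_sequentially)
    obtain n2 :: nat where n2: "l' \<le> real n2" using real_arch_simple by blast
    define n where "n = max N (max n1 n2)"
    have "ennreal l' \<le> ennreal (real n)" using n2 by (intro ennreal_leI) (simp add: n_def)
    then have "ennreal l' \<le> min \<tau> (ennreal (real n))" using l' by simp
    also have "\<dots> \<le> R n + ennreal (1 / real (Suc n))" by (rule R_close) (simp add: n_def)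
    also have "\<dots> \<le> ennreal l + ennreal (1 / real (Suc n))"
      using SUP_upper[of n UNIV R] l by (intro add_right_mono) (simp add: L_def)
    also have "\<dots> = ennreal (l + 1 / real (Suc n))" using l by (simp add: ennreal_plus)
    finally have "l' \<le> l + 1 / real (Suc n)" using l by (subst (asm) ennreal_le_iff) auto
    moreover have "n1 \<le> n" by (simp add: n_def)
    ultimately show False using n1[of n] by linarith
  qed
  ultimately show lim: "R \<longlonglongrightarrow> \<tau>" using RL by simp
  show "\<exists>m\<ge>n. S m \<le> r" if r: "R n \<le> r"
  proof (cases "\<tau> = 0")
    case True
    then show ?thesis using zero[of "max n N"] by (intro exI[of _ "max n N"]) simp
  next
    case False
    show ?thesis
    proof (rule ccontr)
      assume "\<not> (\<exists>m\<ge>n. S m \<le> r)"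
      then have gt: "r < S m" if "m \<ge> n" for m using that by (meson not_le)
      then have "r \<le> R n" unfolding R_def by (intro INF_greatest) (auto simp: less_imp_le)
      then have "r < \<tau>" using r less'[of n] False by (auto simp: zero_less_iff_neq_zero)
      then have "eventually (\<lambda>m. r < R m) sequentially" using lim by (intro order_tendstoD)
      then obtain m0 where m0: "r < R m0" by (auto simp: eventually_sequentially)
      \<comment> \<open>If every \<open>S m\<close> exceeded \<open>r\<close>, the finitely many
        terms before \<open>m0\<close> and the bound \<open>R m0\<close> for all later ones would
        leave a gap above \<open>r\<close>.\<close>
      define w where "w = Min (insert (R m0) (S ` {n..<m0}))"
      have "r < w" unfolding w_def using gt m0 by (subst Min_gr_iff) auto
      moreover have "w \<le> R n" unfolding R_def
      proof (rule INF_greatest)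
        fix m assume m: "m \<in> {n..}"
        show "w \<le> S m"
        proof (cases "m < m0")
          case True
          then show ?thesis unfolding w_def using m by (intro Min_le) auto
        next
          case False
          have "w \<le> R m0" unfolding w_def by (intro Min_le) auto
          also have "\<dots> \<le> S m" using False by (intro le) simp
          finally show ?thesis .
        qed
      qed
      ultimately show False using r by simp
    qed
  qed
qed

text \<open>The exceptional probabilities \<open>(1/2)^n\<close> are summable, so almost surely all
  but finitely many of the approximate announcing times are good, which is what
  \<open>announcing_limit\<close> asks for.\<close>

lemma stopping_time_announced:
  assumes \<tau>: "stopping_time G \<tau>"
  shows "\<exists>R. (\<forall>n::nat. stopping_time G (R n)) \<and> (AE w in M. incseq (\<lambda>n. R n w) \<and>
    (0 < \<tau> w \<longrightarrow> (\<forall>n. R n w < \<tau> w)) \<and> (\<lambda>n. R n w) \<longlonglongrightarrow> \<tau> w)"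
proof -
  define P where "P = (\<lambda>n S N. stopping_time G S \<and> N \<in> events \<and> prob N \<le> (1/2)^n \<and>
    (\<forall>w\<in>space M - N. (\<tau> w = 0 \<longrightarrow> S w = 0) \<and> (0 < \<tau> w \<longrightarrow> S w < \<tau> w) \<and>
      min (\<tau> w) (ennreal (real n)) \<le> S w + ennreal (1 / real (Suc n))))"
  have "\<forall>n. \<exists>S N. P n S N"
  proof
    fix n :: nat
    have "(0::real) < (1/2)^n" by simp
    from announcing_approximation[OF \<tau> this, of n]
    obtain S N where "N \<in> events" "stopping_time G S \<and> prob N \<le> (1/2)^n \<and>
      (\<forall>w\<in>space M - N. (\<tau> w = 0 \<longrightarrow> S w = 0) \<and> (0 < \<tau> w \<longrightarrow> S w < \<tau> w) \<and>
        min (\<tau> w) (ennreal (real n)) \<le> S w + ennreal (1 / real (Suc n)))"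
      by (elim exE bexE)
    then have "P n S N" unfolding P_def by simp
    then show "\<exists>S N. P n S N" by blast
  qed
  then obtain S N where SN: "\<forall>n. P n (S n) (N n)" by metis
  then have S: "stopping_time G (S n)" and N: "N n \<in> events" "prob (N n) \<le> (1/2)^n" for n
    unfolding P_def by blast+
  have "AE w in M. eventually (\<lambda>n. w \<in> space M - N n) sequentially"
  proof (rule borel_cantelli_AE1)
    show "summable (\<lambda>n. prob (N n))"
    proof (rule summable_comparison_test')
      show "summable (\<lambda>n. (1/2)^n :: real)" by (intro summable_geometric) simp
      show "norm (prob (N n)) \<le> (1/2)^n" for n using N(2)[of n] by simp
    qed
  qed (use N in \<open>auto simp: emeasure_eq_measure\<close>)
  then have ae: "AE w in M. \<exists>n0. \<forall>n\<ge>n0. (\<tau> w = 0 \<longrightarrow> S n w = 0) \<and> (0 < \<tau> w \<longrightarrow> S n w < \<tau> w) \<and>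
      min (\<tau> w) (ennreal (real n)) \<le> S n w + ennreal (1 / real (Suc n))"
  proof eventually_elim
    case (elim w)
    then show ?case using SN unfolding P_def eventually_sequentially by meson
  qed
  \<comment> \<open>This infimum is almost surely attained, hence a stopping time.\<close>
  define R where "R = (\<lambda>n w. INF m\<in>{n..}. S m w)"
  have *: "AE w in M. incseq (\<lambda>n. R n w) \<and> (0 < \<tau> w \<longrightarrow> (\<forall>n. R n w < \<tau> w)) \<and> (\<lambda>n. R n w) \<longlonglongrightarrow> \<tau> w \<and>
      (\<forall>n r. R n w \<le> r \<longrightarrow> (\<exists>m\<ge>n. S m w \<le> r))"
    using ae
  proof eventually_elim
    case (elim w)
    then obtain n0 where n0: "\<And>n. n \<ge> n0 \<Longrightarrow> \<tau> w = 0 \<Longrightarrow> S n w = 0"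
      "\<And>n. n \<ge> n0 \<Longrightarrow> 0 < \<tau> w \<Longrightarrow> S n w < \<tau> w"
      "\<And>n. n \<ge> n0 \<Longrightarrow> min (\<tau> w) (ennreal (real n)) \<le> S n w + ennreal (1 / real (Suc n))" by blast
    show ?case
      using announcing_limit[of n0 "\<tau> w" "\<lambda>m. S m w", OF n0] unfolding R_def by blast
  qed
  have "stopping_time G (R n)" for n
    unfolding stopping_time_iff
  proof (intro allI impI)
    fix r :: real assume r: "0 \<le> r"
    have "(\<Union>m\<in>{n..}. {w \<in> space M. S m w \<le> ennreal r}) \<in> sets (G (ennreal r))"
      using S r by (intro sets.countable_UN'') (auto simp: stopping_time_iff)
    then show "{w \<in> space M. R n w \<le> ennreal r} \<in> sets (G (ennreal r))"
    proof (rule AE_eq_in_natural_filtration[OF complete_measure_M])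
      show "AE w in M. w \<in> (\<Union>m\<in>{n..}. {w \<in> space M. S m w \<le> ennreal r}) \<longleftrightarrow> w \<in> {w \<in> space M. R n w \<le> ennreal r}"
        using *
      proof eventually_elim
        case (elim w)
        have "R n w \<le> S m w" if "n \<le> m" for m unfolding R_def by (rule INF_lower) (use that in auto)
        then have "R n w \<le> ennreal r" if "n \<le> m" "S m w \<le> ennreal r" for m
          using that order_trans by blast
        moreover have "\<exists>m\<in>{n..}. S m w \<le> ennreal r" if "R n w \<le> ennreal r"
          using elim that by (metis atLeast_iff)
        ultimately show ?case by auto
      qed
    qed auto
  qed
  moreover have "AE w in M. incseq (\<lambda>n. R n w) \<and> (0 < \<tau> w \<longrightarrow> (\<forall>n. R n w < \<tau> w)) \<and> (\<lambda>n. R n w) \<longlonglongrightarrow> \<tau> w"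
    using * by eventually_elim blast
  ultimately show ?thesis by (intro exI[of _ R]) blast
qed

end

section \<open>Reduction to the Brownian filtration\<close>

text \<open>An explicit sequence from \<open>a\<close> increasing to \<open>b\<close> without
  reaching it when \<open>a < b\<close>. It is measurable in both endpoints, so it announces a value
  that is already known at \<open>a\<close>.\<close>

definition approach :: "ennreal \<Rightarrow> ennreal \<Rightarrow> nat \<Rightarrow> ennreal" where
  "approach a b n = (if b = \<infinity> then a + ennreal (real n)
     else a + ennreal ((1 - inverse (real (Suc n))) * (enn2real b - enn2real a)))"

lemma approach_ge: "a \<le> approach a b n"
  by (simp add: approach_def)

lemma approach_props:
  assumes "a < b"
  shows "incseq (approach a b)" "approach a b n < b" "approach a b \<longlonglongrightarrow> b"
proof -
  obtain x where x: "a = ennreal x" "0 \<le> x" using assms by (cases a) auto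
  have "incseq (approach a b) \<and> (\<forall>n. approach a b n < b) \<and> approach a b \<longlonglongrightarrow> b"
  proof (cases b)
    case top
    then have eq: "approach a b = (\<lambda>n. ennreal (x + real n))" using x by (auto simp: approach_def ennreal_plus)
    have "filterlim (\<lambda>n. x + real n) at_top sequentially"
      by (rule filterlim_tendsto_add_at_top[OF tendsto_const filterlim_real_sequentially])
    then have "(\<lambda>n. ennreal (x + real n)) \<longlonglongrightarrow> top"
      by (rule filterlim_compose[OF ennreal_tendsto_top_eq_at_top[THEN iffD2, of "\<lambda>x. x" at_top, simplified, OF filterlim_ident]])
    then show ?thesis unfolding eq using top x by (auto simp: incseq_def intro!: ennreal_leI)
  next
    case (real y)
    then have xy: "x < y" using assms x by (simp add: ennreal_less_iff)
    let ?f = "\<lambda>n. x + (1 - inverse (real (Suc n))) * (y - x)"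
    have nn: "0 \<le> 1 - inverse (real (Suc n))" "1 - inverse (real (Suc n)) < 1" for n
      by (auto simp: inverse_le_1_iff)
    have eq: "approach a b = (\<lambda>n. ennreal (?f n))"
    proof
      fix n
      have "0 \<le> (1 - inverse (real (Suc n))) * (y - x)" using nn xy by (intro mult_nonneg_nonneg) auto
      then show "approach a b n = ennreal (?f n)"
        using real x by (simp add: approach_def ennreal_plus del: of_nat_Suc)
    qed
    have "?f \<longlonglongrightarrow> x + (1 - 0) * (y - x)"
      by (intro tendsto_intros LIMSEQ_inverse_real_of_nat)
    then have "(\<lambda>n. ennreal (?f n)) \<longlonglongrightarrow> ennreal y" by (intro tendsto_ennrealI) simp
    moreover have "incseq ?f"
      unfolding incseq_def
    proof (intro allI impI add_left_mono mult_right_mono diff_left_mono)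
      show "inverse (real (Suc n)) \<le> inverse (real (Suc m))" if "m \<le> n" for m n
        using that by (intro le_imp_inverse_le) auto
    qed (use xy in auto)
    moreover have "?f n < y" for n
    proof -
      have "(1 - inverse (real (Suc n))) * (y - x) < 1 * (y - x)"
        using nn xy by (intro mult_strict_right_mono) auto
      then show ?thesis by simp
    qed
    moreover have "0 \<le> ?f n" for n using nn xy x by (intro add_nonneg_nonneg mult_nonneg_nonneg) auto
    ultimately show ?thesis unfolding eq using real xy x by (auto simp: incseq_def ennreal_less_iff intro!: ennreal_leI)
  qed
  then show "incseq (approach a b)" "approach a b n < b" "approach a b \<longlonglongrightarrow> b" by blast+
qed

lemma approach_measurable [measurable]:
  assumes [measurable]: "f \<in> borel_measurable N" "g \<in> borel_measurable N"
  shows "(\<lambda>w. approach (f w) (g w) n) \<in> borel_measurable N"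
  unfolding approach_def by measurable

lemma ennreal_rational_between:
  fixes a b :: ennreal
  assumes "a < b" shows "\<exists>q\<in>\<rat>. 0 \<le> q \<and> a < ennreal q \<and> ennreal q < b"
proof -
  obtain x where x: "a = ennreal x" "0 \<le> x" using assms by (cases a) auto
  obtain y where y: "x < y" "ennreal y \<le> b"
  proof (cases b)
    case (real y)
    then show ?thesis using that[of y] assms x by (auto simp: ennreal_less_iff)
  next
    case top
    then show ?thesis using that[of "x + 1"] by simp
  qed
  obtain q where q: "q \<in> \<rat>" "x < q" "q < y" using Rats_dense_in_real[OF y(1)] by blast
  then have "a < ennreal q" "ennreal q < ennreal y" using x by (auto simp: ennreal_less_iff)
  then show ?thesis using q x y by (intro bexI[of _ q]) auto
qed

section \<open>The traces of the two filtrations before and after the last passage\<close>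

context drifted_setting
begin

abbreviation \<xi> :: "real \<Rightarrow> 'a \<Rightarrow> real" where "\<xi> \<equiv> stopped_drifted B \<mu> z"
abbreviation F :: "ennreal \<Rightarrow> 'a measure" where "F \<equiv> completed_natural_filtration M \<xi>"

lemma F_mono: "s \<le> t \<Longrightarrow> A \<in> sets (F s) \<Longrightarrow> A \<in> sets (F t)"
  using natural_filtration_mono[of s t M \<xi>] by auto

lemma \<xi>_before: "0 \<le> s \<Longrightarrow> ennreal s \<le> \<sigma> w \<Longrightarrow> \<xi> s w = X s w"
  by (simp add: stopped_drifted_def min_absorb1)

lemma \<xi>_after: "\<sigma> w \<le> ennreal s \<Longrightarrow> \<xi> s w = X (enn2real (\<sigma> w)) w"
  by (simp add: stopped_drifted_def min_absorb2)

lemma AE_X_neq: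
  assumes "0 \<le> r" "r < t" shows "AE w in M. X r w \<noteq> X t w"
proof -
  note d = B_increment[OF assms]
  have "AE x in lborel. x \<noteq> - \<mu> * (t - r)" by (rule AE_lborel_singleton)
  then have "AE x in lborel. 0 < ennreal (normal_density 0 (sqrt (t - r)) x) \<longrightarrow> x \<noteq> - \<mu> * (t - r)"
    by eventually_elim simp
  then have "AE w in M. B t w - B r w \<noteq> - \<mu> * (t - r)"
    using distributed_AE2[OF d, of "\<lambda>x. x \<noteq> - \<mu> * (t - r)"] by simp
  then show ?thesis by eventually_elim (auto simp: drifted_def algebra_simps)
qed

text \<open>\<open>\<xi>\<close> is frozen from \<open>\<sigma>\<close> on, so if
  \<open>\<sigma> < t\<close> then \<open>\<xi>\<close> has the same value at \<open>t\<close> and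
  at some rational time before \<open>t\<close>. If \<open>t < \<sigma>\<close>, such a coincidence
  is one of countably many null events, as increments have no atoms. The remaining case
  \<open>\<sigma> = t\<close> is null by the avoidance result for the constant stopping
  time.\<close>

lemma stopping_time_last_passage: "stopping_time F \<sigma>"
  unfolding stopping_time_iff
proof (intro allI impI)
  fix t :: real assume t: "0 \<le> t"
  define Q where "Q = \<rat> \<inter> {0..<t}"
  have cQ: "countable Q" unfolding Q_def by (rule countable_subset[OF _ countable_rat]) auto
  have "(\<Union>r\<in>Q. {w \<in> space M. \<xi> r w = \<xi> t w}) \<in> sets (F (ennreal t))"
  proof (rule sets.countable_UN''[OF cQ])
    fix r assume "r \<in> Q"
    then have [measurable]: "\<xi> r \<in> borel_measurable (F (ennreal t))" "\<xi> t \<in> borel_measurable (F (ennreal t))"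
      using t by (auto intro!: measurable_natural_filtration ennreal_leI simp: Q_def)
    have "{w \<in> space (F (ennreal t)). \<xi> r w = \<xi> t w} \<in> sets (F (ennreal t))" by measurable
    then show "{w \<in> space M. \<xi> r w = \<xi> t w} \<in> sets (F (ennreal t))" by simp
  qed
  then show "{w \<in> space M. \<sigma> w \<le> ennreal t} \<in> sets (F (ennreal t))"
  proof (rule AE_eq_in_natural_filtration[OF complete_measure_M])
    have "AE w in M. \<forall>r\<in>Q. X r w \<noteq> X t w"
      unfolding AE_ball_countable[OF cQ] using AE_X_neq by (auto simp: Q_def)
    then show "AE w in M. w \<in> (\<Union>r\<in>Q. {w \<in> space M. \<xi> r w = \<xi> t w}) \<longleftrightarrow> w \<in> {w \<in> space M. \<sigma> w \<le> ennreal t}"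
      using stopping_time_avoids_last_passage[OF stopping_time_const[of G "ennreal t"]] AE_space
    proof eventually_elim
      case (elim w)
      have ne: "\<sigma> w \<noteq> ennreal t" using elim(2) by auto
      show ?case
      proof (cases "\<sigma> w \<le> ennreal t")
        case True
        then obtain s where s: "\<sigma> w = ennreal s" "0 \<le> s" "s < t"
          using ne t by (cases "\<sigma> w") (auto simp: less_le top_unique)
        obtain r where r: "r \<in> \<rat>" "s < r" "r < t" using Rats_dense_in_real[OF s(3)] by blast
        have "\<xi> r w = \<xi> t w" using \<xi>_after[of w r] \<xi>_after[of w t] s r by (simp add: ennreal_leI)
        moreover have "r \<in> Q" using r s by (auto simp: Q_def)
        ultimately show ?thesis using True elim(3) by blast
      next
        case False
        then have lt: "ennreal t < \<sigma> w" by simp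
        have "\<xi> r w \<noteq> \<xi> t w" if "r \<in> Q" for r
        proof -
          have r: "0 \<le> r" "ennreal r \<le> ennreal t" using that by (auto simp: Q_def ennreal_leI)
          have "\<xi> r w = X r w" "\<xi> t w = X t w"
            using r t less_imp_le[OF lt] order_trans[OF r(2) less_imp_le[OF lt]] by (simp_all add: \<xi>_before)
          then show ?thesis using elim(1) that by simp
        qed
        then show ?thesis using False by blast
      qed
    qed
  qed auto
qed

text \<open>Up to \<open>t < \<sigma>\<close> the processes \<open>\<xi>\<close> and
  \<open>X\<close> coincide. The statement asserts agreement on \<open>t < \<sigma>\<close> and not
  membership of an intersection, because that event depends on the future of
  \<open>B\<close>.\<close>

lemma reduction_to_G:
  assumes "0 \<le> t" "C \<in> sets (F (ennreal t))"
  shows "\<exists>C'\<in>sets (G (ennreal t)). \<forall>w\<in>space M. ennreal t < \<sigma> w \<longrightarrow> (w \<in> C \<longleftrightarrow> w \<in> C')"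
  using assms(2) unfolding sets_natural_filtration[of M \<xi>]
proof induction
  case (Basic C)
  then consider s A where "C = \<xi> s -` A \<inter> space M" "0 \<le> s" "ennreal s \<le> ennreal t" "A \<in> sets borel"
    | "C \<in> null_sets M" by blast
  then show ?case
  proof cases
    case 1
    have "X s -` A \<inter> space (G (ennreal t)) \<in> sets (G (ennreal t))"
      by (rule measurable_sets[OF X_measurable_G[OF 1(2,3)] 1(4)])
    moreover have "\<xi> s w = X s w" if "ennreal t < \<sigma> w" for w
      using that 1 by (intro \<xi>_before) auto
    ultimately show ?thesis using 1 by (intro bexI[of _ "X s -` A \<inter> space M"]) auto
  next
    case 2
    then show ?thesis using null_sets_in_natural_filtration by blast
  qed
next
  case Empty
  then show ?case by (intro bexI[of _ "{}"]) auto
next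
  case (Compl C)
  then obtain C' where C': "C' \<in> sets (G (ennreal t))" "\<forall>w\<in>space M. ennreal t < \<sigma> w \<longrightarrow> (w \<in> C \<longleftrightarrow> w \<in> C')"
    by blast
  have "space M - C' \<in> sets (G (ennreal t))" using sets.compl_sets[OF C'(1)] by simp
  then show ?case using C'(2) by (intro bexI[of _ "space M - C'"]) auto
next
  case (Union C)
  then have "\<forall>i. \<exists>C'. C' \<in> sets (G (ennreal t)) \<and> (\<forall>w\<in>space M. ennreal t < \<sigma> w \<longrightarrow> (w \<in> C i \<longleftrightarrow> w \<in> C'))"
    by blast
  then obtain C' where C': "\<forall>i. C' i \<in> sets (G (ennreal t)) \<and> (\<forall>w\<in>space M. ennreal t < \<sigma> w \<longrightarrow> (w \<in> C i \<longleftrightarrow> w \<in> C' i))"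
    by metis
  then have "(\<Union>i. C' i) \<in> sets (G (ennreal t))" by (intro sets.countable_UN) auto
  then show ?case using C' by (intro bexI[of _ "\<Union>i. C' i"]) auto
qed

lemma after_in_F: "0 \<le> t \<Longrightarrow> {w \<in> space M. ennreal t < \<sigma> w} \<in> sets (F (ennreal t))"
proof -
  assume "0 \<le> t"
  then have "{w \<in> space M. \<sigma> w \<le> ennreal t} \<in> sets (F (ennreal t))"
    using stopping_time_last_passage by (simp add: stopping_time_iff)
  from sets.compl_sets[OF this] have "space M - {w \<in> space M. \<sigma> w \<le> ennreal t} \<in> sets (F (ennreal t))" by simp
  moreover have "space M - {w \<in> space M. \<sigma> w \<le> ennreal t} = {w \<in> space M. ennreal t < \<sigma> w}" by (auto simp: not_le)
  ultimately show ?thesis by metis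
qed

text \<open>The converse direction. Here an intersection can be used, since \<open>\<sigma>\<close>
  is a stopping time of \<open>F\<close>.\<close>

lemma G_before_last_passage:
  assumes t: "0 \<le> t" and "C \<in> sets (G (ennreal t))"
  shows "C \<inter> {w \<in> space M. ennreal t < \<sigma> w} \<in> sets (F (ennreal t))"
  using assms(2) unfolding sets_natural_filtration[of M B]
proof induction
  case (Basic C)
  then consider s A where "C = B s -` A \<inter> space M" "0 \<le> s" "ennreal s \<le> ennreal t" "A \<in> sets borel"
    | "C \<in> null_sets M" by blast
  then show ?case
  proof cases
    case 1
    have "(\<lambda>w. \<xi> s w - \<mu> * s) \<in> borel_measurable (F (ennreal t))"
      by (intro borel_measurable_diff measurable_natural_filtration 1) simp
    from measurable_sets[OF this 1(4)]
    have "(\<lambda>w. \<xi> s w - \<mu> * s) -` A \<inter> space M \<inter> {w \<in> space M. ennreal t < \<sigma> w} \<in> sets (F (ennreal t))"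
      using after_in_F[OF t] by auto
    moreover have "\<xi> s w = X s w" if "ennreal t < \<sigma> w" for w
      using that 1 by (intro \<xi>_before) auto
    then have "(\<lambda>w. \<xi> s w - \<mu> * s) -` A \<inter> space M \<inter> {w \<in> space M. ennreal t < \<sigma> w} =
        C \<inter> {w \<in> space M. ennreal t < \<sigma> w}"
      by (auto simp: 1 drifted_def)
    ultimately show ?thesis by metis
  next
    case 2
    then show ?thesis using null_sets_in_natural_filtration after_in_F[OF t] by blast
  qed
next
  case (Compl C)
  have "(space M - C) \<inter> {w \<in> space M. ennreal t < \<sigma> w} =
      {w \<in> space M. ennreal t < \<sigma> w} - C \<inter> {w \<in> space M. ennreal t < \<sigma> w}" by auto
  also have "\<dots> \<in> sets (F (ennreal t))" using after_in_F[OF t] Compl.IH by (rule sets.Diff)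
  finally show ?case .
next
  case (Union C)
  have "(\<Union>i. C i \<inter> {w \<in> space M. ennreal t < \<sigma> w}) \<in> sets (F (ennreal t))"
    using Union.IH by (intro sets.countable_UN) auto
  then show ?case by simp
qed simp

text \<open>On \<open>\<sigma> \<le> t\<close> the path is constant from \<open>t\<close> on, so
  \<open>\<xi> s\<close> equals \<open>\<xi> (min s t)\<close> and the whole future is known at
  \<open>t\<close>.\<close>

lemma F_after_last_passage:
  assumes t: "0 \<le> t" and "D \<in> sets (F \<infinity>)"
  shows "D \<inter> {w \<in> space M. \<sigma> w \<le> ennreal t} \<in> sets (F (ennreal t))"
  using assms(2) unfolding sets_natural_filtration[of M \<xi> \<infinity>]
proof induction
  have le: "{w \<in> space M. \<sigma> w \<le> ennreal t} \<in> sets (F (ennreal t))"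
    using stopping_time_last_passage t by (simp add: stopping_time_iff)
  {
    case (Basic D)
    then consider s A where "D = \<xi> s -` A \<inter> space M" "0 \<le> s" "A \<in> sets borel" | "D \<in> null_sets M" by blast
    then show ?case
    proof cases
      case 1
      define r where "r = min s t"
      have "\<xi> r \<in> borel_measurable (F (ennreal t))"
        using t 1 by (intro measurable_natural_filtration ennreal_leI) (auto simp: r_def)
      from measurable_sets[OF this 1(3)]
      have "\<xi> r -` A \<inter> space M \<inter> {w \<in> space M. \<sigma> w \<le> ennreal t} \<in> sets (F (ennreal t))"
        using le by auto
      moreover have "\<xi> r w = \<xi> s w" if "\<sigma> w \<le> ennreal t" for w
      proof (cases "s \<le> t")
        case False
        then have "ennreal t \<le> ennreal s" by (intro ennreal_leI) simp
        with that have "\<sigma> w \<le> ennreal s" by (rule order_trans)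
        then show ?thesis using False that \<xi>_after[of w s] \<xi>_after[of w t] by (simp add: r_def)
      qed (simp add: r_def)
      then have "\<xi> r -` A \<inter> space M \<inter> {w \<in> space M. \<sigma> w \<le> ennreal t} = D \<inter> {w \<in> space M. \<sigma> w \<le> ennreal t}"
        by (auto simp: 1)
      ultimately show ?thesis by metis
    next
      case 2
      then show ?thesis using null_sets_in_natural_filtration le by blast
    qed
  next
    case Empty
    then show ?case by simp
  next
    case (Compl D)
    have "(space M - D) \<inter> {w \<in> space M. \<sigma> w \<le> ennreal t} =
        {w \<in> space M. \<sigma> w \<le> ennreal t} - D \<inter> {w \<in> space M. \<sigma> w \<le> ennreal t}" by auto
    also have "\<dots> \<in> sets (F (ennreal t))" using le Compl.IH by (rule sets.Diff)
    finally show ?case .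
  next
    case (Union D)
    have "(\<Union>i. D i \<inter> {w \<in> space M. \<sigma> w \<le> ennreal t}) \<in> sets (F (ennreal t))"
      using Union.IH by (intro sets.countable_UN) auto
    then show ?case by simp
  }
qed

text \<open>For each rational \<open>q\<close> an event \<open>C q\<close> of \<open>G q\<close>
  decides \<open>T \<le> q\<close> correctly as long as \<open>q < \<sigma>\<close>. Flags raised at
  \<open>q \<ge> \<sigma>\<close> may be wrong, but they cannot bring the first flag below
  \<open>\<sigma>\<close>, so nothing before \<open>\<sigma>\<close> is spoiled.\<close>

lemma G_version:
  assumes T: "stopping_time F T"
  obtains \<tau> where "stopping_time G \<tau>"
    "\<And>w. w \<in> space M \<Longrightarrow> T w < \<sigma> w \<Longrightarrow> \<tau> w = T w"
    "\<And>w. w \<in> space M \<Longrightarrow> \<sigma> w \<le> T w \<Longrightarrow> \<sigma> w \<le> \<tau> w"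
proof -
  define Q where "Q = \<rat> \<inter> {0::real..}"
  have cQ: "countable Q" unfolding Q_def by (rule countable_subset[OF _ countable_rat]) auto
  have "\<forall>q. \<exists>C'. q \<in> Q \<longrightarrow> C' \<in> sets (G (ennreal q)) \<and>
     (\<forall>w\<in>space M. ennreal q < \<sigma> w \<longrightarrow> (T w \<le> ennreal q \<longleftrightarrow> w \<in> C'))"
  proof
    fix q
    show "\<exists>C'. q \<in> Q \<longrightarrow> C' \<in> sets (G (ennreal q)) \<and>
     (\<forall>w\<in>space M. ennreal q < \<sigma> w \<longrightarrow> (T w \<le> ennreal q \<longleftrightarrow> w \<in> C'))"
    proof (cases "q \<in> Q")
      case True
      then have q: "0 \<le> q" by (simp add: Q_def)
      then have "{w \<in> space M. T w \<le> ennreal q} \<in> sets (F (ennreal q))"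
        using T by (simp add: stopping_time_iff)
      from reduction_to_G[OF q this] show ?thesis by auto
    qed simp
  qed
  then obtain C where C: "\<forall>q. q \<in> Q \<longrightarrow> C q \<in> sets (G (ennreal q)) \<and>
     (\<forall>w\<in>space M. ennreal q < \<sigma> w \<longrightarrow> (T w \<le> ennreal q \<longleftrightarrow> w \<in> C q))" by metis
  \<comment> \<open>Only the strict events \<open>\<tau> < t\<close> are read off from countably
    many flags; right-continuity of \<open>G\<close> gives \<open>\<tau> \<le> t\<close>. Without
    any flag the value is \<open>\<infinity>\<close>.\<close>
  define \<tau> where "\<tau> = (\<lambda>w. INF q\<in>{q \<in> Q. w \<in> C q}. ennreal q)"
  have less: "{w \<in> space M. \<tau> w < ennreal t} \<in> sets (G (ennreal t))" if t: "0 \<le> t" for t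
  proof -
    have "(\<Union>q\<in>Q \<inter> {..<t}. C q) \<in> sets (G (ennreal t))"
    proof (rule sets.countable_UN'')
      show "countable (Q \<inter> {..<t})" using cQ by blast
      fix q assume "q \<in> Q \<inter> {..<t}"
      then show "C q \<in> sets (G (ennreal t))" using C by (intro G_mono[of q t]) (auto simp: Q_def)
    qed
    moreover have "C q \<subseteq> space M" if "q \<in> Q" for q using C that sets.sets_into_space by fastforce
    then have "{w \<in> space M. \<tau> w < ennreal t} = (\<Union>q\<in>Q \<inter> {..<t}. C q)"
      by (auto simp: \<tau>_def INF_less_iff Q_def ennreal_less_iff)
    ultimately show ?thesis by metis
  qed
  have st: "stopping_time G \<tau>"
    unfolding stopping_time_iff
  proof (intro allI impI)
    fix t :: real assume t: "0 \<le> t"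
    show "{w \<in> space M. \<tau> w \<le> ennreal t} \<in> sets (G (ennreal t))"
    proof (rule G_right_continuous[OF t])
      fix \<epsilon> :: real assume \<epsilon>: "\<epsilon> > 0"
      have "{w \<in> space M. \<tau> w < ennreal (t + \<epsilon> * inverse (real (Suc n)))} \<in> sets (G (ennreal (t + \<epsilon>)))" for n
      proof -
        have "\<epsilon> * inverse (real (Suc n)) \<le> \<epsilon> * 1" using \<epsilon> by (intro mult_left_mono) (auto simp: inverse_le_1_iff)
        then show ?thesis using \<epsilon> t by (intro G_mono[OF _ _ less]) auto
      qed
      then have "(\<Inter>n. {w \<in> space M. \<tau> w < ennreal (t + \<epsilon> * inverse (real (Suc n)))}) \<in> sets (G (ennreal (t + \<epsilon>)))"
        by (intro sets.countable_INT') auto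
      moreover have "(\<Inter>n. {w \<in> space M. \<tau> w < ennreal (t + \<epsilon> * inverse (real (Suc n)))}) = {w \<in> space M. \<tau> w \<le> ennreal t}"
      proof (intro equalityI subsetI)
        fix w assume w: "w \<in> (\<Inter>n. {w \<in> space M. \<tau> w < ennreal (t + \<epsilon> * inverse (real (Suc n)))})"
        have "(\<lambda>n. t + \<epsilon> * inverse (real (Suc n))) \<longlonglongrightarrow> t + \<epsilon> * 0"
          by (intro tendsto_intros LIMSEQ_inverse_real_of_nat)
        then have "(\<lambda>n. ennreal (t + \<epsilon> * inverse (real (Suc n)))) \<longlonglongrightarrow> ennreal t"
          by (intro tendsto_ennrealI) simp
        moreover have "\<tau> w \<le> ennreal (t + \<epsilon> * inverse (real (Suc n)))" for n using w by (auto intro: less_imp_le)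
        ultimately have "\<tau> w \<le> ennreal t" by (intro LIMSEQ_le_const) auto
        then show "w \<in> {w \<in> space M. \<tau> w \<le> ennreal t}" using w by auto
      next
        fix w assume w: "w \<in> {w \<in> space M. \<tau> w \<le> ennreal t}"
        have "ennreal t < ennreal (t + \<epsilon> * inverse (real (Suc n)))" for n
          using t \<epsilon> by (simp add: ennreal_less_iff)
        then show "w \<in> (\<Inter>n. {w \<in> space M. \<tau> w < ennreal (t + \<epsilon> * inverse (real (Suc n)))})"
          using w le_less_trans by blast
      qed
      ultimately show "{w \<in> space M. \<tau> w \<le> ennreal t} \<in> sets (G (ennreal (t + \<epsilon>)))" by metis
    qed
  qed
  have lower: "min (T w) (\<sigma> w) \<le> \<tau> w" if w: "w \<in> space M" for w
    unfolding \<tau>_def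
  proof (rule INF_greatest)
    fix q assume q: "q \<in> {q \<in> Q. w \<in> C q}"
    show "min (T w) (\<sigma> w) \<le> ennreal q"
      using C w q by (cases "ennreal q < \<sigma> w") (auto simp: min_le_iff_disj not_less)
  qed
  have upper: "\<tau> w \<le> T w" if w: "w \<in> space M" and lt: "T w < \<sigma> w" for w
  proof (rule ccontr)
    assume "\<not> \<tau> w \<le> T w"
    then have "T w < min (\<tau> w) (\<sigma> w)" using lt by simp
    then obtain q where q: "q \<in> \<rat>" "0 \<le> q" "T w < ennreal q" "ennreal q < min (\<tau> w) (\<sigma> w)"
      using ennreal_rational_between by blast
    then have "q \<in> Q" "ennreal q < \<sigma> w" by (auto simp: Q_def)
    then have "q \<in> {q \<in> Q. w \<in> C q}" using C w less_imp_le[OF q(3)] by blast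
    then have "\<tau> w \<le> ennreal q" unfolding \<tau>_def by (rule INF_lower)
    then show False using q(4) by (simp add: not_less[symmetric])
  qed
  show ?thesis
  proof (rule that[OF st])
    show "\<tau> w = T w" if "w \<in> space M" "T w < \<sigma> w" for w
      using lower[OF that(1)] upper[OF that] min_absorb1[OF less_imp_le[OF that(2)]] by (simp add: antisym)
    show "\<sigma> w \<le> \<tau> w" if "w \<in> space M" "\<sigma> w \<le> T w" for w
      using lower[OF that(1)] min_absorb2[OF that(2)] by simp
  qed
qed

section \<open>The decomposition\<close>

lemma stopping_time_measurable_top:
  assumes "stopping_time F T" shows "T \<in> borel_measurable (F \<infinity>)"
proof (rule measurable_stopping_time[OF assms])
  show "sets (F t) \<subseteq> sets (F \<infinity>)" for t by (rule natural_filtration_mono) simp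
qed simp

lemma stopping_time_min_measurable:
  assumes T: "stopping_time F T" shows "(\<lambda>w. min (T w) t) \<in> borel_measurable (F t)"
proof (rule borel_measurableI_le)
  fix y
  show "{x \<in> space (F t). min (T x) t \<le> y} \<in> sets (F t)"
  proof (cases "t \<le> y")
    case True
    then have "{x \<in> space (F t). min (T x) t \<le> y} = space (F t)" by (auto simp: min_le_iff_disj)
    then show ?thesis by (metis sets.top)
  next
    case False
    then have "{x \<in> space (F t). min (T x) t \<le> y} = {x \<in> space (F y). T x \<le> y}" by (auto simp: min_le_iff_disj)
    moreover have "{x \<in> space (F y). T x \<le> y} \<in> sets (F y)"
      using stopping_timeD[OF T, of y] by (simp add: pred_def)
    moreover have "y \<le> t" using False by simp
    ultimately show ?thesis by (metis F_mono)
  qed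
qed

lemma stopping_times_equal_in_F:
  assumes T: "stopping_time F T" and S: "stopping_time F S" and t: "0 \<le> t"
  shows "{w \<in> space M. T w \<le> ennreal t \<and> T w = S w} \<in> sets (F (ennreal t))"
proof -
  note [measurable] = stopping_time_min_measurable[OF T, of "ennreal t"] stopping_time_min_measurable[OF S, of "ennreal t"]
  have "{w \<in> space (F (ennreal t)). min (T w) (ennreal t) = min (S w) (ennreal t)} \<in> sets (F (ennreal t))"
    by measurable
  moreover have "{w \<in> space M. T w \<le> ennreal t} \<in> sets (F (ennreal t))" "{w \<in> space M. S w \<le> ennreal t} \<in> sets (F (ennreal t))"
    using T S t by (auto simp: stopping_time_iff)
  ultimately have "{w \<in> space M. min (T w) (ennreal t) = min (S w) (ennreal t)} \<inter>
      ({w \<in> space M. T w \<le> ennreal t} \<inter> {w \<in> space M. S w \<le> ennreal t}) \<in> sets (F (ennreal t))"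
    by auto
  also have "{w \<in> space M. min (T w) (ennreal t) = min (S w) (ennreal t)} \<inter>
      ({w \<in> space M. T w \<le> ennreal t} \<inter> {w \<in> space M. S w \<le> ennreal t}) =
      {w \<in> space M. T w \<le> ennreal t \<and> T w = S w}"
    by (auto simp: min_def)
  finally show ?thesis .
qed

lemma stopping_time_restrict_eq:
  assumes T: "stopping_time F T"
  shows "stopping_time F (restrict_time T {w \<in> space M. T w = \<sigma> w})"
    (is "stopping_time F ?T")
  unfolding stopping_time_iff
proof (intro allI impI)
  fix t :: real assume t: "0 \<le> t"
  have "{w \<in> space M. ?T w \<le> ennreal t} =
      {w \<in> space M. T w \<le> ennreal t \<and> T w = \<sigma> w}"
    by (auto simp: restrict_time_def top_unique)
  then show "{w \<in> space M. ?T w \<le> ennreal t} \<in> sets (F (ennreal t))"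
    using stopping_times_equal_in_F[OF T stopping_time_last_passage t] by simp
qed

lemma stopping_time_restrict_neq:
  assumes T: "stopping_time F T"
  shows "stopping_time F (restrict_time T {w \<in> space M. T w \<noteq> \<sigma> w})"
    (is "stopping_time F ?T")
  unfolding stopping_time_iff
proof (intro allI impI)
  fix t :: real assume t: "0 \<le> t"
  have "{w \<in> space M. ?T w \<le> ennreal t} =
      {w \<in> space M. T w \<le> ennreal t} - {w \<in> space M. T w \<le> ennreal t \<and> T w = \<sigma> w}"
    by (auto simp: restrict_time_def top_unique)
  moreover have "{w \<in> space M. T w \<le> ennreal t} \<in> sets (F (ennreal t))"
    using T t by (simp add: stopping_time_iff)
  ultimately show "{w \<in> space M. ?T w \<le> ennreal t} \<in> sets (F (ennreal t))"
    using stopping_times_equal_in_F[OF T stopping_time_last_passage t] by auto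
qed

text \<open>Since \<open>\<sigma>\<close> is positive, on \<open>S = \<sigma>\<close> the announcing
  times are strictly below \<open>\<sigma>\<close>, where they agree with their
  \<open>G\<close>-versions. The supremum of these versions is a \<open>G\<close>-stopping time that
  equals \<open>\<sigma>\<close> there.\<close>

lemma predictable_avoids_last_passage:
  assumes "predictable_time M F S"
  shows "AE w in M. S w = \<sigma> w \<longrightarrow> S w = \<infinity>"
proof -
  obtain R where R: "\<And>n::nat. stopping_time F (R n)"
    "AE w in M. incseq (\<lambda>n. R n w) \<and> (0 < S w \<longrightarrow> (\<forall>n. R n w < S w)) \<and> (\<lambda>n. R n w) \<longlonglongrightarrow> S w"
    using assms unfolding predictable_time_def by blast
  have "\<forall>n. \<exists>\<tau>. stopping_time G \<tau> \<and> (\<forall>w\<in>space M. R n w < \<sigma> w \<longrightarrow> \<tau> w = R n w)"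
    using G_version[OF R(1)] by metis
  then obtain \<tau> where "\<forall>n. stopping_time G (\<tau> n) \<and> (\<forall>w\<in>space M. R n w < \<sigma> w \<longrightarrow> \<tau> n w = R n w)"
    by metis
  then have \<tau>: "stopping_time G (\<tau> n)" "w \<in> space M \<Longrightarrow> R n w < \<sigma> w \<Longrightarrow> \<tau> n w = R n w" for n w
    by blast+
  have "stopping_time G (\<lambda>w. SUP n. \<tau> n w)"
    unfolding stopping_time_iff
  proof (intro allI impI)
    fix t :: real assume t: "0 \<le> t"
    have "(\<Inter>n. {w \<in> space M. \<tau> n w \<le> ennreal t}) \<in> sets (G (ennreal t))"
      using \<tau>(1) t by (intro sets.countable_INT') (auto simp: stopping_time_iff)
    moreover have "(\<Inter>n. {w \<in> space M. \<tau> n w \<le> ennreal t}) = {w \<in> space M. (SUP n. \<tau> n w) \<le> ennreal t}"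
      by (auto simp: SUP_le_iff)
    ultimately show "{w \<in> space M. (SUP n. \<tau> n w) \<le> ennreal t} \<in> sets (G (ennreal t))" by metis
  qed
  from stopping_time_avoids_last_passage[OF this]
  show ?thesis using R(2) AE_last_passage_pos AE_space
  proof eventually_elim
    case (elim w)
    show ?case
    proof
      assume eq: "S w = \<sigma> w"
      then have "R n w < \<sigma> w" for n using elim(2,3) by simp
      then have "(SUP n. \<tau> n w) = (SUP n. R n w)" using \<tau>(2) elim(4) by simp
      also have "\<dots> = S w"
        using LIMSEQ_SUP[of "\<lambda>n. R n w"] elim(2) LIMSEQ_unique by blast
      finally show "S w = \<infinity>" using elim(1) eq by simp
    qed
  qed
qed

lemma totally_inaccessible_restriction:
  assumes T: "stopping_time F T"
  shows "totally_inaccessible_time M F (restrict_time T {w \<in> space M. T w = \<sigma> w})"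
  unfolding totally_inaccessible_time_def
proof (intro conjI allI impI)
  fix S assume S: "predictable_time M F S"
  from predictable_avoids_last_passage[OF S] have "AE w in M. \<not> (restrict_time T {w \<in> space M. T w = \<sigma> w} w = S w \<and> S w < \<infinity>)"
    by eventually_elim (auto simp: restrict_time_def split: if_splits)
  then show "{w \<in> space M. restrict_time T {w \<in> space M. T w = \<sigma> w} w = S w \<and> S w < \<infinity>} \<in> null_sets M"
    unfolding AE_iff_null_sets by simp
qed (rule stopping_time_restrict_eq[OF T])

text \<open>Before \<open>\<sigma>\<close> the time is announced by a sequence announcing its \<open>G\<close>-version; once that sequence
  has passed \<open>\<sigma>\<close>, the whole path of \<open>\<xi>\<close> is known and the value of the time can be approached directly.\<close>

lemma predictable_restriction:
  assumes T: "stopping_time F T"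
  shows "predictable_time M F (restrict_time T {w \<in> space M. T w \<noteq> \<sigma> w})"
proof -
  let ?T = "restrict_time T {w \<in> space M. T w \<noteq> \<sigma> w}"
  obtain \<tau> where \<tau>: "stopping_time G \<tau>"
    "\<And>w. w \<in> space M \<Longrightarrow> T w < \<sigma> w \<Longrightarrow> \<tau> w = T w"
    "\<And>w. w \<in> space M \<Longrightarrow> \<sigma> w \<le> T w \<Longrightarrow> \<sigma> w \<le> \<tau> w"
    using G_version[OF T] by metis
  obtain R where "\<forall>n::nat. stopping_time G (R n)" and R_announces:
    "AE w in M. incseq (\<lambda>n. R n w) \<and> (0 < \<tau> w \<longrightarrow> (\<forall>n. R n w < \<tau> w)) \<and> (\<lambda>n. R n w) \<longlonglongrightarrow> \<tau> w"
    using stopping_time_announced[OF \<tau>(1)] by (elim exE conjE)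
  then have R: "stopping_time G (R n)" for n by blast
  \<comment> \<open>The value of the restricted time whenever \<open>\<sigma> \<le> T\<close>: it is
    \<open>T\<close> after \<open>\<sigma>\<close>, and \<open>\<infinity>\<close> on
    \<open>T = \<sigma>\<close>.\<close>
  define V where "V = (\<lambda>w. if \<sigma> w < T w then T w else \<infinity>)"
  define S where "S = (\<lambda>n w. if R n w < \<sigma> w then R n w else approach (\<sigma> w) (V w) n)"
  have "stopping_time F (S n)" for n
    unfolding stopping_time_iff
  proof (intro allI impI)
    fix t :: real assume t: "0 \<le> t"
    let ?early = "{w \<in> space M. R n w < \<sigma> w \<and> R n w \<le> ennreal t}" and ?late = "{w \<in> space M. approach (\<sigma> w) (V w) n \<le> ennreal t}"
    \<comment> \<open>If \<open>t < \<sigma>\<close>, the time \<open>t\<close> itself is the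
      witness, since no rational need lie between \<open>R n\<close> and \<open>t\<close>; otherwise
      a rational strictly between \<open>R n\<close> and \<open>\<sigma>\<close> serves.\<close>
    define Q where "Q = insert t (\<rat> \<inter> {0..t})"
    have cQ: "countable Q" unfolding Q_def
      by (intro countable_insert countable_subset[OF _ countable_rat]) auto
    let ?U = "(\<Union>q\<in>Q. {w \<in> space M. R n w \<le> ennreal q} \<inter> {w \<in> space M. ennreal q < \<sigma> w})"
    have early: "?early \<in> sets (F (ennreal t))"
    proof -
      have "?U \<in> sets (F (ennreal t))"
      proof (rule sets.countable_UN''[OF cQ])
        fix q assume "q \<in> Q"
        then have q: "0 \<le> q" "ennreal q \<le> ennreal t" using t by (auto simp: Q_def ennreal_leI)
        have "{w \<in> space M. R n w \<le> ennreal q} \<in> sets (G (ennreal q))"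
          using R q by (simp add: stopping_time_iff)
        from F_mono[OF q(2) G_before_last_passage[OF q(1) this]]
        show "{w \<in> space M. R n w \<le> ennreal q} \<inter> {w \<in> space M. ennreal q < \<sigma> w} \<in> sets (F (ennreal t))" .
      qed
      moreover have "?U =
          ?early"
      proof (intro equalityI subsetI)
        fix w assume "w \<in> ?U"
        then obtain q where q: "q \<in> Q" "w \<in> space M" "R n w \<le> ennreal q" "ennreal q < \<sigma> w" by blast
        then have "ennreal q \<le> ennreal t" by (auto simp: Q_def ennreal_leI)
        with q show "w \<in> ?early"
          using le_less_trans order_trans by blast
      next
        fix w assume w: "w \<in> ?early"
        show "w \<in> ?U"
        proof (cases "ennreal t < \<sigma> w")
          case True
          then show ?thesis using w by (intro UN_I[of t]) (auto simp: Q_def)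
        next
          case False
          obtain q where q: "q \<in> \<rat>" "0 \<le> q" "R n w < ennreal q" "ennreal q < \<sigma> w"
            using ennreal_rational_between[of "R n w" "\<sigma> w"] w by blast
          have "ennreal q < ennreal t" using q(4) False by (simp add: not_less less_le_trans)
          then have "q \<in> Q" using q(1,2) by (simp add: Q_def ennreal_less_iff)
          then show ?thesis using q(3,4) w by (intro UN_I[of q]) (auto intro: less_imp_le)
        qed
      qed
      ultimately show ?thesis by metis
    qed
    have "(\<lambda>w. approach (\<sigma> w) (V w) n) \<in> borel_measurable (F \<infinity>)"
    proof -
      have [measurable]: "T \<in> borel_measurable (F \<infinity>)" "\<sigma> \<in> borel_measurable (F \<infinity>)"
        using stopping_time_measurable_top T stopping_time_last_passage by auto
      show ?thesis unfolding V_def by measurable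
    qed
    then have "{w \<in> space (F \<infinity>). approach (\<sigma> w) (V w) n \<le> ennreal t} \<in> sets (F \<infinity>)"
      by measurable
    then have "?late \<in> sets (F \<infinity>)" by simp
    from F_after_last_passage[OF t this]
    \<comment> \<open>On \<open>\<sigma> \<le> t\<close>, having \<open>R n < \<sigma>\<close>
      already forces \<open>R n \<le> t\<close>; removing \<open>?early\<close> thus removes exactly
      the paths on which \<open>S n\<close> takes its first branch.\<close>
    have "?early \<union>
       (?late \<inter> {w \<in> space M. \<sigma> w \<le> ennreal t}
         - ?early) \<in> sets (F (ennreal t))"
      using early by blast
    moreover have "?early \<union>
       (?late \<inter> {w \<in> space M. \<sigma> w \<le> ennreal t}
         - ?early) = {w \<in> space M. S n w \<le> ennreal t}"
    proof -
      have "\<sigma> w \<le> ennreal t" if "approach (\<sigma> w) (V w) n \<le> ennreal t" for w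
        using approach_ge that by (rule order_trans)
      moreover have "R n w \<le> ennreal t" if "R n w < \<sigma> w" "\<sigma> w \<le> ennreal t" for w
        using that by (auto intro: less_imp_le order.strict_trans2)
      ultimately show ?thesis unfolding S_def by (auto split: if_splits)
    qed
    ultimately show "{w \<in> space M. S n w \<le> ennreal t} \<in> sets (F (ennreal t))" by metis
  qed
  moreover have "AE w in M. incseq (\<lambda>n. S n w) \<and> (0 < ?T w \<longrightarrow> (\<forall>n. S n w < ?T w)) \<and> (\<lambda>n. S n w) \<longlonglongrightarrow> ?T w"
    using R_announces stopping_time_avoids_last_passage[OF \<tau>(1)] AE_last_passage_pos AE_space
  proof eventually_elim
    case (elim w)
    then have R\<tau>: "incseq (\<lambda>n. R n w)" "0 < \<tau> w \<Longrightarrow> R n w < \<tau> w" "(\<lambda>n. R n w) \<longlonglongrightarrow> \<tau> w" for n by blast+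
    have R_le: "R n w \<le> \<tau> w" for n by (rule incseq_le[OF R\<tau>(1,3)])
    show ?case
    proof (cases "T w < \<sigma> w")
      case True
      then have eq: "\<tau> w = T w" using \<tau>(2) elim(4) by blast
      then have "R n w < \<sigma> w" for n using R_le[of n] True by simp
      then have "S n w = R n w" for n by (simp add: S_def)
      moreover have "?T w = \<tau> w" using less_imp_neq[OF True] elim(4) eq by (simp add: restrict_time_def)
      ultimately show ?thesis using R\<tau> by simp
    next
      case False
      then have \<sigma>_le: "\<sigma> w \<le> T w" "\<sigma> w \<le> \<tau> w" using \<tau>(3) elim(4) by auto
      have TV: "?T w = V w" using \<sigma>_le(1) elim(4) by (auto simp: restrict_time_def V_def)
      show ?thesis
      proof (cases "\<sigma> w = \<infinity>")
        case True
        \<comment> \<open>\<open>R\<close> stays below an infinite \<open>\<sigma>\<close>, the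
          switch never happens, and \<open>R\<close> announces the value
          \<open>\<infinity>\<close>.\<close>
        then have "\<tau> w = \<infinity>" "V w = \<infinity>" using \<sigma>_le by (auto simp: top_unique V_def)
        moreover from this have "S n w = R n w" for n using R\<tau>(2)[of n] True by (simp add: S_def)
        ultimately show ?thesis using R\<tau> TV by simp
      next
        case fin: False
        \<comment> \<open>Strictness is the avoidance result applied to the
          \<open>G\<close>-version. It makes \<open>R\<close> pass \<open>\<sigma>\<close>
          eventually; with equality \<open>R\<close> would only converge to \<open>\<sigma>\<close>
          from below, and the switch to \<open>approach\<close> would never occur.\<close>
        then have \<sigma>\<tau>: "\<sigma> w < \<tau> w" using \<sigma>_le(2) elim(2) by (auto simp: less_le)
        have \<sigma>V: "\<sigma> w < V w" using fin by (auto simp: V_def less_top)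
        note app = approach_props[OF \<sigma>V]
        have "S n w \<le> S m w" if "n \<le> m" for n m
        proof -
          consider "R m w < \<sigma> w" | "R n w < \<sigma> w" "\<not> R m w < \<sigma> w" | "\<not> R n w < \<sigma> w" "\<not> R m w < \<sigma> w" by blast
          then show ?thesis
          proof cases
            case 1
            have "R n w \<le> R m w" using incseqD[OF R\<tau>(1) that] .
            moreover from this 1 have "R n w < \<sigma> w" by (rule le_less_trans)
            ultimately show ?thesis using 1 by (simp add: S_def)
          next
            case 2
            have "R n w \<le> approach (\<sigma> w) (V w) m"
              using 2(1) approach_ge by (blast intro: less_imp_le order_trans)
            then show ?thesis using 2 by (simp add: S_def)
          next
            case 3
            then show ?thesis using incseqD[OF app(1) that] by (simp add: S_def)
          qed
        qed
        moreover have "S n w < V w" for n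
          using app(2)[of n] less_trans[OF _ \<sigma>V] by (auto simp: S_def)
        moreover have "eventually (\<lambda>n. \<sigma> w < R n w) sequentially" by (rule order_tendstoD(1)[OF R\<tau>(3) \<sigma>\<tau>])
        then have "eventually (\<lambda>n. approach (\<sigma> w) (V w) n = S n w) sequentially"
          by eventually_elim (auto simp: S_def dest: less_asym)
        then have "(\<lambda>n. S n w) \<longlonglongrightarrow> V w" by (rule Lim_transform_eventually[OF app(3)])
        ultimately show ?thesis unfolding TV incseq_def by blast
      qed
    qed
  qed
  ultimately show ?thesis
    unfolding predictable_time_def using stopping_time_restrict_neq[OF T] by blast
qed

end

theorem mainTheorem13:
  fixes M :: "'a measure"
    and B :: "real \<Rightarrow> 'a \<Rightarrow> real"
    and \<mu> z :: real
    and T \<sigma> :: "'a \<Rightarrow> ennreal"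
    and F :: "ennreal \<Rightarrow> 'a measure"
  assumes "prob_space M"
    and "complete_measure M"
    and "brownian_motion M B"
    and "\<mu> > 0"
    and "z > 0"
  defines "\<sigma> \<equiv> last_passage B \<mu> z"
    and "F \<equiv> completed_natural_filtration M (stopped_drifted B \<mu> z)"
  assumes "stopping_time F T"
  shows "(\<forall>\<omega>\<in>space M. T \<omega> = min (restrict_time T {\<omega> \<in> space M. T \<omega> = \<sigma> \<omega>} \<omega>)
                               (restrict_time T {\<omega> \<in> space M. T \<omega> \<noteq> \<sigma> \<omega>} \<omega>)) \<and>
         totally_inaccessible_time M F (restrict_time T {\<omega> \<in> space M. T \<omega> = \<sigma> \<omega>}) \<and>
         predictable_time M F (restrict_time T {\<omega> \<in> space M. T \<omega> \<noteq> \<sigma> \<omega>})"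
proof -
  have "drifted_setting M B \<mu> z"
    using assms(1-5)
    by (simp add: drifted_setting_def brownian_setting_def brownian_setting_axioms_def drifted_setting_axioms_def)
  then interpret drifted_setting M B \<mu> z .
  show ?thesis
    using totally_inaccessible_restriction predictable_restriction assms(8)
    unfolding \<sigma>_def F_def by (auto simp: restrict_time_def)
qed

end
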